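(* Let $M$ be a compact, connected Lie group and let $G = M \times \mathbb{T}^m$. Then every real tube structure on $G$ is equivalent to one defined by left-invariant $1$-forms. That is: if $\omega_1, \dots, \omega_m$ are smooth, closed, real-valued $1$-forms on $M$ and $\mathcal{V} \subset \mathbb{C}TG$ is the associated tube structure, then there exist closed, real-valued, left-invariant $1$-forms $\omega_1^\bullet, \dots, \omega_m^\bullet$ on $M$, with associated tube structure $\mathcal{V}^\bullet \subset \mathbb{C}TG$, and a diffeomorphism $\Psi : G \to G$ such that $\Psi_*(\mathcal{V}_p) = \mathcal{V}^\bullet_{\Psi(p)}$ for every $p \in G$.
   Context: $\mathbb{T}^m = \mathbb{R}^m/2\pi\mathbb{Z}^m$ with usual coordinates $x = (x_1, \dots, x_m)$. Given smooth closed $1$-forms $\omega_1, \dots, \omega_m$ on $M$, the associated tube structure is the subbundle $\mathcal{V} \subset \mathbb{C}T(M \times \mathbb{T}^m)$ whose sections are the complex vector fields annihilated by all the $1$-forms $\zeta_k = \mathrm{d}x_k - \omega_k$, $k \in \{1, \dots, m\}$ (with $\omega_k$ pulled back to $M \times \mathbb{T}^m$). It is called real when the $\omega_k$ are real-valued. Two tube structures $\mathcal{V}, \mathcal{V}^\bullet$ are equivalent if there is a diffeomorphism $\Psi$ of the total space with $\Psi_*(\mathcal{V}_p) = \mathcal{V}^\bullet_{\Psi(p)}$ for every $p$, where $\Psi_*$ is the complex-linear extension of the differential. *)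

theory Defs
  imports "HOL-Analysis.Analysis"
begin

section \<open>Smooth functions between normed spaces\<close>

text \<open>
  Finite-dimensional inner product spaces. In contrast to \<^class>\<open>euclidean_space\<close>, a space of
  dimension 0 is allowed, so that a manifold modelled on such a space may be 0-dimensional.
\<close>

class finite_dim_inner = real_inner +
  assumes finite_dim: "\<exists>B. finite B \<and> (\<forall>x. \<exists>r. x = (\<Sum>b\<in>B. r b *\<^sub>R b))"

instance euclidean_space \<subseteq> finite_dim_inner
  by standard (metis finite_Basis euclidean_representation)

text \<open>The predicates below are meant for open \<open>S\<close>; then they say that \<open>f\<close> is of class $C^k$,
  respectively $C^\infty$, on \<open>S\<close>.\<close>

primrec Ck_on :: "nat \<Rightarrow> 'a::real_normed_vector set \<Rightarrow> ('a \<Rightarrow> 'b::real_normed_vector) \<Rightarrow> bool" where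
  "Ck_on 0 S f \<longleftrightarrow> continuous_on S f"
| "Ck_on (Suc k) S f \<longleftrightarrow> (\<forall>x\<in>S. f differentiable (at x)) \<and>
     (\<forall>v. Ck_on k S (\<lambda>x. frechet_derivative f (at x) v))"

definition smooth_on :: "'a::real_normed_vector set \<Rightarrow> ('a \<Rightarrow> 'b::real_normed_vector) \<Rightarrow> bool" where
  "smooth_on S f \<longleftrightarrow> (\<forall>k. Ck_on k S f)"

section \<open>Manifolds and smooth maps\<close>

text \<open>A chart is a pair of its domain and its coordinate map (whose values outside the domain are
  irrelevant). A manifold is a whole type with an atlas; the atlas need not be maximal.\<close>

type_synonym ('a, 'e) chart = "'a set \<times> ('a \<Rightarrow> 'e)"
type_synonym ('a, 'e) atlas = "('a, 'e) chart set"

abbreviation dom_of :: "('a, 'e) chart \<Rightarrow> 'a set" where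
  "dom_of c \<equiv> fst c"

abbreviation coord :: "('a, 'e) chart \<Rightarrow> 'a \<Rightarrow> 'e" where
  "coord c \<equiv> snd c"

definition param :: "('a, 'e) chart \<Rightarrow> 'e \<Rightarrow> 'a" where
  "param c = inv_into (dom_of c) (coord c)"

definition charts_at :: "('a, 'e) atlas \<Rightarrow> 'a \<Rightarrow> ('a, 'e) chart set" where
  "charts_at A p = {c \<in> A. p \<in> dom_of c}"

definition chart_at :: "('a, 'e) atlas \<Rightarrow> 'a \<Rightarrow> ('a, 'e) chart" where
  "chart_at A p = (SOME c. c \<in> charts_at A p)"

definition smooth_atlas :: "('a::topological_space, 'e::real_normed_vector) atlas \<Rightarrow> bool" where
  "smooth_atlas A \<longleftrightarrow>
     (\<Union>c\<in>A. dom_of c) = UNIV \<and>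
     (\<forall>c\<in>A. open (dom_of c) \<and> open (coord c ` dom_of c) \<and>
        homeomorphism (dom_of c) (coord c ` dom_of c) (coord c) (param c)) \<and>
     (\<forall>c\<in>A. \<forall>d\<in>A. smooth_on (coord c ` (dom_of c \<inter> dom_of d)) (coord d \<circ> param c))"

definition smooth_map ::
  "('a::topological_space, 'e::real_normed_vector) atlas \<Rightarrow>
   ('b::topological_space, 'f::real_normed_vector) atlas \<Rightarrow> ('a \<Rightarrow> 'b) \<Rightarrow> bool" where
  "smooth_map A B F \<longleftrightarrow> continuous_on UNIV F \<and>
     (\<forall>c\<in>A. \<forall>d\<in>B. smooth_on (coord c ` (dom_of c \<inter> F -` dom_of d)) (coord d \<circ> F \<circ> param c))"

definition diffeomorphism ::
  "('a::topological_space, 'e::real_normed_vector) atlas \<Rightarrow>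
   ('b::topological_space, 'f::real_normed_vector) atlas \<Rightarrow> ('a \<Rightarrow> 'b) \<Rightarrow> bool" where
  "diffeomorphism A B F \<longleftrightarrow> bij F \<and> smooth_map A B F \<and> smooth_map B A (inv F)"

definition prod_atlas :: "('a, 'e) atlas \<Rightarrow> ('b, 'f) atlas \<Rightarrow> ('a \<times> 'b, 'e \<times> 'f) atlas" where
  "prod_atlas A B = {(dom_of c \<times> dom_of d, map_prod (coord c) (coord d)) | c d. c \<in> A \<and> d \<in> B}"

section \<open>Tangent vectors and 1-forms\<close>

text \<open>
  A tangent vector at \<open>p\<close> is the family of its coordinate vectors in all charts around \<open>p\<close>,
  subject to the transformation law; it is extended by 0 to all other pairs, so that the family is
  determined by the tangent vector.
\<close>

type_synonym ('a, 'e) tangent = "('a, 'e) chart \<Rightarrow> 'e"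

definition tangent_space ::
  "('a, 'e::real_normed_vector) atlas \<Rightarrow> 'a \<Rightarrow> ('a, 'e) tangent set" where
  "tangent_space A p = {v.
     (\<forall>c. c \<notin> charts_at A p \<longrightarrow> v c = 0) \<and>
     (\<forall>c\<in>charts_at A p. \<forall>d\<in>charts_at A p.
        v d = frechet_derivative (coord d \<circ> param c) (at (coord c p)) (v c))}"

text \<open>The tangent vector at \<open>p\<close> with coordinate vector \<open>e\<close> in the chart \<open>c\<close>.\<close>

definition coord_vector ::
  "('a, 'e::real_normed_vector) atlas \<Rightarrow> ('a, 'e) chart \<Rightarrow> 'a \<Rightarrow> 'e \<Rightarrow> ('a, 'e) tangent" where
  "coord_vector A c p e = (\<lambda>d. if d \<in> charts_at A p
     then frechet_derivative (coord d \<circ> param c) (at (coord c p)) e else 0)"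

text \<open>The differential of \<open>F\<close> at \<open>p\<close>; for smooth \<open>F\<close> it does not depend on the chart chosen
  around \<open>p\<close>.\<close>

definition differential ::
  "('a, 'e::real_normed_vector) atlas \<Rightarrow> ('b, 'f::real_normed_vector) atlas \<Rightarrow> ('a \<Rightarrow> 'b) \<Rightarrow>
   'a \<Rightarrow> ('a, 'e) tangent \<Rightarrow> ('b, 'f) tangent" where
  "differential A B F p v = (\<lambda>d. if d \<in> charts_at B (F p)
     then let c = chart_at A p in
       frechet_derivative (coord d \<circ> F \<circ> param c) (at (coord c p)) (v c)
     else 0)"

text \<open>Complex-valued 1-forms; only the values \<open>\<omega> p v\<close> with \<open>v\<close> tangent at \<open>p\<close> matter.\<close>

type_synonym ('a, 'e) form = "'a \<Rightarrow> ('a, 'e) tangent \<Rightarrow> complex"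

definition one_form :: "('a, 'e::real_normed_vector) atlas \<Rightarrow> ('a, 'e) form \<Rightarrow> bool" where
  "one_form A \<omega> \<longleftrightarrow> (\<forall>p.
     (\<forall>u\<in>tangent_space A p. \<forall>v\<in>tangent_space A p. \<omega> p (\<lambda>c. u c + v c) = \<omega> p u + \<omega> p v) \<and>
     (\<forall>r::real. \<forall>v\<in>tangent_space A p. \<omega> p (\<lambda>c. r *\<^sub>R v c) = complex_of_real r * \<omega> p v))"

text \<open>The coefficient function of \<open>\<omega>\<close> in the chart \<open>c\<close> along the constant direction \<open>e\<close>.\<close>

definition coeff_in ::
  "('a, 'e::real_normed_vector) atlas \<Rightarrow> ('a, 'e) form \<Rightarrow> ('a, 'e) chart \<Rightarrow> 'e \<Rightarrow> 'e \<Rightarrow> complex" where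
  "coeff_in A \<omega> c e x = \<omega> (param c x) (coord_vector A c (param c x) e)"

definition smooth_form :: "('a, 'e::real_normed_vector) atlas \<Rightarrow> ('a, 'e) form \<Rightarrow> bool" where
  "smooth_form A \<omega> \<longleftrightarrow> one_form A \<omega> \<and>
     (\<forall>c\<in>A. \<forall>e. smooth_on (coord c ` dom_of c) (coeff_in A \<omega> c e))"

text \<open>The exterior derivative in the chart \<open>c\<close>, at the point with coordinates \<open>x\<close>, evaluated on
  the vectors with coordinates \<open>e\<close> and \<open>e'\<close>.\<close>

definition ext_deriv_in ::
  "('a, 'e::real_normed_vector) atlas \<Rightarrow> ('a, 'e) form \<Rightarrow> ('a, 'e) chart \<Rightarrow>
   'e \<Rightarrow> 'e \<Rightarrow> 'e \<Rightarrow> complex" where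
  "ext_deriv_in A \<omega> c x e e' =
     frechet_derivative (coeff_in A \<omega> c e') (at x) e - frechet_derivative (coeff_in A \<omega> c e) (at x) e'"

definition closed_form :: "('a, 'e::real_normed_vector) atlas \<Rightarrow> ('a, 'e) form \<Rightarrow> bool" where
  "closed_form A \<omega> \<longleftrightarrow> (\<forall>c\<in>A. \<forall>x\<in>coord c ` dom_of c. \<forall>e e'. ext_deriv_in A \<omega> c x e e' = 0)"

definition real_form :: "('a, 'e::real_normed_vector) atlas \<Rightarrow> ('a, 'e) form \<Rightarrow> bool" where
  "real_form A \<omega> \<longleftrightarrow> (\<forall>p. \<forall>v\<in>tangent_space A p. \<omega> p v \<in> \<real>)"

definition pullback ::
  "('a, 'e::real_normed_vector) atlas \<Rightarrow> ('b, 'f::real_normed_vector) atlas \<Rightarrow> ('a \<Rightarrow> 'b) \<Rightarrow>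
   ('b, 'f) form \<Rightarrow> ('a, 'e) form" where
  "pullback A B F \<omega> = (\<lambda>p v. \<omega> (F p) (differential A B F p v))"

section \<open>Lie groups\<close>

definition lie_group ::
  "('a::{t2_space,second_countable_topology}, 'e::finite_dim_inner) atlas \<Rightarrow>
   ('a \<Rightarrow> 'a \<Rightarrow> 'a) \<Rightarrow> 'a \<Rightarrow> ('a \<Rightarrow> 'a) \<Rightarrow> bool" where
  "lie_group A mul one inve \<longleftrightarrow>
     smooth_atlas A \<and> group mul one inve \<and>
     smooth_map (prod_atlas A A) A (\<lambda>(x, y). mul x y) \<and> smooth_map A A inve"

definition left_invariant ::
  "('a, 'e::real_normed_vector) atlas \<Rightarrow> ('a \<Rightarrow> 'a \<Rightarrow> 'a) \<Rightarrow> ('a, 'e) form \<Rightarrow> bool" where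
  "left_invariant A mul \<omega> \<longleftrightarrow>
     (\<forall>g p. \<forall>v\<in>tangent_space A p. pullback A A (mul g) \<omega> p v = \<omega> p v)"

section \<open>The torus\<close>

quotient_type (overloaded) 'm torus = "real ^ 'm::finite" /
  "\<lambda>x y. \<forall>k. \<exists>n::int. x $ k - y $ k = 2 * pi * of_int n"
proof (rule equivpI)
  show "reflp (\<lambda>x y::real^'m. \<forall>k. \<exists>n::int. x $ k - y $ k = 2 * pi * of_int n)"
    by (rule reflpI) (auto intro: exI[of _ 0])
  show "symp (\<lambda>x y::real^'m. \<forall>k. \<exists>n::int. x $ k - y $ k = 2 * pi * of_int n)"
  proof (rule sympI, rule allI)
    fix x y :: "real^'m" and k
    assume "\<forall>k. \<exists>n::int. x $ k - y $ k = 2 * pi * of_int n"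
    then obtain n :: int where "x $ k - y $ k = 2 * pi * of_int n" by blast
    then have "y $ k - x $ k = 2 * pi * of_int (- n)" by simp
    then show "\<exists>n::int. y $ k - x $ k = 2 * pi * of_int n" by blast
  qed
  show "transp (\<lambda>x y::real^'m. \<forall>k. \<exists>n::int. x $ k - y $ k = 2 * pi * of_int n)"
  proof (rule transpI, rule allI)
    fix x y z :: "real^'m" and k
    assume "\<forall>k. \<exists>n::int. x $ k - y $ k = 2 * pi * of_int n"
      and "\<forall>k. \<exists>n::int. y $ k - z $ k = 2 * pi * of_int n"
    then obtain n n' :: int where "x $ k - y $ k = 2 * pi * of_int n"
      "y $ k - z $ k = 2 * pi * of_int n'" by blast
    then have "x $ k - z $ k = 2 * pi * of_int (n + n')" by (simp add: algebra_simps)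
    then show "\<exists>n::int. x $ k - z $ k = 2 * pi * of_int n" by blast
  qed
qed

instantiation torus :: (finite) topological_space
begin

definition open_torus :: "'a torus set \<Rightarrow> bool" where
  "open_torus U \<longleftrightarrow> open (abs_torus -` U)"

instance
  by standard (auto simp: open_torus_def vimage_Union)

end

text \<open>The charts are the local inverses of the projection from $\mathbb{R}^m$; they are the usual
  coordinates $(x_1, \dots, x_m)$.\<close>

definition torus_atlas :: "('m::finite torus, real ^ 'm) atlas" where
  "torus_atlas = {(abs_torus ` W, inv_into W abs_torus) | W. open W \<and> inj_on abs_torus W}"

text \<open>The form $\mathrm{d}x_k$; transition maps of the torus are locally translations, so that the
  coordinate vector of a tangent vector is the same in all charts.\<close>

definition dx :: "'m::finite \<Rightarrow> ('m torus, real ^ 'm) form" where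
  "dx k = (\<lambda>q w. complex_of_real (w (chart_at torus_atlas q) $ k))"

section \<open>Tube structures\<close>

text \<open>An element \<open>(u, v)\<close> of the complexified tangent space stands for $u + iv$.\<close>

type_synonym ('a, 'e) ctangent = "('a, 'e) tangent \<times> ('a, 'e) tangent"

definition ctangent_space ::
  "('a, 'e::real_normed_vector) atlas \<Rightarrow> 'a \<Rightarrow> ('a, 'e) ctangent set" where
  "ctangent_space A p = tangent_space A p \<times> tangent_space A p"

definition capply :: "('a, 'e) form \<Rightarrow> 'a \<Rightarrow> ('a, 'e) ctangent \<Rightarrow> complex" where
  "capply \<zeta> p Z = \<zeta> p (fst Z) + \<i> * \<zeta> p (snd Z)"

definition cdifferential ::
  "('a, 'e::real_normed_vector) atlas \<Rightarrow> ('b, 'f::real_normed_vector) atlas \<Rightarrow> ('a \<Rightarrow> 'b) \<Rightarrow>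
   'a \<Rightarrow> ('a, 'e) ctangent \<Rightarrow> ('b, 'f) ctangent" where
  "cdifferential A B F p = map_prod (differential A B F p) (differential A B F p)"

abbreviation total_atlas ::
  "('a, 'e) atlas \<Rightarrow> ('a \<times> 'm::finite torus, 'e \<times> (real ^ 'm)) atlas" where
  "total_atlas A \<equiv> prod_atlas A torus_atlas"

definition tube_form ::
  "('a, 'e::real_normed_vector) atlas \<Rightarrow> ('m::finite \<Rightarrow> ('a, 'e) form) \<Rightarrow> 'm \<Rightarrow>
   ('a \<times> 'm torus, 'e \<times> (real ^ 'm)) form" where
  "tube_form A \<omega> k = (\<lambda>p v. pullback (total_atlas A) torus_atlas snd (dx k) p v -
                            pullback (total_atlas A) A fst (\<omega> k) p v)"

definition tube_structure ::
  "('a, 'e::real_normed_vector) atlas \<Rightarrow> ('m::finite \<Rightarrow> ('a, 'e) form) \<Rightarrow>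
   'a \<times> 'm torus \<Rightarrow> ('a \<times> 'm torus, 'e \<times> (real ^ 'm)) ctangent set" where
  "tube_structure A \<omega> p =
     {Z \<in> ctangent_space (total_atlas A) p. \<forall>k. capply (tube_form A \<omega> k) p Z = 0}"

text \<open>Equivalence of subbundles of the complexified tangent bundle, given by their fibres.\<close>

definition equivalent_structures ::
  "('a::topological_space, 'e::real_normed_vector) atlas \<Rightarrow>
   ('a \<Rightarrow> ('a, 'e) ctangent set) \<Rightarrow> ('a \<Rightarrow> ('a, 'e) ctangent set) \<Rightarrow> bool" where
  "equivalent_structures A V V' \<longleftrightarrow>
     (\<exists>\<Psi>. diffeomorphism A A \<Psi> \<and> (\<forall>p. cdifferential A A \<Psi> p ` V p = V' (\<Psi> p)))"

end

theory Submission
  imports Defs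
begin

text \<open>
  Averaging \<open>\<omega>\<close> over left translations gives a left-invariant form \<open>\<omega>'\<close>; if \<open>\<omega>' = \<omega> + df\<close>, then the
  shear \<open>(p, t) \<mapsto> (p, t + f p)\<close> of the total space carries the tube structure of \<open>\<omega>\<close> to that of \<open>\<omega>'\<close>.

  No Haar measure is needed. Let \<open>avg F x\<close> be the weighted mean of the values \<open>F (g x)\<close>, where \<open>g\<close> runs
  through a dense sequence. By uniform continuity and compactness \<open>avg\<close> contracts the oscillation of \<open>F\<close>,
  so its iterates converge to a constant, which is linear in \<open>F\<close> and invariant under right
  translations of \<open>F\<close> because \<open>avg\<close> commutes with them.

  For the exactness of \<open>\<omega>' - \<omega>\<close>, the elements \<open>h\<close> for which \<open>L\<^sub>h\<^sup>*\<omega> - \<omega>\<close> is exact form a set that is closed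
  under multiplication by a neighbourhood of the identity, hence all of the connected group. The
  primitives \<open>c h\<close> that vanish at the identity satisfy \<open>c (h k) p = c h (k p) - c h k + c k p\<close>.
  The mean \<open>f p\<close> of \<open>c h p\<close> over \<open>h\<close> therefore satisfies \<open>f (g p) = f p + f g - c g p\<close>, and differentiating
  this identity shows that \<open>\<omega> + df\<close> is left-invariant. A left-invariant form is smooth, since its
  value at \<open>p\<close> is its value at the identity composed with the differential of the translation by the
  inverse of \<open>p\<close>; hence \<open>f\<close> is smooth as well.
\<close>

text \<open>The averaging operator is convolution with a probability measure whose atoms are dense;
  its iterates are convolutions with the powers of that measure, which converge weakly to Haar
  measure. The translating factor stands on the left because the invariance needed later is under
  \<open>h \<mapsto> h \<star> g\<close>: solving the cocycle identity for its value at
  \<open>g \<star> p\<close> produces exactly this shift. It is not enough to average the forms,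
  since one also needs a primitive of the difference. Averaging primitives of
  \<open>L_h^*\<omega> - \<omega>\<close> provides it without integration over cycles or de Rham
  theory. Their normalisation at the identity removes the free constants, so that they depend
  continuously on \<open>h\<close>. Differentiating under the mean yields just one derivative of the
  potential. Its smoothness is not obtained by repeating this: it is read off from the invariant
  form, whose regularity comes from the group law. Closedness likewise avoids the mean and rests on
  the symmetry of second derivatives.\<close>

section \<open>Linear algebra in finite-dimensional inner product spaces\<close>

lemma finite_dim_orthogonal_basis:
  "\<exists>B::'a::finite_dim_inner set. finite B \<and> (\<forall>x. x = (\<Sum>b\<in>B. (x \<bullet> b / (b \<bullet> b)) *\<^sub>R b))"
proof -
  obtain B0 :: "'a set" where B0: "finite B0" "\<And>x. \<exists>r. x = (\<Sum>b\<in>B0. r b *\<^sub>R b)"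
    using finite_dim by blast
  have sp: "span B0 = UNIV"
  proof (intro equalityI subsetI UNIV_I)
    fix x :: 'a assume "x \<in> UNIV"
    obtain r where "x = (\<Sum>b\<in>B0. r b *\<^sub>R b)" using B0(2) by blast
    then show "x \<in> span B0" by (auto intro: span_sum span_scale span_base)
  qed
  obtain C where C: "finite C" "span C = span B0" "pairwise orthogonal C"
    using basis_orthogonal[OF B0(1)] by blast
  \<comment> \<open>The remainder of the orthogonal expansion is orthogonal to every element of
    \<open>C\<close> and lies in the span of \<open>C\<close>, hence is orthogonal to
    itself.\<close>
  have "x = (\<Sum>b\<in>C. (x \<bullet> b / (b \<bullet> b)) *\<^sub>R b)" for x
  proof -
    let ?y = "x - (\<Sum>b\<in>C. (x \<bullet> b / (b \<bullet> b)) *\<^sub>R b)"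
    have orth: "orthogonal ?y c" if c: "c \<in> C" for c
    proof -
      have "(\<Sum>b\<in>C. (x \<bullet> b / (b \<bullet> b)) *\<^sub>R b) \<bullet> c = (\<Sum>b\<in>C. (x \<bullet> b / (b \<bullet> b)) * (b \<bullet> c))"
        by (simp add: inner_sum_left)
      also have "\<dots> = (\<Sum>b\<in>C. if b = c then (x \<bullet> c / (c \<bullet> c)) * (c \<bullet> c) else 0)"
        using C(3) c by (intro sum.cong) (auto simp: pairwise_def orthogonal_def)
      \<comment> \<open>The orthogonal set may contain 0; its coefficient is a division by 0, hence
        0, and \<open>x \<bullet> 0\<close> is 0 as well.\<close>
      also have "\<dots> = x \<bullet> c"
        using c C(1) by (cases "c = 0") simp_all
      finally show ?thesis by (simp add: orthogonal_def inner_diff_left)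
    qed
    have "?y \<in> span C" using C(2) sp by simp
    from orthogonal_to_span[OF this orth] have "orthogonal ?y ?y" .
    then show ?thesis by (simp add: orthogonal_self)
  qed
  with C(1) show ?thesis by blast
qed

text \<open>Stands in for \<open>Basis\<close>, which \<open>euclidean_space\<close> supplies only
  in positive dimension. The elements are not normalised, hence the quotients by
  \<open>b \<bullet> b\<close>.\<close>

definition fd_basis :: "'a::finite_dim_inner set" where
  "fd_basis = (SOME B. finite B \<and> (\<forall>x. x = (\<Sum>b\<in>B. (x \<bullet> b / (b \<bullet> b)) *\<^sub>R b)))"

lemma finite_fd_basis [simp]: "finite (fd_basis :: 'a::finite_dim_inner set)"
  and fd_expand: "(x::'a) = (\<Sum>b\<in>fd_basis. (x \<bullet> b / (b \<bullet> b)) *\<^sub>R b)"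
  using someI_ex[OF finite_dim_orthogonal_basis[where 'a='a]] unfolding fd_basis_def by blast+

lemma linear_fd_expand:
  fixes f :: "'a::finite_dim_inner \<Rightarrow> 'b::real_vector"
  assumes "linear f"
  shows "f x = (\<Sum>b\<in>fd_basis. (x \<bullet> b / (b \<bullet> b)) *\<^sub>R f b)"
  by (subst fd_expand[of x]) (simp add: linear_sum[OF assms] linear_scale[OF assms])

text \<open>The factor depends on the space alone, so estimates in finitely many directions become
  uniform estimates in all of them.\<close>

lemma linear_fd_bound:
  assumes "linear (f :: 'a::finite_dim_inner \<Rightarrow> 'b::real_normed_vector)"
    and "\<And>b. b \<in> fd_basis \<Longrightarrow> norm (f b) \<le> e"
  shows "norm (f x) \<le> e * (\<Sum>b\<in>(fd_basis::'a set). norm b / (b \<bullet> b)) * norm x"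
proof -
  have "norm (f x) \<le> (\<Sum>b\<in>fd_basis. norm ((x \<bullet> b / (b \<bullet> b)) *\<^sub>R f b))"
    unfolding linear_fd_expand[OF assms(1), of x] by (rule norm_sum)
  also have "\<dots> \<le> (\<Sum>b\<in>(fd_basis::'a set). (norm b / (b \<bullet> b)) * norm x * e)"
  proof (rule sum_mono)
    fix b :: 'a assume b: "b \<in> fd_basis"
    have "\<bar>x \<bullet> b / (b \<bullet> b)\<bar> \<le> (norm b / (b \<bullet> b)) * norm x"
      using Cauchy_Schwarz_ineq2[of x b] by (simp add: divide_right_mono mult.commute)
    then show "norm ((x \<bullet> b / (b \<bullet> b)) *\<^sub>R f b) \<le> (norm b / (b \<bullet> b)) * norm x * e"
      unfolding norm_scaleR real_norm_def using assms(2)[OF b] by (intro mult_mono) auto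
  qed
  also have "\<dots> = e * (\<Sum>b\<in>(fd_basis::'a set). norm b / (b \<bullet> b)) * norm x"
    by (simp add: sum_distrib_left sum_distrib_right mult_ac)
  finally show ?thesis .
qed

lemma linear_fd_bounded:
  assumes "linear (f :: 'a::finite_dim_inner \<Rightarrow> 'b::real_normed_vector)"
  shows "bounded_linear f"
proof -
  have "norm (f b) \<le> Max (insert 0 ((\<lambda>b. norm (f b)) ` fd_basis))" if "b \<in> fd_basis" for b
    using that by (intro Max_ge) auto
  from linear_fd_bound[OF assms this] have "\<exists>K. \<forall>x. norm (f x) \<le> norm x * K"
    by (metis mult.commute)
  then show ?thesis
    using assms by (auto intro: bounded_linear_intro simp: linear_add linear_scale)
qed

text \<open>Puts pairs of coordinate vectors into the class for which \<open>Ck_on_compose\<close>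
  is available, as needed for the chart expression of the multiplication.\<close>

instance prod :: (finite_dim_inner, finite_dim_inner) finite_dim_inner
proof
  let ?B = "(\<lambda>a. (a, 0)) ` fd_basis \<union> (\<lambda>b. (0, b)) ` fd_basis :: ('a \<times> 'b) set"
  have "\<exists>r. x = (\<Sum>b\<in>?B. r b *\<^sub>R b)" for x :: "'a \<times> 'b"
  proof -
    have "span ?B = UNIV"
    proof (intro equalityI subsetI UNIV_I)
      fix z :: "'a \<times> 'b" assume "z \<in> UNIV"
      obtain x y where z: "z = (x, y)" by (cases z)
      have "(x, y) = (\<Sum>b\<in>fd_basis. (x \<bullet> b / (b \<bullet> b)) *\<^sub>R (b, 0)) +
                     (\<Sum>b\<in>fd_basis. (y \<bullet> b / (b \<bullet> b)) *\<^sub>R (0, b))"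
        using fd_expand[of x] fd_expand[of y] by (simp add: prod_eq_iff fst_sum snd_sum)
      also have "\<dots> \<in> span ?B"
        by (intro span_add span_sum span_scale span_base) auto
      finally show "z \<in> span ?B" using z by simp
    qed
    then show ?thesis
      using span_finite[of ?B] by auto
  qed
  then show "\<exists>B::('a \<times> 'b) set. finite B \<and> (\<forall>x. \<exists>r. x = (\<Sum>b\<in>B. r b *\<^sub>R b))"
    by (intro exI[of _ ?B]) auto
qed

subsection \<open>Functions of class Ck\<close>

lemma frechet_derivative_cong_open:
  assumes "open S" "x \<in> S" "\<And>y. y \<in> S \<Longrightarrow> f y = g y"
  shows "frechet_derivative f (at x) = frechet_derivative g (at x)"
proof -
  have "(f has_derivative D) (at x) \<longleftrightarrow> (g has_derivative D) (at x)" for D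
    using assms by (metis has_derivative_transform_within_open)
  then show ?thesis by (simp add: frechet_derivative_def)
qed

lemma differentiable_cong_open:
  assumes "open S" "x \<in> S" "\<And>y. y \<in> S \<Longrightarrow> f y = g y"
  shows "f differentiable (at x) \<longleftrightarrow> g differentiable (at x)"
  unfolding differentiable_def using assms by (metis has_derivative_transform_within_open)

lemma Ck_on_cong:
  assumes "open S" "\<And>x. x \<in> S \<Longrightarrow> f x = g x"
  shows "Ck_on k S f \<longleftrightarrow> Ck_on k S g"
  using assms(2)
proof (induction k arbitrary: f g)
  case 0
  then show ?case by (simp cong: continuous_on_cong)
next
  case (Suc k)
  have "f differentiable (at x) \<longleftrightarrow> g differentiable (at x)" if "x \<in> S" for x
    using differentiable_cong_open[OF assms(1) that] Suc.prems by blast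
  moreover have "Ck_on k S (\<lambda>x. frechet_derivative f (at x) v) \<longleftrightarrow>
      Ck_on k S (\<lambda>x. frechet_derivative g (at x) v)" for v
    using frechet_derivative_cong_open[OF assms(1), of _ f g] Suc.prems by (intro Suc.IH) auto
  ultimately show ?case by simp
qed

lemma Ck_on_eq:
  "open S \<Longrightarrow> Ck_on k S f \<Longrightarrow> (\<And>x. x \<in> S \<Longrightarrow> f x = g x) \<Longrightarrow> Ck_on k S g"
  using Ck_on_cong[of S f g] by simp

lemma Ck_on_subset: "Ck_on k S f \<Longrightarrow> T \<subseteq> S \<Longrightarrow> Ck_on k T f"
  by (induction k arbitrary: f) (auto intro: continuous_on_subset)

text \<open>Smoothness is later checked near one point at a time, in charts adapted to that
  point.\<close>

lemma Ck_on_local: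
  assumes "\<And>x. x \<in> S \<Longrightarrow> \<exists>U. open U \<and> x \<in> U \<and> Ck_on k U f"
  shows "Ck_on k S f"
  using assms
proof (induction k arbitrary: f)
  case 0
  have "isCont f x" if "x \<in> S" for x
    using 0[OF that] by (auto simp: continuous_on_eq_continuous_at)
  then show ?case by (simp add: continuous_at_imp_continuous_on)
next
  case (Suc k)
  then have "f differentiable (at x)" if "x \<in> S" for x
    using that by (metis Ck_on.simps(2))
  moreover have "Ck_on k S (\<lambda>x. frechet_derivative f (at x) v)" for v
    using Suc.prems by (intro Suc.IH) (metis Ck_on.simps(2))
  ultimately show ?case by simp
qed

text \<open>Derivatives are unique, so an explicit formula \<open>D\<close> can replace
  \<open>frechet_derivative\<close>.\<close>

lemma Ck_on_SucI:
  assumes "open S" "\<And>x. x \<in> S \<Longrightarrow> (f has_derivative D x) (at x)"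
    and "\<And>v. Ck_on k S (\<lambda>x. D x v)"
  shows "Ck_on (Suc k) S f"
proof -
  have "Ck_on k S (\<lambda>x. frechet_derivative f (at x) v)" for v
    using assms(3)[of v] frechet_derivative_at[OF assms(2)]
      Ck_on_cong[OF assms(1), of "\<lambda>x. frechet_derivative f (at x) v" "\<lambda>x. D x v" k] by simp
  then show ?thesis using assms(2) by (auto simp: differentiable_def)
qed

lemma Ck_on_SucD:
  assumes "Ck_on (Suc k) S f"
  shows "x \<in> S \<Longrightarrow> (f has_derivative frechet_derivative f (at x)) (at x)"
    and "Ck_on k S (\<lambda>x. frechet_derivative f (at x) v)"
  using assms frechet_derivative_works by auto

lemma Ck_on_Suc_imp: "Ck_on (Suc k) S f \<Longrightarrow> Ck_on k S f"
proof (induction k arbitrary: f)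
  case 0
  then show ?case
    by (auto intro!: continuous_at_imp_continuous_on differentiable_imp_continuous_within)
next
  case (Suc k)
  show ?case
    using Suc.prems Suc.IH by (metis Ck_on.simps(2))
qed

lemma Ck_on_const [simp]: "Ck_on k S (\<lambda>x. c)"
  by (induction k arbitrary: c) simp_all

lemma Ck_on_continuous: "Ck_on k S f \<Longrightarrow> continuous_on S f"
proof (induction k)
  case (Suc k)
  then show ?case using Ck_on_Suc_imp by blast
qed simp

lemma Ck_on_bounded_linear:
  assumes "bounded_linear L" "open S" "Ck_on k S f"
  shows "Ck_on k S (\<lambda>x. L (f x))"
  using assms(3)
proof (induction k arbitrary: f)
  case 0
  then show ?case using bounded_linear.continuous_on[OF assms(1)] by simp
next
  case (Suc k)
  show ?case
    by (rule Ck_on_SucI[OF assms(2) bounded_linear.has_derivative[OF assms(1)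
      Ck_on_SucD(1)[OF Suc.prems]]]) (use Suc in auto)
qed

lemma Ck_on_add:
  assumes "open S" "Ck_on k S f" "Ck_on k S g"
  shows "Ck_on k S (\<lambda>x. f x + g x)"
  using assms(2,3)
proof (induction k arbitrary: f g)
  case 0
  then show ?case by (simp add: continuous_on_add)
next
  case (Suc k)
  show ?case
    by (rule Ck_on_SucI[OF assms(1) has_derivative_add[OF Ck_on_SucD(1)[OF Suc.prems(1)]
      Ck_on_SucD(1)[OF Suc.prems(2)]]]) (use Suc in auto)
qed

lemma Ck_on_diff:
  assumes "open S" "Ck_on k S f" "Ck_on k S g"
  shows "Ck_on k S (\<lambda>x. f x - g x)"
  using Ck_on_add[OF assms(1,2) Ck_on_bounded_linear[OF bounded_linear_minus[OF bounded_linear_ident] assms(1,3)]]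
  by simp

lemma Ck_on_sum:
  assumes "open S" "\<And>i. i \<in> I \<Longrightarrow> Ck_on k S (f i)"
  shows "Ck_on k S (\<lambda>x. \<Sum>i\<in>I. f i x)"
proof (cases "finite I")
  case True
  then show ?thesis using assms(2) by induction (auto intro!: Ck_on_add[OF assms(1)])
qed simp

lemma Ck_on_scaleR:
  assumes "open S" "Ck_on k S r" "Ck_on k S f"
  shows "Ck_on k S (\<lambda>x. r x *\<^sub>R f x)"
  using assms(2,3)
proof (induction k arbitrary: r f)
  case 0
  then show ?case by (simp add: continuous_on_scaleR)
next
  case (Suc k)
  show ?case
  proof (rule Ck_on_SucI[OF assms(1) has_derivative_scaleR[OF Ck_on_SucD(1)[OF Suc.prems(1)]
      Ck_on_SucD(1)[OF Suc.prems(2)]]])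
    show "Ck_on k S (\<lambda>x. r x *\<^sub>R frechet_derivative f (at x) v + frechet_derivative r (at x) v *\<^sub>R f x)" for v
      using Suc.prems Ck_on_Suc_imp[OF Suc.prems(1)] Ck_on_Suc_imp[OF Suc.prems(2)]
      by (intro Ck_on_add[OF assms(1)] Suc.IH) auto
  qed auto
qed

lemma Ck_on_Pair:
  assumes "open S" "Ck_on k S f" "Ck_on k S g"
  shows "Ck_on k S (\<lambda>x. (f x, g x))"
proof -
  have "bounded_linear (\<lambda>x. (x, 0))" "bounded_linear (\<lambda>x. (0, x))"
    by (auto intro: bounded_linear_Pair bounded_linear_ident bounded_linear_zero)
  from Ck_on_add[OF assms(1) Ck_on_bounded_linear[OF this(1) assms(1,2)]
      Ck_on_bounded_linear[OF this(2) assms(1,3)]]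
  show ?thesis by simp
qed

lemma Ck_on_id [simp]: "open S \<Longrightarrow> Ck_on k S (\<lambda>x. x)"
proof (cases k)
  case (Suc j)
  assume "open S"
  then show ?thesis unfolding Suc by (rule Ck_on_SucI[OF _ has_derivative_ident]) auto
qed simp

text \<open>The direction \<open>frechet_derivative f (at x) v\<close> varies with \<open>x\<close>,
  whereas \<open>Ck_on\<close> speaks of fixed directions. Expanding it in \<open>fd_basis\<close>
  leaves scalar functions times derivatives of \<open>g\<close> along fixed vectors, to which the
  induction hypothesis applies.\<close>

lemma Ck_on_compose:
  fixes f :: "'a::real_normed_vector \<Rightarrow> 'b::finite_dim_inner" and g :: "'b \<Rightarrow> 'c::real_normed_vector"
  assumes "open S" "open T" "f ` S \<subseteq> T" "Ck_on k S f" "Ck_on k T g"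
  shows "Ck_on k S (\<lambda>x. g (f x))"
  using assms(4,5)
proof (induction k arbitrary: g)
  case 0
  then show ?case using assms(3) by (auto intro: continuous_on_compose2)
next
  case (Suc k)
  show ?case
  proof (rule Ck_on_SucI[OF assms(1)])
    fix x assume x: "x \<in> S"
    have *: "(g has_derivative frechet_derivative g (at (f x))) (at (f x))"
      using Ck_on_SucD(1)[OF Suc.prems(2)] x assms(3) by auto
    have "((\<lambda>x. g (f x)) has_derivative
        (\<lambda>v. frechet_derivative g (at (f x)) (frechet_derivative f (at x) v))) (at x)"
      using has_derivative_compose[OF Ck_on_SucD(1)[OF Suc.prems(1) x] *] .
    moreover have "linear (frechet_derivative g (at (f x)))"
      using * has_derivative_linear by blast
    ultimately show "((\<lambda>x. g (f x)) has_derivative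
        (\<lambda>v. \<Sum>b\<in>fd_basis. (frechet_derivative f (at x) v \<bullet> b / (b \<bullet> b)) *\<^sub>R frechet_derivative g (at (f x)) b)) (at x)"
      by (simp flip: linear_fd_expand)
  next
    fix v
    have "bounded_linear (\<lambda>y. y \<bullet> b / (b \<bullet> b))" for b :: 'b
      by (rule bounded_linear_divide[THEN bounded_linear_compose, OF bounded_linear_inner_left])
    then show "Ck_on k S (\<lambda>x. \<Sum>b\<in>fd_basis. (frechet_derivative f (at x) v \<bullet> b / (b \<bullet> b)) *\<^sub>R
        frechet_derivative g (at (f x)) b)"
      using Suc.prems Ck_on_Suc_imp[OF Suc.prems(1)]
      by (intro Ck_on_sum Ck_on_scaleR Suc.IH assms(1) Ck_on_bounded_linear[where L = "\<lambda>y. y \<bullet> b / (b \<bullet> b)" for b]) auto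
  qed
qed

lemma smooth_on_cong:
  "open S \<Longrightarrow> (\<And>x. x \<in> S \<Longrightarrow> f x = g x) \<Longrightarrow> smooth_on S f \<Longrightarrow> smooth_on S g"
  unfolding smooth_on_def using Ck_on_eq[of S _ f g] by simp

lemma smooth_on_compose:
  fixes f :: "'a::real_normed_vector \<Rightarrow> 'b::finite_dim_inner" and g :: "'b \<Rightarrow> 'c::real_normed_vector"
  assumes "open S" "open T" "f ` S \<subseteq> T" "smooth_on S f" "smooth_on T g"
  shows "smooth_on S (\<lambda>x. g (f x))"
  using assms by (auto simp: smooth_on_def intro: Ck_on_compose)

lemma smooth_on_diff:
  "open S \<Longrightarrow> smooth_on S f \<Longrightarrow> smooth_on S g \<Longrightarrow> smooth_on S (\<lambda>x. f x - g x)"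
  unfolding smooth_on_def by (blast intro: Ck_on_diff)

lemma smooth_on_differentiable: "smooth_on S f \<Longrightarrow> x \<in> S \<Longrightarrow> f differentiable (at x)"
  unfolding smooth_on_def by (metis Ck_on.simps(2))

lemma smooth_on_derivative: "smooth_on S f \<Longrightarrow> smooth_on S (\<lambda>x. frechet_derivative f (at x) v)"
  unfolding smooth_on_def by (metis Ck_on.simps(2))

lemma smooth_onI_derivative:
  assumes "open S" "\<And>x. x \<in> S \<Longrightarrow> (f has_derivative D x) (at x)" "\<And>v. smooth_on S (\<lambda>x. D x v)"
  shows "smooth_on S f"
  unfolding smooth_on_def
proof
  fix k show "Ck_on k S f"
    using Ck_on_SucI[OF assms(1,2), of k] assms(3) Ck_on_Suc_imp unfolding smooth_on_def by blast
qed

lemma smooth_on_continuous: "smooth_on S f \<Longrightarrow> continuous_on S f"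
  unfolding smooth_on_def using Ck_on_continuous by blast

subsection \<open>Derivatives of higher order\<close>

text \<open>Continuity of the directional derivatives upgrades them to a total derivative. This
  serves the radial integral in \<open>poincare_ball\<close>, which is differentiated along one line
  at a time.\<close>

lemma has_derivative_of_directional:
  fixes f :: "'a::finite_dim_inner \<Rightarrow> real"
  assumes "open S" "x0 \<in> S"
    and dir: "\<And>x v. x \<in> S \<Longrightarrow> ((\<lambda>s. f (x + s *\<^sub>R v)) has_real_derivative D x v) (at 0)"
    and lin: "\<And>x. x \<in> S \<Longrightarrow> linear (D x)"
    and cont: "\<And>v. continuous_on S (\<lambda>x. D x v)"
  shows "(f has_derivative D x0) (at x0)"
proof (rule has_derivativeI)
  show "bounded_linear (D x0)" using lin assms(2) linear_fd_bounded by blast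
  \<comment> \<open>Adding 1 keeps \<open>C\<close> positive in dimension 0, where the sum is empty.
    The basis bound carries the factor \<open>C - 1\<close>, which \<open>C\<close> absorbs.\<close>
  define C where "C = (\<Sum>b\<in>(fd_basis::'a set). norm b / (b \<bullet> b)) + 1"
  have C: "C > 0" unfolding C_def by (intro add_nonneg_pos sum_nonneg) auto
  show "((\<lambda>y. (f y - f x0 - D x0 (y - x0)) /\<^sub>R norm (y - x0)) \<longlongrightarrow> 0) (at x0)"
  proof (rule tendstoI)
    fix e :: real assume e: "e > 0"
    have "\<forall>\<^sub>F x in at x0. \<forall>b\<in>fd_basis. dist (D x b) (D x0 b) < e / (2 * C)"
    proof (intro eventually_ball_finite ballI)
      fix b :: 'a
      have "isCont (\<lambda>x. D x b) x0"
        using cont[of b] assms(1,2) by (simp add: continuous_on_eq_continuous_at)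
      then show "\<forall>\<^sub>F x in at x0. dist (D x b) (D x0 b) < e / (2 * C)"
        using e C by (auto simp: isCont_def intro: tendstoD)
    qed simp
    then obtain r1 where r1: "r1 > 0" "\<And>x. x \<noteq> x0 \<Longrightarrow> dist x x0 < r1 \<Longrightarrow> \<forall>b\<in>fd_basis. dist (D x b) (D x0 b) < e / (2 * C)"
      unfolding eventually_at by blast
    obtain r2 where r2: "r2 > 0" "ball x0 r2 \<subseteq> S" using assms(1,2) openE by blast
    define r where "r = min r1 r2"
    have r: "r > 0" using r1 r2 by (simp add: r_def)
    have bd: "\<bar>D x v - D x0 v\<bar> \<le> e / 2 * norm v" if "x \<in> ball x0 r" for x v
    proof -
      have "x \<in> S" using that r2 by (auto simp: r_def)
      then have "linear (\<lambda>v. D x v - D x0 v)"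
        using lin assms(2) by (intro linear_compose_sub) auto
      moreover have "norm (D x b - D x0 b) \<le> e / (2 * C)" if "b \<in> fd_basis" for b
        using r1(2)[of x] that \<open>x \<in> ball x0 r\<close> e C by (cases "x = x0") (auto simp: r_def dist_commute dist_real_def intro: less_imp_le)
      ultimately have "norm (D x v - D x0 v) \<le> e / (2 * C) * (C - 1) * norm v"
        using linear_fd_bound[of "\<lambda>v. D x v - D x0 v" "e / (2 * C)" v] by (simp add: C_def)
      also have "\<dots> \<le> e / (2 * C) * C * norm v"
        using e C by (intro mult_right_mono mult_left_mono) auto
      finally show ?thesis using C by simp
    qed
    have "norm ((f y - f x0 - D x0 (y - x0)) /\<^sub>R norm (y - x0)) < e" if y: "y \<noteq> x0" "dist y x0 < r" for y
    proof -
      let ?v = "y - x0"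
      have xs: "x0 + s *\<^sub>R ?v \<in> ball x0 r" if "0 \<le> s" "s \<le> 1" for s
      proof -
        have "norm (s *\<^sub>R ?v) \<le> norm ?v" using that by (simp add: mult_left_le_one_le)
        also have "\<dots> < r" using y by (simp add: dist_norm)
        finally show ?thesis by (simp add: dist_norm)
      qed
      \<comment> \<open>Subtracting the linear term makes the mean value theorem produce the
        remainder itself.\<close>
      have der: "((\<lambda>s. f (x0 + s *\<^sub>R ?v) - s * D x0 ?v) has_real_derivative (D (x0 + s *\<^sub>R ?v) ?v - D x0 ?v)) (at s)"
        if "0 \<le> s" "s \<le> 1" for s
      proof -
        have "x0 + s *\<^sub>R ?v \<in> S" using xs[OF that] r2 by (auto simp: r_def)
        from dir[OF this, of ?v]
        have "((\<lambda>u. f (x0 + (s + u) *\<^sub>R ?v)) has_real_derivative D (x0 + s *\<^sub>R ?v) ?v) (at 0)"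
          by (simp add: scaleR_left_distrib add.assoc)
        then have "((\<lambda>u. f (x0 + u *\<^sub>R ?v)) has_real_derivative D (x0 + s *\<^sub>R ?v) ?v) (at s)"
          using DERIV_shift[of "\<lambda>u. f (x0 + u *\<^sub>R ?v)" _ 0 s] by (simp add: add.commute)
        then show ?thesis by (auto intro!: derivative_eq_intros)
      qed
      obtain z where z: "0 < z" "z < 1" and eq: "(f (x0 + 1 *\<^sub>R ?v) - 1 * D x0 ?v) - (f (x0 + 0 *\<^sub>R ?v) - 0 * D x0 ?v)
          = (1 - 0) * (D (x0 + z *\<^sub>R ?v) ?v - D x0 ?v)"
        using MVT2[of 0 1 "\<lambda>s. f (x0 + s *\<^sub>R ?v) - s * D x0 ?v" "\<lambda>s. D (x0 + s *\<^sub>R ?v) ?v - D x0 ?v"] der by auto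
      have "\<bar>f y - f x0 - D x0 ?v\<bar> \<le> e / 2 * norm ?v"
        using bd[OF xs, of z ?v] z eq by simp
      also have "\<dots> < e * norm ?v" using e y by simp
      finally show ?thesis using y by (simp add: field_simps)
    qed
    with r show "\<forall>\<^sub>F y in at x0. dist ((f y - f x0 - D x0 (y - x0)) /\<^sub>R norm (y - x0)) 0 < e"
      unfolding eventually_at by (metis dist_0_norm dist_commute)
  qed
qed

text \<open>Schwarz's theorem by double differences; it is what makes the differential of the
  potential closed.\<close>

lemma mixed_derivatives_symmetric:
  fixes f :: "'a::real_normed_vector \<Rightarrow> real"
  assumes S: "open S" "x \<in> S" and f: "Ck_on 2 S f"
  shows "frechet_derivative (\<lambda>x. frechet_derivative f (at x) a) (at x) b =
         frechet_derivative (\<lambda>x. frechet_derivative f (at x) b) (at x) a"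
proof -
  define D where "D v x = frechet_derivative f (at x) v" for v x
  define H where "H v w x = frechet_derivative (D v) (at x) w" for v w x
  have f2: "Ck_on (Suc (Suc 0)) S f" using f by (simp add: numeral_2_eq_2)
  have df: "(f has_derivative (\<lambda>v. D v x)) (at x)" if "x \<in> S" for x
    using Ck_on_SucD(1)[OF f2 that] by (simp add: D_def)
  have D1: "Ck_on (Suc 0) S (D v)" for v
    using Ck_on_SucD(2)[OF f2, of v] unfolding D_def .
  have dD: "(D v has_derivative (\<lambda>w. H v w x)) (at x)" if "x \<in> S" for x v
    using Ck_on_SucD(1)[OF D1 that] by (simp add: H_def)
  have Hc: "continuous_on S (H v w)" for v w
    using Ck_on_SucD(2)[OF D1, of v w] unfolding H_def by simp
  text \<open>The second difference of \<open>f\<close> along \<open>a\<close> and \<open>b\<close> is a value of \<open>H v w\<close> in both orders.\<close>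
  have mv: "\<exists>s t. 0 < s \<and> s < e \<and> 0 < t \<and> t < e \<and>
      f (x + e *\<^sub>R v + e *\<^sub>R w) - f (x + e *\<^sub>R v) - f (x + e *\<^sub>R w) + f x = e * e * H v w (x + s *\<^sub>R v + t *\<^sub>R w)"
    if e: "e > 0" and in_S: "\<And>s t. 0 \<le> s \<Longrightarrow> s \<le> e \<Longrightarrow> 0 \<le> t \<Longrightarrow> t \<le> e \<Longrightarrow> x + s *\<^sub>R v + t *\<^sub>R w \<in> S"
    for e v w
  proof -
    let ?g = "\<lambda>s. f (x + s *\<^sub>R v + e *\<^sub>R w) - f (x + s *\<^sub>R v + 0 *\<^sub>R w)"
    have fl: "((\<lambda>s. f (x + s *\<^sub>R v + t *\<^sub>R w)) has_real_derivative D v (x + s *\<^sub>R v + t *\<^sub>R w)) (at s)"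
      if "0 \<le> s" "s \<le> e" "0 \<le> t" "t \<le> e" for s t
    proof -
      have l: "((\<lambda>s. x + s *\<^sub>R v + t *\<^sub>R w) has_derivative (\<lambda>s. s *\<^sub>R v)) (at s)"
        by (auto intro!: derivative_eq_intros)
      note d = df[OF in_S[OF that]]
      have "linear (\<lambda>u. D u (x + s *\<^sub>R v + t *\<^sub>R w))" using d has_derivative_linear by blast
      from linear_scale[OF this] show ?thesis using has_derivative_compose[OF l d]
        by (simp add: has_field_derivative_def mult_commute_abs)
    qed
    have "(?g has_real_derivative (D v (x + s *\<^sub>R v + e *\<^sub>R w) - D v (x + s *\<^sub>R v + 0 *\<^sub>R w))) (at s)"
      if "0 \<le> s" "s \<le> e" for s
      using fl[OF that, of e] fl[OF that, of 0] e by (intro DERIV_diff) auto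
    then obtain s where s: "0 < s" "s < e" "?g e - ?g 0 = (e - 0) * (D v (x + s *\<^sub>R v + e *\<^sub>R w) - D v (x + s *\<^sub>R v + 0 *\<^sub>R w))"
      using MVT2[of 0 e ?g "\<lambda>s. D v (x + s *\<^sub>R v + e *\<^sub>R w) - D v (x + s *\<^sub>R v + 0 *\<^sub>R w)"] e by blast
    have "((\<lambda>t. D v (x + s *\<^sub>R v + t *\<^sub>R w)) has_real_derivative H v w (x + s *\<^sub>R v + t *\<^sub>R w)) (at t)"
      if "0 \<le> t" "t \<le> e" for t
    proof -
      have l: "((\<lambda>t. x + s *\<^sub>R v + t *\<^sub>R w) has_derivative (\<lambda>t. t *\<^sub>R w)) (at t)"
        by (auto intro!: derivative_eq_intros)
      note d = dD[OF in_S[of s t], of v]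
      have "linear (\<lambda>u. H v u (x + s *\<^sub>R v + t *\<^sub>R w))" using d that s has_derivative_linear by force
      from linear_scale[OF this] show ?thesis using has_derivative_compose[OF l d] that s
        by (simp add: has_field_derivative_def mult_commute_abs)
    qed
    then obtain t where t: "0 < t" "t < e" "D v (x + s *\<^sub>R v + e *\<^sub>R w) - D v (x + s *\<^sub>R v + 0 *\<^sub>R w) = (e - 0) * H v w (x + s *\<^sub>R v + t *\<^sub>R w)"
      using MVT2[of 0 e "\<lambda>t. D v (x + s *\<^sub>R v + t *\<^sub>R w)" "\<lambda>t. H v w (x + s *\<^sub>R v + t *\<^sub>R w)"] e by blast
    show ?thesis using s t by (intro exI[of _ s] exI[of _ t]) simp
  qed
  have "\<bar>H a b x - H b a x\<bar> \<le> e" if e: "e > 0" for e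
  proof -
    have "(H v w \<longlongrightarrow> H v w x) (nhds x)" for v w
      using Hc[of v w] S by (simp add: continuous_on_eq_continuous_at isCont_def tendsto_at_iff_tendsto_nhds)
    from tendstoD[OF this, of "e / 2"] e
    have "\<forall>\<^sub>F y in nhds x. dist (H a b y) (H a b x) < e / 2 \<and> dist (H b a y) (H b a x) < e / 2 \<and> y \<in> S"
      using S by (intro eventually_conj eventually_nhds_in_open) auto
    then obtain r where r: "r > 0" "\<And>y. dist y x < r \<Longrightarrow> dist (H a b y) (H a b x) < e / 2 \<and> dist (H b a y) (H b a x) < e / 2 \<and> y \<in> S"
      unfolding eventually_nhds_metric by blast
    \<comment> \<open>Points with parameters up to \<open>d\<close> stay within \<open>r / 2\<close>
      of \<open>x\<close>; the summand 1 covers the case that \<open>a\<close> and \<open>b\<close>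
      are both 0.\<close>
    define d where "d = r / (2 * (norm a + norm b + 1))"
    have n: "0 < norm a + norm b + 1" by (intro add_nonneg_pos) auto
    have d: "d > 0" using r n by (simp add: d_def)
    have near: "dist (x + s *\<^sub>R v + t *\<^sub>R w) x < r"
      if "0 \<le> s" "s \<le> d" "0 \<le> t" "t \<le> d" "norm v + norm w = norm a + norm b" for s t v w
    proof -
      have "dist (x + s *\<^sub>R v + t *\<^sub>R w) x = norm (s *\<^sub>R v + t *\<^sub>R w)" by (simp add: dist_norm)
      also have "\<dots> \<le> s * norm v + t * norm w" using that by (intro norm_triangle_le) auto
      also have "\<dots> \<le> d * norm v + d * norm w" using that by (intro add_mono mult_right_mono) auto
      also have "\<dots> = d * (norm a + norm b)" using that by (simp flip: distrib_left)
      also have "\<dots> \<le> d * (norm a + norm b + 1)" using d by simp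
      also have "\<dots> = r / 2" using n by (simp add: d_def field_simps)
      also have "\<dots> < r" using r by simp
      finally show ?thesis .
    qed
    obtain s t where st: "0 < s" "s < d" "0 < t" "t < d"
      "f (x + d *\<^sub>R a + d *\<^sub>R b) - f (x + d *\<^sub>R a) - f (x + d *\<^sub>R b) + f x = d * d * H a b (x + s *\<^sub>R a + t *\<^sub>R b)"
      using mv[OF d, of a b] near[of _ _ a b] r by auto
    obtain s' t' where st': "0 < s'" "s' < d" "0 < t'" "t' < d"
      "f (x + d *\<^sub>R b + d *\<^sub>R a) - f (x + d *\<^sub>R b) - f (x + d *\<^sub>R a) + f x = d * d * H b a (x + s' *\<^sub>R b + t' *\<^sub>R a)"
      using mv[OF d, of b a] near[of _ _ b a] r by auto
    have "d * d * H a b (x + s *\<^sub>R a + t *\<^sub>R b) = d * d * H b a (x + s' *\<^sub>R b + t' *\<^sub>R a)"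
      unfolding st(5)[symmetric] st'(5)[symmetric] by (simp add: add.assoc add.commute[of "d *\<^sub>R a"])
    then have "H a b (x + s *\<^sub>R a + t *\<^sub>R b) = H b a (x + s' *\<^sub>R b + t' *\<^sub>R a)"
      using d by simp
    moreover have "dist (H a b (x + s *\<^sub>R a + t *\<^sub>R b)) (H a b x) < e / 2"
      using r(2) near[of s t a b] st by simp
    moreover have "dist (H b a (x + s' *\<^sub>R b + t' *\<^sub>R a)) (H b a x) < e / 2"
      using r(2) near[of s' t' b a] st' by simp
    ultimately show ?thesis unfolding dist_real_def by linarith
  qed
  then have "\<bar>H a b x - H b a x\<bar> \<le> 0" by (rule field_le_epsilon[where y = 0, unfolded add_0])
  then have "H a b x = H b a x" by simp
  then show ?thesis by (simp add: H_def D_def[abs_def])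
qed

subsection \<open>Charts\<close>

lemma smooth_atlasD:
  assumes "smooth_atlas A" "c \<in> A"
  shows "open (dom_of c)" "open (coord c ` dom_of c)" "continuous_on (dom_of c) (coord c)"
    "continuous_on (coord c ` dom_of c) (param c)"
    "\<And>p. p \<in> dom_of c \<Longrightarrow> param c (coord c p) = p"
    "\<And>x. x \<in> coord c ` dom_of c \<Longrightarrow> coord c (param c x) = x"
    "\<And>x. x \<in> coord c ` dom_of c \<Longrightarrow> param c x \<in> dom_of c"
  using assms by (auto simp: smooth_atlas_def homeomorphism_def)

lemma charts_atD: "c \<in> charts_at A p \<Longrightarrow> c \<in> A \<and> p \<in> dom_of c"
  by (simp add: charts_at_def)

lemma chart_at_in [intro]:
  assumes "smooth_atlas A"
  shows "chart_at A p \<in> charts_at A p"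
proof -
  have "p \<in> (\<Union>c\<in>A. dom_of c)" using assms by (simp add: smooth_atlas_def)
  then have "\<exists>c. c \<in> charts_at A p" unfolding charts_at_def by blast
  then show ?thesis unfolding chart_at_def by (rule someI_ex)
qed

lemma eventually_param:
  assumes "smooth_atlas A" "c \<in> charts_at A p" "open N" "p \<in> N"
  shows "\<forall>\<^sub>F x in nhds (coord c p). x \<in> coord c ` dom_of c \<and> param c x \<in> N"
proof -
  have c: "c \<in> A" "p \<in> dom_of c" using assms(2) by (auto simp: charts_at_def)
  note a = smooth_atlasD[OF assms(1) c(1)]
  have "open (coord c ` dom_of c \<inter> param c -` N)"
    using continuous_open_preimage[OF a(4,2) assms(3)] .
  from eventually_nhds_in_open[OF this, of "coord c p"] show ?thesis
    using a(5)[OF c(2)] c(2) assms(4) by auto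
qed

lemma has_derivative_transform_nhds:
  assumes "(f has_derivative D) (at x)" "\<forall>\<^sub>F y in nhds x. f y = g y"
  shows "(g has_derivative D) (at x)"
  using assms has_derivative_transform_within_open unfolding eventually_nhds by blast

text \<open>\<open>G\<close> takes values in a normed space, so one chain rule serves both
  coordinate expressions of maps and real functions. Continuity of \<open>F\<close> keeps the images
  of nearby points in the domain of \<open>d\<close>.\<close>

lemma has_derivative_param_compose:
  assumes "smooth_atlas A" "smooth_atlas B" "continuous_on UNIV F"
    and c: "c \<in> charts_at A p" and d: "d \<in> charts_at B (F p)"
    and F: "((coord d \<circ> F \<circ> param c) has_derivative D) (at (coord c p))"
    and G: "((G \<circ> param d) has_derivative D') (at (coord d (F p)))"
  shows "((G \<circ> F \<circ> param c) has_derivative (\<lambda>e. D' (D e))) (at (coord c p))"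
proof -
  have p: "param c (coord c p) = p"
    using c smooth_atlasD(5)[OF assms(1)] by (auto simp: charts_at_def)
  have dd: "d \<in> B" "F p \<in> dom_of d" using d by (auto simp: charts_at_def)
  have "open (F -` dom_of d)"
    using open_vimage[OF smooth_atlasD(1)[OF assms(2) dd(1)] assms(3)] .
  from eventually_param[OF assms(1) c this] dd
  have ev: "\<forall>\<^sub>F x in nhds (coord c p). (G \<circ> param d \<circ> (coord d \<circ> F \<circ> param c)) x = (G \<circ> F \<circ> param c) x"
    using smooth_atlasD(5)[OF assms(2) dd(1)] by (auto elim: eventually_mono)
  have "((G \<circ> param d \<circ> (coord d \<circ> F \<circ> param c)) has_derivative (\<lambda>e. D' (D e))) (at (coord c p))"
    using has_derivative_compose[OF F, of "G \<circ> param d" D'] G p by (simp add: o_def)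
  then show ?thesis using ev by (rule has_derivative_transform_nhds)
qed

text \<open>Differentiability at one point is all that differentials require. Global continuity is
  included because the chain rule pulls back chart domains.\<close>

definition mdiff ::
  "('a::topological_space, 'e::real_normed_vector) atlas \<Rightarrow>
   ('b::topological_space, 'f::real_normed_vector) atlas \<Rightarrow> ('a \<Rightarrow> 'b) \<Rightarrow> 'a \<Rightarrow> bool" where
  "mdiff A B F p \<longleftrightarrow> continuous_on UNIV F \<and> (\<forall>c\<in>charts_at A p. \<forall>d\<in>charts_at B (F p).
     (coord d \<circ> F \<circ> param c) differentiable (at (coord c p)))"

lemma mdiff_has_derivative:
  assumes "mdiff A B F p" "c \<in> charts_at A p" "d \<in> charts_at B (F p)"
  shows "((coord d \<circ> F \<circ> param c) has_derivative
    frechet_derivative (coord d \<circ> F \<circ> param c) (at (coord c p))) (at (coord c p))"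
  using assms frechet_derivative_works unfolding mdiff_def by blast

lemma smooth_map_mdiff:
  assumes "smooth_map A B F"
  shows "mdiff A B F p"
  unfolding mdiff_def
proof (intro conjI ballI)
  show "continuous_on UNIV F" using assms by (simp add: smooth_map_def)
  fix c d assume "c \<in> charts_at A p" "d \<in> charts_at B (F p)"
  then have "smooth_on (coord c ` (dom_of c \<inter> F -` dom_of d)) (coord d \<circ> F \<circ> param c)"
    and "coord c p \<in> coord c ` (dom_of c \<inter> F -` dom_of d)"
    using assms by (auto simp: smooth_map_def charts_at_def)
  then show "(coord d \<circ> F \<circ> param c) differentiable (at (coord c p))"
    by (rule smooth_on_differentiable)
qed

lemma smooth_map_id: "smooth_atlas A \<Longrightarrow> smooth_map A A (\<lambda>p. p)"
  by (simp add: smooth_map_def smooth_atlas_def o_def)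

lemma mdiff_id: "smooth_atlas A \<Longrightarrow> mdiff A A (\<lambda>p. p) p"
  using smooth_map_id smooth_map_mdiff by blast

lemma mdiff_comp:
  assumes "smooth_atlas A" "smooth_atlas B" "smooth_atlas C" "mdiff A B F p" "mdiff B C G (F p)"
  shows "mdiff A C (G \<circ> F) p"
    and "\<lbrakk>c \<in> charts_at A p; d \<in> charts_at B (F p); e \<in> charts_at C (G (F p))\<rbrakk> \<Longrightarrow>
      frechet_derivative (coord e \<circ> (G \<circ> F) \<circ> param c) (at (coord c p)) v =
      frechet_derivative (coord e \<circ> G \<circ> param d) (at (coord d (F p)))
        (frechet_derivative (coord d \<circ> F \<circ> param c) (at (coord c p)) v)"
proof -
  have cont: "continuous_on UNIV F" "continuous_on UNIV G" using assms by (auto simp: mdiff_def)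
  have *: "((coord e \<circ> (G \<circ> F) \<circ> param c) has_derivative (\<lambda>v.
      frechet_derivative (coord e \<circ> G \<circ> param d) (at (coord d (F p)))
        (frechet_derivative (coord d \<circ> F \<circ> param c) (at (coord c p)) v))) (at (coord c p))"
    if "c \<in> charts_at A p" "d \<in> charts_at B (F p)" "e \<in> charts_at C (G (F p))" for c d e
    using has_derivative_param_compose[OF assms(1,2) cont(1) that(1,2)
      mdiff_has_derivative[OF assms(4) that(1,2)] mdiff_has_derivative[OF assms(5) that(2,3)]]
    by (simp add: o_def)
  show "mdiff A C (G \<circ> F) p"
    unfolding mdiff_def
  proof (intro conjI ballI)
    show "continuous_on UNIV (G \<circ> F)" using cont by (metis continuous_on_compose continuous_on_subset subset_UNIV)
    show "(coord e \<circ> (G \<circ> F) \<circ> param c) differentiable (at (coord c p))"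
      if "c \<in> charts_at A p" "e \<in> charts_at C ((G \<circ> F) p)" for c e
      using *[OF that(1) chart_at_in[OF assms(2)], of e] that(2) by (auto simp: differentiable_def)
  qed
  show "frechet_derivative (coord e \<circ> (G \<circ> F) \<circ> param c) (at (coord c p)) v =
      frechet_derivative (coord e \<circ> G \<circ> param d) (at (coord d (F p)))
        (frechet_derivative (coord d \<circ> F \<circ> param c) (at (coord c p)) v)"
    if "c \<in> charts_at A p" "d \<in> charts_at B (F p)" "e \<in> charts_at C (G (F p))"
    using frechet_derivative_at[OF *[OF that]] by metis
qed

subsection \<open>Tangent vectors\<close>

text \<open>A transition map is the coordinate expression of the identity, so this is the chain rule
  for the identity composed with itself.\<close>

lemma transition_compose:
  assumes "smooth_atlas A" "c \<in> charts_at A p" "d \<in> charts_at A p" "e \<in> charts_at A p"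
  shows "frechet_derivative (coord e \<circ> param d) (at (coord d p))
      (frechet_derivative (coord d \<circ> param c) (at (coord c p)) v) =
    frechet_derivative (coord e \<circ> param c) (at (coord c p)) v"
  using mdiff_comp(2)[OF assms(1,1,1) mdiff_id[OF assms(1)] mdiff_id[OF assms(1)] assms(2,3,4)]
  by (simp add: o_def)

lemma transition_self:
  assumes "smooth_atlas A" "c \<in> charts_at A p"
  shows "frechet_derivative (coord c \<circ> param c) (at (coord c p)) v = v"
proof -
  have c: "c \<in> A" "p \<in> dom_of c" using assms(2) by (auto simp: charts_at_def)
  have "frechet_derivative (coord c \<circ> param c) (at (coord c p)) = frechet_derivative (\<lambda>x. x) (at (coord c p))"
    using smooth_atlasD[OF assms(1) c(1)] c(2)
    by (intro frechet_derivative_cong_open[of "coord c ` dom_of c"]) auto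
  then show ?thesis by (simp add: frechet_derivative_ident)
qed

lemma coord_vector_self [simp]:
  "smooth_atlas A \<Longrightarrow> c \<in> charts_at A p \<Longrightarrow> coord_vector A c p e c = e"
  by (simp add: coord_vector_def transition_self)

lemma coord_vector_in:
  "smooth_atlas A \<Longrightarrow> c \<in> charts_at A p \<Longrightarrow> coord_vector A c p e \<in> tangent_space A p"
  by (auto simp: tangent_space_def coord_vector_def transition_compose)

lemma tangent_eq_coord_vector:
  assumes "v \<in> tangent_space A p" "c \<in> charts_at A p"
  shows "coord_vector A c p (v c) = v"
proof
  fix d
  have "v d = frechet_derivative (coord d \<circ> param c) (at (coord c p)) (v c)" if "d \<in> charts_at A p"
    using assms that unfolding tangent_space_def by blast
  moreover have "v d = 0" if "d \<notin> charts_at A p"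
    using assms that unfolding tangent_space_def by blast
  ultimately show "coord_vector A c p (v c) d = v d"
    unfolding coord_vector_def by presburger
qed

lemma tangent_eqI:
  assumes "v \<in> tangent_space A p" "w \<in> tangent_space A p" "c \<in> charts_at A p" "v c = w c"
  shows "v = w"
  using assms tangent_eq_coord_vector by metis

lemma linear_transition:
  assumes "smooth_atlas A" "c \<in> charts_at A p" "d \<in> charts_at A p"
  shows "linear (frechet_derivative (coord d \<circ> param c) (at (coord c p)))"
  using mdiff_has_derivative[OF mdiff_id[OF assms(1)] assms(2,3)] has_derivative_linear
  by (auto simp: o_def)

lemma coord_vector_add:
  assumes "smooth_atlas A" "c \<in> charts_at A p"
  shows "coord_vector A c p (e + e') = (\<lambda>d. coord_vector A c p e d + coord_vector A c p e' d)"
  using linear_add[OF linear_transition[OF assms]] by (auto simp: coord_vector_def)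

lemma coord_vector_scale:
  assumes "smooth_atlas A" "c \<in> charts_at A p"
  shows "coord_vector A c p (r *\<^sub>R e) = (\<lambda>d. r *\<^sub>R coord_vector A c p e d)"
  using linear_scale[OF linear_transition[OF assms]] by (auto simp: coord_vector_def)

text \<open>\<open>differential\<close> is defined through the selected chart
  \<open>chart_at A p\<close>; composing \<open>F\<close> with the identity moves to any other
  chart.\<close>

lemma differential_chart:
  assumes "smooth_atlas A" "smooth_atlas B" "mdiff A B F p"
    and v: "v \<in> tangent_space A p" and c: "c \<in> charts_at A p" and d: "d \<in> charts_at B (F p)"
  shows "differential A B F p v d = frechet_derivative (coord d \<circ> F \<circ> param c) (at (coord c p)) (v c)"
proof -
  let ?c = "chart_at A p"
  have c': "?c \<in> charts_at A p" using assms(1) by blast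
  have vc: "v ?c = frechet_derivative (coord ?c \<circ> param c) (at (coord c p)) (v c)"
    using v c c' unfolding tangent_space_def by blast
  show ?thesis
    using mdiff_comp(2)[OF assms(1,1,2) mdiff_id[OF assms(1)] assms(3) c c' d, of "v c"] d
    by (simp add: differential_def Let_def vc o_def)
qed

lemma differential_eq_coord_vector:
  assumes "smooth_atlas A" "smooth_atlas B" "mdiff A B F p"
    and v: "v \<in> tangent_space A p" and c: "c \<in> charts_at A p" and d: "d \<in> charts_at B (F p)"
  shows "differential A B F p v =
    coord_vector B d (F p) (frechet_derivative (coord d \<circ> F \<circ> param c) (at (coord c p)) (v c))"
proof
  fix d'
  show "differential A B F p v d' =
    coord_vector B d (F p) (frechet_derivative (coord d \<circ> F \<circ> param c) (at (coord c p)) (v c)) d'"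
  proof (cases "d' \<in> charts_at B (F p)")
    case True
    then show ?thesis
      using mdiff_comp(2)[OF assms(1,2,2,3) mdiff_id[OF assms(2)] c d True, of "v c"]
        differential_chart[OF assms(1,2,3) v c True]
      by (simp add: coord_vector_def o_def)
  qed (simp add: coord_vector_def differential_def)
qed

lemma differential_coord_vector:
  assumes "smooth_atlas A" "smooth_atlas B" "mdiff A B F p"
    and c: "c \<in> charts_at A p" and d: "d \<in> charts_at B (F p)"
  shows "differential A B F p (coord_vector A c p e) =
    coord_vector B d (F p) (frechet_derivative (coord d \<circ> F \<circ> param c) (at (coord c p)) e)"
  using differential_eq_coord_vector[OF assms(1-3) coord_vector_in[OF assms(1) c] c d] assms(1) c
  by simp

lemma differential_in:
  assumes "smooth_atlas A" "smooth_atlas B" "mdiff A B F p" "v \<in> tangent_space A p"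
  shows "differential A B F p v \<in> tangent_space B (F p)"
  by (metis differential_eq_coord_vector[OF assms] coord_vector_in chart_at_in assms(1,2))

lemma differential_comp:
  assumes "smooth_atlas A" "smooth_atlas B" "smooth_atlas C" "mdiff A B F p" "mdiff B C G (F p)"
    and v: "v \<in> tangent_space A p"
  shows "differential A C (G \<circ> F) p v = differential B C G (F p) (differential A B F p v)"
proof -
  obtain c d e where ch: "c \<in> charts_at A p" "d \<in> charts_at B (F p)" "e \<in> charts_at C (G (F p))"
    using assms(1-3) by blast
  note comp = mdiff_comp[OF assms(1-5)]
  have "differential A C (G \<circ> F) p v e = differential B C G (F p) (differential A B F p v) e"
    using differential_chart[OF assms(1,3) comp(1) v ch(1), of e] ch comp(2)[OF ch]
      differential_chart[OF assms(1,2,4) v ch(1,2)]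
      differential_chart[OF assms(2,3,5) differential_in[OF assms(1,2,4) v] ch(2,3)]
    by simp
  then show ?thesis
    using differential_in[OF assms(1,3) comp(1) v]
      differential_in[OF assms(2,3,5) differential_in[OF assms(1,2,4) v]] ch(3)
    by (intro tangent_eqI[of _ C "G (F p)" _ e]) auto
qed

lemma differential_id:
  assumes "smooth_atlas A" "v \<in> tangent_space A p"
  shows "differential A A (\<lambda>p. p) p v = v"
proof -
  obtain c where c: "c \<in> charts_at A p" using assms(1) by blast
  show ?thesis
    using differential_eq_coord_vector[OF assms(1,1) mdiff_id[OF assms(1)] assms(2) c, of c] c
      transition_self[OF assms(1) c] tangent_eq_coord_vector[OF assms(2) c]
    by (simp add: o_def)
qed

subsection \<open>Differentials of real functions\<close>

text \<open>A relation, since \<alpha> is determined only on tangent vectors at \<open>p\<close>.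
  This admits explicit formulas whose values elsewhere are arbitrary.\<close>

definition mderiv ::
  "('a, 'e::real_normed_vector) atlas \<Rightarrow> ('a \<Rightarrow> real) \<Rightarrow> 'a \<Rightarrow> (('a, 'e) tangent \<Rightarrow> real) \<Rightarrow> bool" where
  "mderiv A \<phi> p \<alpha> \<longleftrightarrow> (\<forall>c\<in>charts_at A p.
     ((\<phi> \<circ> param c) has_derivative (\<lambda>e. \<alpha> (coord_vector A c p e))) (at (coord c p)))"

lemma mderivI_chart:
  assumes "smooth_atlas A" "c \<in> charts_at A p"
    and "((\<phi> \<circ> param c) has_derivative (\<lambda>e. \<alpha> (coord_vector A c p e))) (at (coord c p))"
  shows "mderiv A \<phi> p \<alpha>"
  unfolding mderiv_def
proof
  fix d assume d: "d \<in> charts_at A p"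
  have "((\<phi> \<circ> (\<lambda>p. p) \<circ> param d) has_derivative (\<lambda>e. \<alpha> (coord_vector A c p
      (frechet_derivative (coord c \<circ> (\<lambda>p. p) \<circ> param d) (at (coord d p)) e)))) (at (coord d p))"
    by (rule has_derivative_param_compose[OF assms(1,1) continuous_on_id d _
      mdiff_has_derivative[OF mdiff_id[OF assms(1)] d]]) (use assms in auto)
  moreover have "coord_vector A c p (frechet_derivative (coord c \<circ> param d) (at (coord d p)) e) =
      coord_vector A d p e" for e
    using transition_compose[OF assms(1) d assms(2)] by (auto simp: coord_vector_def)
  ultimately show "((\<phi> \<circ> param d) has_derivative (\<lambda>e. \<alpha> (coord_vector A d p e))) (at (coord d p))"
    by (simp add: o_def)
qed

lemma mderiv_comp:
  assumes "smooth_atlas A" "smooth_atlas B" "mdiff A B F p" "mderiv B \<phi> (F p) \<alpha>"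
  shows "mderiv A (\<phi> \<circ> F) p (\<lambda>v. \<alpha> (differential A B F p v))"
  unfolding mderiv_def
proof
  fix c assume c: "c \<in> charts_at A p"
  obtain d where d: "d \<in> charts_at B (F p)" using assms(2) by blast
  have "((\<phi> \<circ> F \<circ> param c) has_derivative (\<lambda>e. \<alpha> (coord_vector B d (F p)
      (frechet_derivative (coord d \<circ> F \<circ> param c) (at (coord c p)) e)))) (at (coord c p))"
    using assms(3,4) d by (intro has_derivative_param_compose[OF assms(1,2) _ c d
      mdiff_has_derivative[OF assms(3) c d]]) (auto simp: mdiff_def mderiv_def)
  then show "((\<phi> \<circ> F \<circ> param c) has_derivative (\<lambda>e. \<alpha> (differential A B F p (coord_vector A c p e)))) (at (coord c p))"
    by (simp add: differential_coord_vector[OF assms(1-3) c d])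
qed

lemma mderiv_unique:
  assumes "smooth_atlas A" "mderiv A \<phi> p \<alpha>" "mderiv A \<phi> p \<beta>" "v \<in> tangent_space A p"
  shows "\<alpha> v = \<beta> v"
proof -
  obtain c where c: "c \<in> charts_at A p" using assms(1) by blast
  have "(\<lambda>e. \<alpha> (coord_vector A c p e)) = (\<lambda>e. \<beta> (coord_vector A c p e))"
    using assms(2,3) c unfolding mderiv_def by (metis has_derivative_unique)
  from fun_cong[OF this, of "v c"] show ?thesis
    by (simp add: tangent_eq_coord_vector[OF assms(4) c])
qed

lemma mderiv_cong:
  assumes "smooth_atlas A" "mderiv A \<phi> p \<alpha>" "\<And>v. v \<in> tangent_space A p \<Longrightarrow> \<alpha> v = \<beta> v"
  shows "mderiv A \<phi> p \<beta>"
  using assms coord_vector_in[OF assms(1)] by (simp add: mderiv_def)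

lemma mderiv_transform:
  assumes "smooth_atlas A" "mderiv A \<phi> p \<alpha>" "open N" "p \<in> N" "\<And>q. q \<in> N \<Longrightarrow> \<phi> q = \<psi> q"
  shows "mderiv A \<psi> p \<alpha>"
  unfolding mderiv_def
proof
  fix c assume c: "c \<in> charts_at A p"
  have "\<forall>\<^sub>F x in nhds (coord c p). (\<phi> \<circ> param c) x = (\<psi> \<circ> param c) x"
    using eventually_param[OF assms(1) c assms(3,4)] by eventually_elim (simp add: assms(5))
  moreover have "((\<phi> \<circ> param c) has_derivative (\<lambda>e. \<alpha> (coord_vector A c p e))) (at (coord c p))"
    using assms(2) c unfolding mderiv_def by blast
  ultimately show "((\<psi> \<circ> param c) has_derivative (\<lambda>e. \<alpha> (coord_vector A c p e))) (at (coord c p))"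
    by (rule has_derivative_transform_nhds[rotated])
qed

lemma mderiv_add:
  "mderiv A \<phi> p \<alpha> \<Longrightarrow> mderiv A \<psi> p \<beta> \<Longrightarrow> mderiv A (\<lambda>p. \<phi> p + \<psi> p) p (\<lambda>v. \<alpha> v + \<beta> v)"
  unfolding mderiv_def by (auto simp: o_def intro!: has_derivative_add)

lemma mderiv_diff:
  "mderiv A \<phi> p \<alpha> \<Longrightarrow> mderiv A \<psi> p \<beta> \<Longrightarrow> mderiv A (\<lambda>p. \<phi> p - \<psi> p) p (\<lambda>v. \<alpha> v - \<beta> v)"
  unfolding mderiv_def by (auto simp: o_def intro!: has_derivative_diff)

lemma mderiv_const: "mderiv A (\<lambda>p. r) p (\<lambda>v. 0)"
  unfolding mderiv_def by (auto simp: o_def)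

text \<open>Near each point of \<open>B\<close> a chart turns the hypothesis into a vanishing
  derivative on a ball, so \<phi> is locally constant there. For local primitives, \<open>N\<close>
  will be the set of products \<open>h \<star> q\<close> with \<open>h\<close> in a connected
  neighbourhood of the identity.\<close>

lemma mderiv_zero_imp_constant:
  assumes "smooth_atlas A" "open B" "connected N" "N \<subseteq> B"
    and "\<And>q. q \<in> B \<Longrightarrow> mderiv A \<phi> q (\<lambda>v. 0)"
    and "p \<in> N" "q \<in> N"
  shows "\<phi> p = \<phi> q"
proof (rule connected_local_const[OF assms(3,6,7)], rule ballI)
  fix a assume "a \<in> N"
  then have a: "a \<in> B" using assms by auto
  obtain c where c: "c \<in> charts_at A a" using assms(1) by blast
  then have cA: "c \<in> A" "a \<in> dom_of c" by (auto simp: charts_at_def)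
  note at = smooth_atlasD[OF assms(1) cA(1)]
  have "\<forall>\<^sub>F x in nhds (coord c a). x \<in> coord c ` dom_of c \<and> param c x \<in> B"
    using eventually_param[OF assms(1) c assms(2) a] .
  then obtain r where r: "r > 0" "\<And>x. x \<in> ball (coord c a) r \<Longrightarrow> x \<in> coord c ` dom_of c \<and> param c x \<in> B"
    unfolding eventually_nhds_metric by (auto simp: dist_commute)
  have "((\<phi> \<circ> param c) has_derivative (\<lambda>e. 0)) (at x within ball (coord c a) r)" if "x \<in> ball (coord c a) r" for x
  proof -
    have "c \<in> charts_at A (param c x)" "coord c (param c x) = x" "param c x \<in> B"
      using r(2)[OF that] at(6,7) cA(1) by (auto simp: charts_at_def)
    then show ?thesis using assms(5)[of "param c x"] unfolding mderiv_def
      by (metis has_derivative_at_withinI)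
  qed
  then obtain k where k: "\<And>x. x \<in> ball (coord c a) r \<Longrightarrow> (\<phi> \<circ> param c) x = k"
    using has_derivative_zero_constant[of "ball (coord c a) r" "\<phi> \<circ> param c"] by auto
  let ?W = "dom_of c \<inter> coord c -` ball (coord c a) r"
  have "open ?W" using continuous_open_preimage[OF at(3,1) open_ball] .
  moreover have "\<phi> a = \<phi> b" if "b \<in> ?W" for b
    using k[of "coord c a"] k[of "coord c b"] at(5) that cA(2) r(1) by simp
  ultimately show "\<forall>\<^sub>F b in at a within N. \<phi> a = \<phi> b"
    unfolding eventually_at_topological using cA(2) r(1) by (intro exI[of _ ?W]) auto
qed

subsection \<open>The invariant mean of a compact group\<close>

locale compact_group = group mul one inve
  for mul :: "'a::second_countable_topology \<Rightarrow> 'a \<Rightarrow> 'a" (infixl "\<star>" 70)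
    and one :: 'a and inve :: "'a \<Rightarrow> 'a" +
  assumes continuous_mul: "continuous_on UNIV (\<lambda>(x, y). x \<star> y)"
    and continuous_inve: "continuous_on UNIV inve"
    and compact_UNIV: "compact (UNIV :: 'a set)"
begin

lemma continuous_on_mul [continuous_intros]:
  "continuous_on S f \<Longrightarrow> continuous_on S g \<Longrightarrow> continuous_on S (\<lambda>x. f x \<star> g x)"
  using continuous_on_compose2[OF continuous_mul, of S "\<lambda>x. (f x, g x)"]
  by (simp add: continuous_on_Pair)

lemma continuous_on_inve [continuous_intros]:
  "continuous_on S f \<Longrightarrow> continuous_on S (\<lambda>x. inve (f x))"
  using continuous_on_compose2[OF continuous_inve, of S f] by simp

definition dense_seq :: "nat \<Rightarrow> 'a" where
  "dense_seq = (SOME g. \<forall>X. open X \<longrightarrow> X \<noteq> {} \<longrightarrow> (\<exists>i. g i \<in> X))"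

lemma dense_seq:
  assumes "open X" "X \<noteq> {}"
  shows "\<exists>i. dense_seq i \<in> X"
proof -
  obtain D :: "'a set" where D: "countable D" "\<And>X. open X \<Longrightarrow> X \<noteq> {} \<Longrightarrow> \<exists>d\<in>D. d \<in> X"
    using countable_dense_setE by blast
  have "D \<noteq> {}" using D(2)[of UNIV] by auto
  then have "range (from_nat_into D) = D" using D(1) by (rule range_from_nat_into)
  have "\<exists>i. from_nat_into D i \<in> X" if X: "open X" "X \<noteq> {}" for X
  proof -
    obtain d where "d \<in> D" "d \<in> X" using D(2)[OF X] by blast
    moreover then obtain i where "d = from_nat_into D i" using \<open>range (from_nat_into D) = D\<close> by auto
    ultimately show ?thesis by auto
  qed
  then have "\<exists>g::nat\<Rightarrow>'a. \<forall>X. open X \<longrightarrow> X \<noteq> {} \<longrightarrow> (\<exists>i. g i \<in> X)" by blast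
  from someI_ex[OF this] assms show ?thesis unfolding dense_seq_def by blast
qed

text \<open>The weights sum to 1 and are all positive, so that every point of the dense sequence
  contributes. The sequence multiplies on the left, so \<open>avg\<close> commutes with right
  translations by associativity alone.\<close>

definition avg :: "('a \<Rightarrow> real) \<Rightarrow> 'a \<Rightarrow> real" where
  "avg F x = (\<Sum>i. (1/2) ^ Suc i * F (dense_seq i \<star> x))"

text \<open>\<open>avg\<close> preserves both bounds, so one pair \<open>a\<close>, \<open>b\<close>
  guarantees summability for all iterates.\<close>

definition range_in :: "real \<Rightarrow> real \<Rightarrow> ('a \<Rightarrow> real) \<Rightarrow> bool" where
  "range_in a b F \<longleftrightarrow> (\<forall>x. a \<le> F x \<and> F x \<le> b)"

lemma avg_sums:
  assumes "range_in a b F"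
  shows "(\<lambda>i. (1/2) ^ Suc i * F (dense_seq i \<star> x)) sums avg F x"
proof -
  have "summable (\<lambda>i. (1/2) ^ Suc i * F (dense_seq i \<star> x))"
  proof (rule summable_comparison_test'[where N = 0])
    show "summable (\<lambda>i. (1/2) ^ Suc i * (\<bar>a\<bar> + \<bar>b\<bar>))"
      by (intro summable_mult2 sums_summable[OF power_half_series])
    fix i
    have "\<bar>F (dense_seq i \<star> x)\<bar> \<le> \<bar>a\<bar> + \<bar>b\<bar>"
      using assms unfolding range_in_def by (smt (verit))
    then show "norm ((1/2) ^ Suc i * F (dense_seq i \<star> x)) \<le> (1/2) ^ Suc i * (\<bar>a\<bar> + \<bar>b\<bar>)"
      by (simp add: abs_mult)
  qed
  then show ?thesis unfolding avg_def by (rule summable_sums)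
qed

text \<open>All terms of the series for \<open>c - avg F x\<close> are nonnegative, so any single
  one bounds it from below. This retained deficit is the source of the contraction.\<close>

lemma avg_le:
  assumes "range_in a b F" "\<And>x. F x \<le> c"
  shows "avg F x \<le> c - (1/2) ^ Suc i * (c - F (dense_seq i \<star> x))"
proof -
  let ?f = "\<lambda>i. (1/2) ^ Suc i * (c - F (dense_seq i \<star> x))"
  have "(\<lambda>i. (1/2) ^ Suc i * c - (1/2) ^ Suc i * F (dense_seq i \<star> x)) sums (1 * c - avg F x)"
    by (intro sums_diff sums_mult2 power_half_series avg_sums[OF assms(1)])
  then have s: "?f sums (c - avg F x)" by (simp add: right_diff_distrib)
  have "sum ?f {i} \<le> suminf ?f"
    using sums_summable[OF s] assms(2) by (intro sum_le_suminf) auto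
  then show ?thesis using sums_unique[OF s] by simp
qed

lemma avg_ge:
  assumes "range_in a b F" "\<And>x. c \<le> F x"
  shows "c \<le> avg F x"
proof -
  have s: "(\<lambda>i. (1/2) ^ Suc i * F (dense_seq i \<star> x) - (1/2) ^ Suc i * c) sums (avg F x - 1 * c)"
    by (intro sums_diff sums_mult2 power_half_series avg_sums[OF assms(1)])
  have "0 \<le> (1/2) ^ Suc i * F (dense_seq i \<star> x) - (1/2) ^ Suc i * c" for i
    using assms(2) by simp
  from sums_le[OF this sums_zero s] have "0 \<le> avg F x - 1 * c" .
  then show ?thesis by simp
qed

lemma avg_range: "range_in a b F \<Longrightarrow> range_in a b (avg F)"
proof -
  assume F: "range_in a b F"
  have "avg F x \<le> b" for x
  proof -
    have "avg F x \<le> b - (1/2) ^ Suc 0 * (b - F (dense_seq 0 \<star> x))"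
      using F by (intro avg_le[OF F]) (simp add: range_in_def)
    also have "\<dots> \<le> b" using F by (simp add: range_in_def)
    finally show ?thesis .
  qed
  moreover have "a \<le> avg F x" for x using F by (intro avg_ge[OF F]) (simp add: range_in_def)
  ultimately show ?thesis by (simp add: range_in_def)
qed

lemma avg_add:
  assumes "range_in a b F" "range_in a' b' G"
  shows "avg (\<lambda>x. F x + G x) = (\<lambda>x. avg F x + avg G x)"
proof
  fix x
  from sums_add[OF avg_sums[OF assms(1)] avg_sums[OF assms(2)], of x x]
  show "avg (\<lambda>x. F x + G x) x = avg F x + avg G x"
    unfolding avg_def[of "\<lambda>x. F x + G x"] by (simp add: distrib_left sums_iff)
qed

lemma avg_mult:
  assumes "range_in a b F"
  shows "avg (\<lambda>x. c * F x) = (\<lambda>x. c * avg F x)"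
proof
  fix x
  from sums_mult[OF avg_sums[OF assms], of c x]
  show "avg (\<lambda>x. c * F x) x = c * avg F x"
    unfolding avg_def[of "\<lambda>x. c * F x"] by (simp add: mult_ac sums_iff)
qed

lemma avg_pow_range: "range_in a b F \<Longrightarrow> range_in a b ((avg ^^ n) F)"
  by (induction n) (auto intro: avg_range)

lemma avg_pow_add:
  "range_in a b F \<Longrightarrow> range_in a' b' G \<Longrightarrow>
    (avg ^^ n) (\<lambda>x. F x + G x) = (\<lambda>x. (avg ^^ n) F x + (avg ^^ n) G x)"
  by (induction n) (simp_all add: avg_add[OF avg_pow_range avg_pow_range])

lemma avg_pow_mult:
  "range_in a b F \<Longrightarrow> (avg ^^ n) (\<lambda>x. c * F x) = (\<lambda>x. c * (avg ^^ n) F x)"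
  by (induction n) (simp_all add: avg_mult[OF avg_pow_range])

lemma avg_pow_translate: "(avg ^^ n) (\<lambda>x. F (x \<star> h)) = (\<lambda>x. (avg ^^ n) F (x \<star> h))"
  by (induction n) (simp_all add: avg_def assoc)

text \<open>Uniform continuity with the perturbation on the right. Averaging acts on the left, so
  all iterates inherit the same \<open>U\<close> and \<open>e\<close>.\<close>

definition varies_within :: "real \<Rightarrow> 'a set \<Rightarrow> ('a \<Rightarrow> real) \<Rightarrow> bool" where
  "varies_within e U F \<longleftrightarrow> (\<forall>x. \<forall>u\<in>U. \<bar>F (x \<star> u) - F x\<bar> \<le> e)"

lemma avg_varies_within:
  assumes "range_in a b F" "varies_within e U F"
  shows "varies_within e U (avg F)"
  unfolding varies_within_def
proof (intro allI ballI)
  fix x u assume u: "u \<in> U"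
  have s: "(\<lambda>i. (1/2) ^ Suc i * (F (dense_seq i \<star> x \<star> u) - F (dense_seq i \<star> x))) sums (avg F (x \<star> u) - avg F x)"
    using sums_diff[OF avg_sums[OF assms(1)] avg_sums[OF assms(1)], of "x \<star> u" x]
    by (simp add: right_diff_distrib assoc)
  have e: "(\<lambda>i. (1/2) ^ Suc i * e) sums (1 * e)" by (intro sums_mult2 power_half_series)
  have "\<bar>F (dense_seq i \<star> x \<star> u) - F (dense_seq i \<star> x)\<bar> \<le> e" for i
    using assms(2) u by (simp add: varies_within_def)
  then have "(1/2) ^ Suc i * (F (dense_seq i \<star> x \<star> u) - F (dense_seq i \<star> x)) \<le> (1/2) ^ Suc i * e"
    and "- ((1/2) ^ Suc i * e) \<le> (1/2) ^ Suc i * (F (dense_seq i \<star> x \<star> u) - F (dense_seq i \<star> x))" for i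
    by (simp_all only: abs_le_iff minus_mult_right mult_le_cancel_left_pos zero_less_power zero_less_divide_1_iff zero_less_numeral minus_le_iff)
  from sums_le[OF this(1) s e] sums_le[OF this(2) sums_minus[OF e] s]
  have "avg F (x \<star> u) - avg F x \<le> 1 * e" "- (1 * e) \<le> avg F (x \<star> u) - avg F x" .
  then show "\<bar>avg F (x \<star> u) - avg F x\<bar> \<le> e" by linarith
qed

lemma avg_pow_varies_within:
  "range_in a b F \<Longrightarrow> varies_within e U F \<Longrightarrow> varies_within e U ((avg ^^ n) F)"
  by (induction n) (auto intro: avg_varies_within avg_pow_range)

lemma continuous_range_in:
  assumes "continuous_on UNIV F"
  shows "\<exists>a b. range_in a b F"
proof -
  have "bounded (range F)"
    using compact_continuous_image[OF assms compact_UNIV] by (rule compact_imp_bounded)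
  then obtain B where "\<forall>x. \<bar>F x\<bar> \<le> B" by (auto simp: bounded_iff)
  then show ?thesis unfolding range_in_def by (metis abs_le_D1 abs_le_D2 minus_le_iff)
qed

lemma continuous_varies_within:
  assumes F: "continuous_on UNIV F" and e: "e > 0"
  shows "\<exists>U. open U \<and> one \<in> U \<and> varies_within e U F"
proof -
  let ?W = "{p. \<bar>F (snd p \<star> fst p) - F (snd p)\<bar> < e}"
  have F': "continuous_on S (\<lambda>p. F (f p))" if "continuous_on S f" for S and f :: "'a \<times> 'a \<Rightarrow> 'a"
    using continuous_on_compose2[OF F that] by simp
  have W: "open ?W"
    by (intro open_Collect_less continuous_intros F')
  \<comment> \<open>\<open>?W\<close> contains the whole slice over \<open>one\<close>; compactness
    of the group gives a neighbourhood of \<open>one\<close> that works for every \<open>x\<close>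
    at once.\<close>
  have "{one} \<times> UNIV \<subseteq> ?W" using e by auto
  from Elementary_Topology.tube_lemma[OF compact_UNIV W this] obtain U where U: "one \<in> U" "open U" "U \<times> UNIV \<subseteq> ?W"
    by blast
  then have "varies_within e U F" unfolding varies_within_def by (fastforce intro: less_imp_le)
  with U show ?thesis by blast
qed

section \<open>Contraction of the oscillation and the limit of the iterates\<close>

definition osc :: "('a \<Rightarrow> real) \<Rightarrow> real" where
  "osc F = (SUP x. F x) - (INF x. F x)"

lemma range_in_bdd:
  assumes "range_in a b F"
  shows "bdd_above (range F)" "bdd_below (range F)"
  using assms unfolding range_in_def by (auto intro: bdd_aboveI bdd_belowI)

lemma range_in_bounds:
  assumes "range_in a b F"
  shows "F x \<le> (SUP x. F x)" "(INF x. F x) \<le> F x"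
  using range_in_bdd[OF assms] by (auto intro: cSUP_upper cINF_lower)

text \<open>For any \<open>x\<close> and \<open>y\<close> some point of the dense sequence moves
  \<open>x\<close> into \<open>y \<star> U\<close>, so one term of \<open>avg F x\<close> involves a
  value at most \<open>F y + e\<close>. By compactness finitely many indices do for all pairs, which
  bounds the weight of that term from below. The constant \<open>d\<close> depends on
  \<open>U\<close> alone and hence serves every iterate.\<close>

lemma osc_contraction:
  assumes "open U" "one \<in> U"
  obtains d where "0 < d" "d < 1"
    "\<And>a b e F. \<lbrakk>range_in a b F; varies_within e U F\<rbrakk> \<Longrightarrow> osc (avg F) \<le> (1 - d) * osc F + d * e"
proof -
  let ?V = "\<lambda>i. {p. inve (snd p) \<star> dense_seq i \<star> fst p \<in> U}"
  have V_open: "open (?V i)" for i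
    unfolding vimage_def[symmetric, of _ U] by (intro open_vimage assms(1) continuous_intros)
  have V_cover: "UNIV \<subseteq> (\<Union>i. ?V i)"
  proof
    fix p :: "'a \<times> 'a"
    let ?X = "(\<lambda>g. inve (snd p) \<star> g \<star> fst p) -` U"
    have "open ?X" by (intro open_vimage assms continuous_intros)
    \<comment> \<open>For \<open>p = (x, y)\<close> the element \<open>g = y \<star> inve x\<close>
      gives \<open>inve y \<star> g \<star> x = one\<close>, so \<open>?X\<close> is nonempty and
      density supplies an index.\<close>
    moreover have "snd p \<star> inve (fst p) \<in> ?X"
      using assms(2) by (simp flip: assoc)
    ultimately obtain i where "dense_seq i \<in> ?X" using dense_seq by blast
    then show "p \<in> (\<Union>i. ?V i)" by auto
  qed
  have "compact (UNIV :: ('a \<times> 'a) set)"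
    using compact_Times[OF compact_UNIV compact_UNIV] by simp
  then obtain I where I: "I \<subseteq> UNIV" "finite I" "UNIV \<subseteq> (\<Union>i\<in>I. ?V i)"
    using V_open V_cover by (rule compactE_image)
  \<comment> \<open>The smallest weight among the indices in \<open>I\<close>.\<close>
  define d :: real where "d = (1/2) ^ Suc (Max I)"
  have d: "0 < d" "d < 1" unfolding d_def by (auto intro!: power_Suc_less_one simp del: power_Suc)
  show ?thesis
  proof (rule that[OF d])
    fix a b e F assume F: "range_in a b F" "varies_within e U F"
    let ?b = "SUP x. F x" and ?a = "INF x. F x"
    have up: "avg F x \<le> ?b - d * (?b - (F y + e))" for x y
    proof -
      obtain i where i: "i \<in> I" "inve y \<star> dense_seq i \<star> x \<in> U" using subsetD[OF I(3), of "(x, y)"] by auto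
      have "\<bar>F (y \<star> (inve y \<star> dense_seq i \<star> x)) - F y\<bar> \<le> e"
        using F(2) i(2) by (simp add: varies_within_def)
      then have "F (dense_seq i \<star> x) \<le> F y + e" by (simp add: assoc[symmetric])
      then have *: "?b - (F y + e) \<le> ?b - F (dense_seq i \<star> x)" by simp
      have "d \<le> (1/2) ^ Suc i"
        unfolding d_def using i(1) I(2) by (intro power_decreasing) auto
      then have "d * (?b - F (dense_seq i \<star> x)) \<le> (1/2) ^ Suc i * (?b - F (dense_seq i \<star> x))"
        using range_in_bounds[OF F(1)] by (intro mult_right_mono) auto
      moreover have "d * (?b - (F y + e)) \<le> d * (?b - F (dense_seq i \<star> x))"
        using * d by (intro mult_left_mono) auto
      moreover have "avg F x \<le> ?b - (1/2) ^ Suc i * (?b - F (dense_seq i \<star> x))"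
        using range_in_bounds[OF F(1)] by (intro avg_le[OF F(1)]) auto
      ultimately show ?thesis by linarith
    qed
    \<comment> \<open>Solved for \<open>F y\<close>, so that the left-hand side is a lower bound of
      \<open>F\<close> and can be compared with its infimum.\<close>
    have "(avg F x - (1 - d) * ?b - d * e) / d \<le> F y" for x y
      using up[of x y] d by (simp add: field_simps)
    then have "(avg F x - (1 - d) * ?b - d * e) / d \<le> ?a" for x
      by (intro cINF_greatest) auto
    then have "avg F x \<le> (1 - d) * ?b + d * e + d * ?a" for x
      using d by (simp add: field_simps)
    then have "(SUP x. avg F x) \<le> (1 - d) * ?b + d * e + d * ?a"
      by (intro cSUP_least) auto
    moreover have "?a \<le> (INF x. avg F x)"
      using range_in_bounds[OF F(1)] avg_ge[OF F(1)] by (intro cINF_greatest) auto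
    ultimately show "osc (avg F) \<le> (1 - d) * osc F + d * e"
      by (simp add: osc_def algebra_simps)
  qed
qed

lemma osc_nonneg: "range_in a b F \<Longrightarrow> 0 \<le> osc F"
  using range_in_bounds[of a b F one] by (simp add: osc_def)

lemma osc_avg_pow_tendsto_0:
  assumes "continuous_on UNIV F"
  shows "(\<lambda>n. osc ((avg ^^ n) F)) \<longlonglongrightarrow> 0"
proof (rule LIMSEQ_I)
  fix e :: real assume e: "e > 0"
  obtain a b where F: "range_in a b F" using continuous_range_in[OF assms] by blast
  obtain U where U: "open U" "one \<in> U" "varies_within (e/2) U F"
    using continuous_varies_within[OF assms, of "e/2"] e by auto
  obtain d where d: "0 < d" "d < 1"
    "\<And>a b e F. \<lbrakk>range_in a b F; varies_within e U F\<rbrakk> \<Longrightarrow> osc (avg F) \<le> (1 - d) * osc F + d * e"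
    using osc_contraction[OF U(1,2)] by blast
  \<comment> \<open>The recursion \<open>t \<mapsto> (1 - d) * t + d * (e/2)\<close> has the fixed
    point \<open>e/2\<close>, and the distance from it shrinks by the factor \<open>1 - d\<close>.
    The absolute value covers an initial oscillation below \<open>e/2\<close>.\<close>
  have dec: "osc ((avg ^^ n) F) - e/2 \<le> (1 - d) ^ n * \<bar>osc F - e/2\<bar>" for n
  proof (induction n)
    case (Suc n)
    have "osc ((avg ^^ Suc n) F) - e/2 \<le> (1 - d) * (osc ((avg ^^ n) F) - e/2)"
      using d(3)[OF avg_pow_range[OF F] avg_pow_varies_within[OF F U(3)], of n]
      by (simp add: field_simps)
    also have "\<dots> \<le> (1 - d) * ((1 - d) ^ n * \<bar>osc F - e/2\<bar>)"
      using Suc d by (intro mult_left_mono) auto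
    finally show ?case by simp
  qed simp
  have "(\<lambda>n. (1 - d) ^ n * \<bar>osc F - e/2\<bar>) \<longlonglongrightarrow> 0 * \<bar>osc F - e/2\<bar>"
    using d by (intro tendsto_mult tendsto_const LIMSEQ_power_zero) auto
  then have "\<forall>\<^sub>F n in sequentially. (1 - d) ^ n * \<bar>osc F - e/2\<bar> < e/2"
    using e by (intro order_tendstoD(2)) auto
  then obtain N where N: "\<And>n. n \<ge> N \<Longrightarrow> (1 - d) ^ n * \<bar>osc F - e/2\<bar> < e/2"
    unfolding eventually_sequentially by blast
  have "norm (osc ((avg ^^ n) F) - 0) < e" if "n \<ge> N" for n
    using N[OF that] dec[of n] osc_nonneg[OF avg_pow_range[OF F, of n]] by simp
  then show "\<exists>N. \<forall>n\<ge>N. norm (osc ((avg ^^ n) F) - 0) < e" by blast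
qed

text \<open>The infima of the iterates increase and stay bounded, and the oscillations tend to 0, so
  the iterates converge to this number at every point. Taking infima avoids a base point.\<close>

definition mean :: "('a \<Rightarrow> real) \<Rightarrow> real" where
  "mean F = lim (\<lambda>n. INF x. (avg ^^ n) F x)"

lemma mean_tendsto:
  assumes "continuous_on UNIV F"
  shows "(\<lambda>n. (avg ^^ n) F x) \<longlonglongrightarrow> mean F"
proof -
  obtain a b where F: "range_in a b F" using continuous_range_in[OF assms] by blast
  let ?I = "\<lambda>n. INF x. (avg ^^ n) F x"
  have "incseq ?I"
    using range_in_bounds(2)[OF avg_pow_range[OF F]] avg_ge[OF avg_pow_range[OF F]]
    by (intro incseq_SucI cINF_greatest) auto
  moreover have "?I n \<le> b" for n
    using range_in_bounds(2)[OF avg_pow_range[OF F], of n one] avg_pow_range[OF F, of n]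
    unfolding range_in_def by (meson order_trans)
  ultimately obtain L where "?I \<longlonglongrightarrow> L" using incseq_convergent[of ?I b] by metis
  then have "convergent ?I" unfolding convergent_def ..
  then have I: "?I \<longlonglongrightarrow> mean F" by (simp add: mean_def convergent_LIMSEQ_iff)
  have "(\<lambda>n. (avg ^^ n) F x - ?I n) \<longlonglongrightarrow> 0"
  proof (rule tendsto_sandwich[OF _ _ tendsto_const osc_avg_pow_tendsto_0[OF assms]])
    show "\<forall>\<^sub>F n in sequentially. 0 \<le> (avg ^^ n) F x - ?I n"
      using range_in_bounds(2)[OF avg_pow_range[OF F]] by simp
    show "\<forall>\<^sub>F n in sequentially. (avg ^^ n) F x - ?I n \<le> osc ((avg ^^ n) F)"
      using range_in_bounds(1)[OF avg_pow_range[OF F]] by (simp add: osc_def)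
  qed
  from tendsto_add[OF this I] show ?thesis by simp
qed

lemma mean_bounds:
  assumes "continuous_on UNIV F" "\<And>x. a \<le> F x" "\<And>x. F x \<le> b"
  shows "a \<le> mean F" "mean F \<le> b"
proof -
  have "range_in a b F" using assms by (simp add: range_in_def)
  from avg_pow_range[OF this] mean_tendsto[OF assms(1), of one]
  show "a \<le> mean F" "mean F \<le> b"
    unfolding range_in_def by (auto intro: LIMSEQ_le_const LIMSEQ_le_const2)
qed

lemma mean_const [simp]: "mean (\<lambda>x. c) = c"
  using mean_bounds[of "\<lambda>x. c" c c] by (simp add: order_antisym)

lemma mean_add:
  assumes "continuous_on UNIV F" "continuous_on UNIV G"
  shows "mean (\<lambda>x. F x + G x) = mean F + mean G"
proof -
  obtain a b a' b' where r: "range_in a b F" "range_in a' b' G"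
    using continuous_range_in assms by metis
  have "(\<lambda>n. (avg ^^ n) (\<lambda>x. F x + G x) one) \<longlonglongrightarrow> mean F + mean G"
    using tendsto_add[OF mean_tendsto[OF assms(1)] mean_tendsto[OF assms(2)]]
    by (simp add: avg_pow_add[OF r])
  with mean_tendsto[OF continuous_on_add[OF assms], of one] show ?thesis by (rule LIMSEQ_unique)
qed

lemma mean_mult:
  assumes "continuous_on UNIV F"
  shows "mean (\<lambda>x. c * F x) = c * mean F"
proof -
  obtain a b where r: "range_in a b F" using continuous_range_in assms by metis
  have "(\<lambda>n. (avg ^^ n) (\<lambda>x. c * F x) one) \<longlonglongrightarrow> c * mean F"
    using tendsto_mult[OF tendsto_const mean_tendsto[OF assms]]
    by (simp add: avg_pow_mult[OF r])
  with mean_tendsto[OF continuous_on_mult[OF continuous_on_const assms], of c one]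
  show ?thesis by (rule LIMSEQ_unique)
qed

lemma mean_diff:
  assumes "continuous_on UNIV F" "continuous_on UNIV G"
  shows "mean (\<lambda>x. F x - G x) = mean F - mean G"
  using mean_add[OF assms(1) continuous_on_minus[OF assms(2)]] mean_mult[OF assms(2), of "- 1"]
  by simp

text \<open>A right translation only moves the point at which the iterates are evaluated, and their
  limit is the same at every point.\<close>

lemma mean_translate:
  assumes "continuous_on UNIV F"
  shows "mean (\<lambda>x. F (x \<star> h)) = mean F"
proof -
  have "continuous_on UNIV (\<lambda>x. F (x \<star> h))"
    by (rule continuous_on_compose2[OF assms]) (auto intro: continuous_intros)
  from mean_tendsto[OF this, of one] mean_tendsto[OF assms, of "one \<star> h"] show ?thesis
    unfolding avg_pow_translate by (rule LIMSEQ_unique)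
qed

text \<open>Compactness makes the continuity of \<open>D h x\<close> in \<open>x\<close> uniform in
  \<open>h\<close>. The first-order remainder is therefore small uniformly in \<open>h\<close>, and
  its mean is equally small.\<close>

lemma mean_has_derivative:
  fixes u :: "'a \<Rightarrow> 'e::finite_dim_inner \<Rightarrow> real"
  assumes S: "open S" "x0 \<in> S"
    and u: "\<And>h x. x \<in> S \<Longrightarrow> (u h has_derivative D h x) (at x)"
    and cu: "\<And>x. x \<in> S \<Longrightarrow> continuous_on UNIV (\<lambda>h. u h x)"
    and cD: "\<And>v. continuous_on (UNIV \<times> S) (\<lambda>(h, x). D h x v)"
  shows "((\<lambda>x. mean (\<lambda>h. u h x)) has_derivative (\<lambda>v. mean (\<lambda>h. D h x0 v))) (at x0)"
proof -
  have lin: "linear (D h x)" if "x \<in> S" for h x using u[OF that] has_derivative_linear by blast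
  have cD0: "continuous_on UNIV (\<lambda>h. D h x0 v)" for v
    using continuous_on_compose2[OF cD[of v], of UNIV "\<lambda>h. (h, x0)"] S(2)
    by (auto simp: continuous_on_Pair)
  define C where "C = (\<Sum>b\<in>(fd_basis::'e set). norm b / (b \<bullet> b)) + 1"
  have C: "C > 0" unfolding C_def by (intro add_nonneg_pos sum_nonneg) auto
  show ?thesis
  proof (rule has_derivativeI)
    show "bounded_linear (\<lambda>v. mean (\<lambda>h. D h x0 v))"
      using lin[OF S(2)] by (intro linear_fd_bounded linearI)
        (simp_all add: linear_add linear_scale mean_add[OF cD0 cD0] mean_mult[OF cD0])
    show "((\<lambda>y. ((mean (\<lambda>h. u h y) - mean (\<lambda>h. u h x0)) - mean (\<lambda>h. D h x0 (y - x0))) /\<^sub>R norm (y - x0)) \<longlongrightarrow> 0) (at x0)"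
    proof (rule tendstoI)
      fix e :: real assume e: "e > 0"
      \<comment> \<open>The tube lemma over the compact group yields a neighbourhood of
        \<open>x0\<close> that is independent of \<open>h\<close>.\<close>
      have "\<exists>X. open X \<and> x0 \<in> X \<and> X \<subseteq> S \<and> (\<forall>x\<in>X. \<forall>h. \<bar>D h x b - D h x0 b\<bar> < e / (2 * C))" for b
      proof -
        have "continuous_on (S \<times> UNIV) (\<lambda>p. \<bar>D (snd p) (fst p) b - D (snd p) x0 b\<bar>)"
        proof (intro continuous_on_rabs continuous_on_diff)
          have "continuous_on (S \<times> UNIV) (\<lambda>p. (snd p :: 'a, fst p))"
            by (intro continuous_intros)
          from continuous_on_compose2[OF cD[of b] this]
          show "continuous_on (S \<times> UNIV) (\<lambda>p. D (snd p) (fst p) b)" by (simp add: image_subset_iff)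
          show "continuous_on (S \<times> UNIV) (\<lambda>p. D (snd p) x0 b)"
            by (rule continuous_on_compose2[OF cD0[of b] continuous_on_snd[OF continuous_on_id]]) simp
        qed
        moreover have "open (S \<times> (UNIV :: 'a set))" using S(1) by (intro open_Times) auto
        ultimately have W: "open ((\<lambda>p. \<bar>D (snd p) (fst p) b - D (snd p) x0 b\<bar>) -` {..<e / (2 * C)} \<inter> (S \<times> UNIV))"
          using continuous_on_open_vimage open_lessThan by blast
        have "{x0} \<times> UNIV \<subseteq> (\<lambda>p. \<bar>D (snd p) (fst p) b - D (snd p) x0 b\<bar>) -` {..<e / (2 * C)} \<inter> (S \<times> UNIV)"
          using S(2) e C by auto
        from Elementary_Topology.tube_lemma[OF compact_UNIV W this] obtain X where X: "x0 \<in> X" "open X"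
          "X \<times> UNIV \<subseteq> (\<lambda>p. \<bar>D (snd p) (fst p) b - D (snd p) x0 b\<bar>) -` {..<e / (2 * C)} \<inter> (S \<times> UNIV)"
          by blast
        have "x \<in> S \<and> \<bar>D h x b - D h x0 b\<bar> < e / (2 * C)" if "x \<in> X" for x h
          using subsetD[OF X(3), of "(x, h)"] that by simp
        with X(1,2) show ?thesis by blast
      qed
      then obtain X where X: "\<And>b. open (X b)" "\<And>b. x0 \<in> X b" "\<And>b. X b \<subseteq> S"
        "\<And>b x h. x \<in> X b \<Longrightarrow> \<bar>D h x b - D h x0 b\<bar> < e / (2 * C)"
        by metis
      have "open (S \<inter> (\<Inter>b\<in>fd_basis. X b))" using X S by (intro open_Int open_INT) auto
      then obtain r where r: "r > 0" "ball x0 r \<subseteq> S \<inter> (\<Inter>b\<in>fd_basis. X b)"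
        using X(2) S(2) openE[of "S \<inter> (\<Inter>b\<in>fd_basis. X b)" x0] by blast
      have bd: "norm (D h x v - D h x0 v) \<le> e / 2 * norm v" if "x \<in> ball x0 r" for h x v
      proof -
        have xS: "x \<in> S" using that r by auto
        have "linear (\<lambda>v. D h x v - D h x0 v)"
          using lin xS S(2) by (intro linear_compose_sub) auto
        moreover have "norm (D h x b - D h x0 b) \<le> e / (2 * C)" if "b \<in> fd_basis" for b
          using X(4)[of x b h] that r \<open>x \<in> ball x0 r\<close> by (auto intro: less_imp_le)
        ultimately have "norm (D h x v - D h x0 v) \<le> e / (2 * C) * (C - 1) * norm v"
          using linear_fd_bound[of "\<lambda>v. D h x v - D h x0 v" "e / (2 * C)" v] by (simp add: C_def)
        also have "\<dots> \<le> e / (2 * C) * C * norm v"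
          using e C by (intro mult_right_mono mult_left_mono) auto
        finally show ?thesis using C by simp
      qed
      \<comment> \<open>Subtracting the linear map \<open>D h x0\<close> leaves a function with
        small derivative, to which the mean value inequality applies.\<close>
      have est: "\<bar>u h y - u h x0 - D h x0 (y - x0)\<bar> \<le> e / 2 * norm (y - x0)" if y: "y \<in> ball x0 r" for h y
      proof -
        have "norm ((u h y - D h x0 y) - (u h x0 - D h x0 x0)) \<le> e / 2 * norm (y - x0)"
        proof (rule differentiable_bound[of "ball x0 r" "\<lambda>x. u h x - D h x0 x" "\<lambda>x v. D h x v - D h x0 v"])
          have "bounded_linear (D h x0)" using lin[OF S(2)] linear_fd_bounded by blast
          note l = bounded_linear_imp_has_derivative[OF this]
          show "((\<lambda>x. u h x - D h x0 x) has_derivative (\<lambda>v. D h x v - D h x0 v)) (at x within ball x0 r)"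
            if "x \<in> ball x0 r" for x
          proof -
            have "x \<in> S" using that r(2) by blast
            from has_derivative_diff[OF u[OF this] l] show ?thesis by (rule has_derivative_at_withinI)
          qed
          show "onorm (\<lambda>v. D h x v - D h x0 v) \<le> e / 2" if "x \<in> ball x0 r" for x
            using bd[OF that] e by (intro onorm_bound) auto
        qed (use y r in auto)
        moreover have "D h x0 (y - x0) = D h x0 y - D h x0 x0" using linear_diff[OF lin[OF S(2)]] .
        ultimately show ?thesis unfolding real_norm_def by (smt (verit))
      qed
      have "norm ((mean (\<lambda>h. u h y) - mean (\<lambda>h. u h x0) - mean (\<lambda>h. D h x0 (y - x0))) /\<^sub>R norm (y - x0)) < e"
        if y: "y \<noteq> x0" "dist y x0 < r" for y
      proof -
        have yb: "y \<in> ball x0 r" using y by (simp add: dist_commute)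
        have c: "continuous_on UNIV (\<lambda>h. u h y)" "continuous_on UNIV (\<lambda>h. u h x0)"
          using cu yb r(2) S(2) by auto
        have eq: "mean (\<lambda>h. u h y) - mean (\<lambda>h. u h x0) - mean (\<lambda>h. D h x0 (y - x0)) =
          mean (\<lambda>h. u h y - u h x0 - D h x0 (y - x0))"
          using mean_diff[OF continuous_on_diff[OF c] cD0] mean_diff[OF c] by simp
        have "- (e / 2 * norm (y - x0)) \<le> u h y - u h x0 - D h x0 (y - x0)"
          "u h y - u h x0 - D h x0 (y - x0) \<le> e / 2 * norm (y - x0)" for h
          using est[OF yb, of h] by linarith+
        from mean_bounds[OF continuous_on_diff[OF continuous_on_diff[OF c] cD0] this]
        have "- (e / 2 * norm (y - x0)) \<le> mean (\<lambda>h. u h y - u h x0 - D h x0 (y - x0))"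
          "mean (\<lambda>h. u h y - u h x0 - D h x0 (y - x0)) \<le> e / 2 * norm (y - x0)" .
        then have "\<bar>mean (\<lambda>h. u h y) - mean (\<lambda>h. u h x0) - mean (\<lambda>h. D h x0 (y - x0))\<bar> \<le> e / 2 * norm (y - x0)"
          unfolding eq by linarith
        also have "\<dots> < e * norm (y - x0)" using e y by simp
        finally show ?thesis using y by (simp add: field_simps)
      qed
      with r(1) show "\<forall>\<^sub>F y in at x0. dist ((mean (\<lambda>h. u h y) - mean (\<lambda>h. u h x0) - mean (\<lambda>h. D h x0 (y - x0))) /\<^sub>R norm (y - x0)) 0 < e"
        unfolding eventually_at by (metis dist_0_norm dist_commute)
    qed
  qed
qed

end

subsection \<open>Primitives of closed forms\<close>

text \<open>The Poincare lemma, with the integral along radii from the centre as primitive. Symmetry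
  of \<open>H\<close> is closedness of the form \<open>a\<close>.\<close>

lemma poincare_ball:
  fixes a :: "'e::finite_dim_inner \<Rightarrow> 'e \<Rightarrow> real"
  defines "H \<equiv> \<lambda>e x. frechet_derivative (\<lambda>x. a x e) (at x)"
  assumes lin: "\<And>x. x \<in> ball x0 r \<Longrightarrow> linear (a x)"
    and smooth: "\<And>e. Ck_on 1 (ball x0 r) (\<lambda>x. a x e)"
    and symmetric_H: "\<And>x e e'. x \<in> ball x0 r \<Longrightarrow> H e' x e = H e x e'"
  shows "\<exists>\<phi>. \<forall>x\<in>ball x0 r. (\<phi> has_derivative a x) (at x)"
proof -
  let ?S = "ball x0 r"
  have s1: "Ck_on (Suc 0) ?S (\<lambda>x. a x e)" for e using smooth by simp
  have H: "((\<lambda>x. a x e) has_derivative H e x) (at x)" if "x \<in> ?S" for x e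
    using Ck_on_SucD(1)[OF s1 that] by (simp add: H_def)
  have linH: "linear (H e x)" if "x \<in> ?S" for x e
    using H[OF that] has_derivative_linear by blast
  have contH: "continuous_on ?S (\<lambda>x. H e x v)" for e v
    using Ck_on_SucD(2)[OF s1] by (simp add: H_def)
  have conta: "continuous_on ?S (\<lambda>x. a x e)" for e
    using Ck_on_continuous[OF s1] .
  define \<phi> where "\<phi> x = integral (cbox 0 1) (\<lambda>t. a (x0 + t *\<^sub>R (x - x0)) (x - x0))" for x
  have seg: "x0 + t *\<^sub>R (x - x0) \<in> ?S" if "x \<in> ?S" "0 \<le> t" "t \<le> 1" for x t
  proof -
    have "norm (t *\<^sub>R (x - x0)) \<le> norm (x - x0)" using that by (simp add: mult_left_le_one_le)
    also have "\<dots> < r" using that by (simp add: dist_norm norm_minus_commute)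
    finally show ?thesis by (simp add: dist_norm)
  qed
  have dir: "((\<lambda>s. \<phi> (x + s *\<^sub>R v)) has_real_derivative a x v) (at 0)" if x: "x \<in> ?S" for x v
  proof -
    let ?y = "\<lambda>s. x + s *\<^sub>R v - x0"
    let ?z = "\<lambda>s t. x0 + t *\<^sub>R ?y s"
    let ?fx = "\<lambda>s t. a (?z s t) v + t * H v (?z s t) (?y s)"
    have "open ((\<lambda>s. x + s *\<^sub>R v) -` ?S)"
      by (intro open_vimage open_ball continuous_intros)
    moreover have "0 \<in> (\<lambda>s. x + s *\<^sub>R v) -` ?S" using x by simp
    ultimately obtain d where d0: "d > 0" "ball 0 d \<subseteq> (\<lambda>s. x + s *\<^sub>R v) -` ?S"
      using openE by blast
    then have d: "d > 0" "\<And>s. s \<in> ball 0 d \<Longrightarrow> x + s *\<^sub>R v \<in> ?S" by blast+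
    let ?U = "ball (0::real) d"
    have z: "?z s t \<in> ?S" if "s \<in> ?U" "t \<in> cbox 0 1" for s t
      using seg[OF d(2)[OF that(1)], of t] that(2) by simp
    \<comment> \<open>Both arguments of \<open>a\<close> move with \<open>s\<close>. Expansion in
      the basis turns the integrand into a sum of products of real functions, to which the product
      rule applies.\<close>
    have exp_a: "a p w = (\<Sum>b\<in>fd_basis. (w \<bullet> b / (b \<bullet> b)) * a p b)" if "p \<in> ?S" for p w
      using linear_fd_expand[OF lin[OF that], of w] unfolding real_scaleR_def .
    have exp_H: "H e p w = (\<Sum>b\<in>fd_basis. (w \<bullet> b / (b \<bullet> b)) * H e p b)" if "p \<in> ?S" for e p w
      using linear_fd_expand[OF linH[OF that], of e w] unfolding real_scaleR_def .
    have "((\<lambda>s. integral (cbox 0 1) (\<lambda>t. a (?z s t) (?y s))) has_vector_derivative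
        integral (cbox 0 1) (?fx 0)) (at 0 within ?U)"
    proof (rule leibniz_rule_vector_derivative)
      fix s t assume st: "s \<in> ?U" "t \<in> cbox (0::real) 1"
      have zd: "((\<lambda>s. ?z s t) has_derivative (\<lambda>h. h *\<^sub>R t *\<^sub>R v)) (at s)"
        by (auto intro!: derivative_eq_intros)
      have ad: "((\<lambda>s. a (?z s t) b) has_real_derivative t * H b (?z s t) v) (at s)" for b
        unfolding has_field_derivative_def
      proof (rule has_derivative_eq_rhs[OF has_derivative_compose[OF zd H[OF z[OF st]]]])
        show "(\<lambda>h. H b (?z s t) (h *\<^sub>R t *\<^sub>R v)) = (*) (t * H b (?z s t) v)"
          unfolding linear_scale[OF linH[OF z[OF st]]] by (auto simp: mult_ac)
      qed
      have yd: "((\<lambda>s. ?y s \<bullet> b / (b \<bullet> b)) has_real_derivative (v \<bullet> b / (b \<bullet> b))) (at s)" for b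
        by (rule DERIV_cdivide) (auto simp: inner_diff_left inner_add_left intro!: derivative_eq_intros)
      have "((\<lambda>s. \<Sum>b\<in>fd_basis. (?y s \<bullet> b / (b \<bullet> b)) * a (?z s t) b) has_real_derivative
          (\<Sum>b\<in>fd_basis. (v \<bullet> b / (b \<bullet> b)) * a (?z s t) b + (t * H b (?z s t) v) * (?y s \<bullet> b / (b \<bullet> b)))) (at s)"
        by (intro DERIV_sum DERIV_mult yd ad)
      \<comment> \<open>Symmetry exchanges \<open>H b (?z s t) v\<close> for
        \<open>H v (?z s t) b\<close>; the sum over \<open>b\<close> then collapses to a single
        value of \<open>H v (?z s t)\<close>.\<close>
      also have "(\<Sum>b\<in>fd_basis. (v \<bullet> b / (b \<bullet> b)) * a (?z s t) b + (t * H b (?z s t) v) * (?y s \<bullet> b / (b \<bullet> b))) = ?fx s t"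
        unfolding exp_a[OF z[OF st], of v] exp_H[OF z[OF st], of v "?y s"] sum_distrib_left sum.distrib[symmetric]
        by (intro sum.cong) (simp_all add: symmetric_H[OF z[OF st], of _ v] mult_ac)
      finally have "((\<lambda>s. \<Sum>b\<in>fd_basis. (?y s \<bullet> b / (b \<bullet> b)) * a (?z s t) b) has_real_derivative ?fx s t) (at s)" .
      then have "((\<lambda>s. a (?z s t) (?y s)) has_real_derivative ?fx s t) (at s)"
      proof (rule has_field_derivative_transform_within_open)
        show "open ?U" "s \<in> ?U" using st by auto
        show "(\<Sum>b\<in>fd_basis. (?y s \<bullet> b / (b \<bullet> b)) * a (?z s t) b) = a (?z s t) (?y s)" if "s \<in> ?U" for s
          using exp_a[OF z[OF that st(2)], of "?y s"] by (rule sym)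
      qed
      then show "((\<lambda>s. a (?z s t) (?y s)) has_vector_derivative ?fx s t) (at s within ?U)"
        unfolding has_real_derivative_iff_has_vector_derivative by (rule has_vector_derivative_at_within)
    next
      fix s assume s: "s \<in> ?U"
      have "continuous_on (cbox 0 1) (\<lambda>t. a (?z s t) (?y s))"
        by (rule continuous_on_compose2[OF conta]) (use z[OF s] in \<open>auto intro!: continuous_intros\<close>)
      then show "(\<lambda>t. a (?z s t) (?y s)) integrable_on cbox 0 1" by (rule integrable_continuous)
    next
      have zc: "continuous_on (?U \<times> cbox 0 1) (\<lambda>p. ?z (fst p) (snd p))"
        by (intro continuous_intros)
      have zi: "(\<lambda>p. ?z (fst p) (snd p)) ` (?U \<times> cbox 0 1) \<subseteq> ?S" using z by auto
      have "continuous_on (?U \<times> cbox 0 1) (\<lambda>p. a (?z (fst p) (snd p)) v +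
          snd p * (\<Sum>b\<in>fd_basis. (?y (fst p) \<bullet> b / (b \<bullet> b)) * H v (?z (fst p) (snd p)) b))"
        unfolding divide_inverse
        by (intro continuous_intros continuous_on_compose2[OF conta zc zi] continuous_on_compose2[OF contH zc zi])
      then have "continuous_on (?U \<times> cbox 0 1) (\<lambda>p. ?fx (fst p) (snd p))"
        by (rule continuous_on_eq) (use exp_H[OF z] in force)
      then show "continuous_on (?U \<times> cbox 0 1) (\<lambda>(s, t). ?fx s t)" by (simp add: case_prod_unfold)
    qed (use d(1) in auto)
    then have main: "((\<lambda>s. \<phi> (x + s *\<^sub>R v)) has_real_derivative integral (cbox 0 1) (?fx 0)) (at 0)"
      using d(1) unfolding \<phi>_def has_real_derivative_iff_has_vector_derivative
      by (simp only: at_within_open[OF _ open_ball] centre_in_ball)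
    \<comment> \<open>The integrand \<open>?fx 0 t\<close> is the derivative of
      \<open>t * a (?z 0 t) v\<close>, so its integral over the unit interval is
      \<open>a x v\<close>.\<close>
    have "(?fx 0 has_integral (1 * a (?z 0 1) v - 0 * a (?z 0 0) v)) {0..1}"
    proof (rule fundamental_theorem_of_calculus)
      fix t :: real assume t: "t \<in> {0..1}"
      have z0: "?z 0 t \<in> ?S" using z[of 0 t] t d(1) by simp
      have zd: "((\<lambda>t. ?z 0 t) has_derivative (\<lambda>h. h *\<^sub>R ?y 0)) (at t)"
        by (auto intro!: derivative_eq_intros)
      have "((\<lambda>t. a (?z 0 t) v) has_real_derivative H v (?z 0 t) (?y 0)) (at t)"
        unfolding has_field_derivative_def
      proof (rule has_derivative_eq_rhs[OF has_derivative_compose[OF zd H[OF z0]]])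
        show "(\<lambda>h. H v (?z 0 t) (h *\<^sub>R ?y 0)) = (*) (H v (?z 0 t) (?y 0))"
          unfolding linear_scale[OF linH[OF z0]] by (auto simp: mult_ac)
      qed
      from DERIV_mult[OF DERIV_ident this]
      have "((\<lambda>t. t * a (?z 0 t) v) has_real_derivative ?fx 0 t) (at t)"
        by (simp add: algebra_simps)
      then show "((\<lambda>t. t * a (?z 0 t) v) has_vector_derivative ?fx 0 t) (at t within {0..1})"
        unfolding has_real_derivative_iff_has_vector_derivative by (rule has_vector_derivative_at_within)
    qed simp
    then have "integral (cbox 0 1) (?fx 0) = a x v" by (simp add: integral_unique)
    with main show ?thesis by simp
  qed
  have "(\<phi> has_derivative a x) (at x)" if "x \<in> ?S" for x
    using has_derivative_of_directional[OF open_ball that dir lin conta] .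
  then show ?thesis by blast
qed

lemma coeff_in_coord: "smooth_atlas A \<Longrightarrow> c \<in> charts_at A p \<Longrightarrow>
    coeff_in A \<omega> c e (coord c p) = \<omega> p (coord_vector A c p e)"
  using smooth_atlasD(5)[of A c p] by (simp add: coeff_in_def charts_at_def)

lemma one_form_linear:
  assumes "smooth_atlas A" "one_form A \<omega>" "c \<in> charts_at A p"
  shows "linear (\<lambda>e. \<omega> p (coord_vector A c p e))"
  using assms(2) coord_vector_in[OF assms(1,3)]
  unfolding one_form_def
  by (intro linearI) (simp_all add: coord_vector_add[OF assms(1,3)] coord_vector_scale[OF assms(1,3)] scaleR_conv_of_real)

lemma linear_Re_comp: "linear f \<Longrightarrow> linear (\<lambda>e. Re (f e))"
  using linear_compose[of f Re] bounded_linear.linear[OF bounded_linear_Re] by (simp add: o_def)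

lemma frechet_derivative_Re:
  assumes "f differentiable (at x)"
  shows "frechet_derivative (\<lambda>x. Re (f x)) (at x) e = Re (frechet_derivative f (at x) e)"
  using frechet_derivative_at[OF bounded_linear.has_derivative[OF bounded_linear_Re
    frechet_derivative_works[THEN iffD1, OF assms]]] by metis

lemma smooth_on_Re: "open S \<Longrightarrow> smooth_on S f \<Longrightarrow> smooth_on S (\<lambda>x. Re (f x))"
  unfolding smooth_on_def by (auto intro: Ck_on_bounded_linear[OF bounded_linear_Re])

text \<open>In a chart, the vanishing of \<open>ext_deriv_in\<close> is the symmetry that the
  Poincare lemma asks for. Real parts are taken because primitives are real functions.\<close>

lemma local_primitive:
  fixes A :: "('a::topological_space, 'e::finite_dim_inner) atlas"
  assumes "smooth_atlas A" "smooth_form A \<omega>" "closed_form A \<omega>"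
  shows "\<exists>B \<phi>. open B \<and> p \<in> B \<and> (\<forall>q\<in>B. mderiv A \<phi> q (\<lambda>v. Re (\<omega> q v)))"
proof -
  obtain c where c: "c \<in> charts_at A p" using assms(1) by blast
  then have cA: "c \<in> A" "p \<in> dom_of c" by (auto simp: charts_at_def)
  note at = smooth_atlasD[OF assms(1) cA(1)]
  obtain r where r: "r > 0" "ball (coord c p) r \<subseteq> coord c ` dom_of c"
    using at(2) cA(2) openE by blast
  let ?S = "ball (coord c p) r" and ?a = "\<lambda>x e. Re (coeff_in A \<omega> c e x)"
  have ch: "c \<in> charts_at A (param c x)" "coord c (param c x) = x" if "x \<in> coord c ` dom_of c" for x
    using at(6,7)[OF that] cA(1) by (auto simp: charts_at_def)
  have one: "one_form A \<omega>" using assms(2) by (simp add: smooth_form_def)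
  have sm: "smooth_on (coord c ` dom_of c) (coeff_in A \<omega> c e)" for e
    using assms(2) cA(1) by (simp add: smooth_form_def)
  have "\<exists>\<phi>. \<forall>x\<in>?S. (\<phi> has_derivative ?a x) (at x)"
  proof (rule poincare_ball)
    show "linear (?a x)" if "x \<in> ?S" for x
      unfolding coeff_in_def using ch[of x] that r(2)
      by (intro linear_Re_comp one_form_linear[OF assms(1) one]) auto
    show "Ck_on 1 ?S (\<lambda>x. ?a x e)" for e
      using smooth_on_Re[OF at(2) sm] r(2) unfolding smooth_on_def by (blast intro: Ck_on_subset)
    fix x e e' assume "x \<in> ?S"
    then have x: "x \<in> coord c ` dom_of c" using r(2) by blast
    have "ext_deriv_in A \<omega> c x e e' = 0" using assms(3) cA(1) x unfolding closed_form_def by blast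
    then show "frechet_derivative (\<lambda>x. ?a x e') (at x) e = frechet_derivative (\<lambda>x. ?a x e) (at x) e'"
      using smooth_on_differentiable[OF sm x] by (simp add: frechet_derivative_Re ext_deriv_in_def)
  qed
  then obtain \<phi> where \<phi>: "\<And>x. x \<in> ?S \<Longrightarrow> (\<phi> has_derivative ?a x) (at x)" by blast
  let ?B = "dom_of c \<inter> coord c -` ?S"
  have "open ?B" using continuous_open_preimage[OF at(3,1) open_ball] .
  moreover have "p \<in> ?B" using cA r by simp
  moreover have "mderiv A (\<phi> \<circ> coord c) q (\<lambda>v. Re (\<omega> q v))" if q: "q \<in> ?B" for q
  proof -
    have cq: "c \<in> charts_at A q" using q cA by (simp add: charts_at_def)
    have "((\<phi> \<circ> coord c \<circ> param c) has_derivative ?a (coord c q)) (at (coord c q))"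
      by (rule has_derivative_transform_within_open[OF \<phi> open_ball]) (use q r at(6) in auto)
    then show ?thesis
      by (intro mderivI_chart[OF assms(1) cq]) (simp add: coeff_in_coord[OF assms(1) cq])
  qed
  ultimately show ?thesis by blast
qed

lemma continuous_on_local:
  assumes "\<And>p. p \<in> S \<Longrightarrow> \<exists>N. open N \<and> p \<in> N \<and> continuous_on N f"
  shows "continuous_on S f"
  unfolding continuous_on_def
proof
  fix p assume "p \<in> S"
  then obtain N where "open N" "p \<in> N" "continuous_on N f" using assms by blast
  then have "(f \<longlongrightarrow> f p) (at p)" unfolding continuous_on_def by (metis at_within_open)
  then show "(f \<longlongrightarrow> f p) (at p within S)" by (rule tendsto_within_subset) simp
qed

lemma mderiv_continuous_on:
  assumes "smooth_atlas A" "open B" "\<And>q. q \<in> B \<Longrightarrow> mderiv A \<phi> q (\<alpha> q)"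
  shows "continuous_on B \<phi>"
proof (rule continuous_on_local)
  fix p assume p: "p \<in> B"
  obtain c where c: "c \<in> charts_at A p" using assms(1) by blast
  then have cA: "c \<in> A" "p \<in> dom_of c" by (auto simp: charts_at_def)
  note at = smooth_atlasD[OF assms(1) cA(1)]
  let ?N = "dom_of c \<inter> B"
  have N: "open ?N" using at(1) assms(2) by (rule open_Int)
  have "isCont (\<phi> \<circ> param c) (coord c q)" if q: "q \<in> ?N" for q
  proof -
    have "c \<in> charts_at A q" using q cA by (simp add: charts_at_def)
    then show ?thesis
      using assms(3)[of q] q has_derivative_continuous unfolding mderiv_def by blast
  qed
  then have "continuous_on (coord c ` ?N) (\<phi> \<circ> param c)"
    by (intro continuous_at_imp_continuous_on) blast
  moreover have "continuous_on ?N (coord c)" using at(3) continuous_on_subset by blast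
  ultimately have "continuous_on ?N (\<lambda>q. (\<phi> \<circ> param c) (coord c q))"
    by (rule continuous_on_compose2) simp
  then have "continuous_on ?N \<phi>" by (rule continuous_on_eq) (use at(5) in auto)
  then show "\<exists>N. open N \<and> p \<in> N \<and> continuous_on N \<phi>" using N p cA by blast
qed

text \<open>Charts carry small balls to connected open sets. A connected neighbourhood of the
  identity will make local primitives comparable.\<close>

lemma connected_neighbourhood:
  fixes A :: "('a::topological_space, 'e::real_normed_vector) atlas"
  assumes "smooth_atlas A" "open (V :: 'a set)" "p \<in> V"
  shows "\<exists>U. open U \<and> connected U \<and> p \<in> U \<and> U \<subseteq> V"
proof -
  obtain c where c: "c \<in> charts_at A p" using assms(1) by blast
  then have cA: "c \<in> A" "p \<in> dom_of c" by (auto simp: charts_at_def)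
  note at = smooth_atlasD[OF assms(1) cA(1)]
  from eventually_param[OF assms(1) c assms(2,3)]
  obtain r where r: "r > 0" "\<And>x. x \<in> ball (coord c p) r \<Longrightarrow> x \<in> coord c ` dom_of c \<and> param c x \<in> V"
    unfolding eventually_nhds_metric by (auto simp: dist_commute)
  let ?b = "ball (coord c p) r"
  have "param c ` ?b = dom_of c \<inter> coord c -` ?b"
  proof (intro equalityI subsetI)
    fix q assume "q \<in> param c ` ?b"
    then show "q \<in> dom_of c \<inter> coord c -` ?b" using r(2) at(6,7) by force
  next
    fix q assume "q \<in> dom_of c \<inter> coord c -` ?b"
    then show "q \<in> param c ` ?b" using at(5)[of q] by (metis IntE image_eqI vimageE)
  qed
  moreover have "open (dom_of c \<inter> coord c -` ?b)"
    using continuous_open_preimage[OF at(3,1) open_ball] .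
  moreover have "connected (param c ` ?b)"
    by (rule connected_continuous_image[OF continuous_on_subset[OF at(4)]]) (use r(2) in auto)
  moreover have "p \<in> dom_of c \<inter> coord c -` ?b" using r(1) cA by simp
  moreover have "param c ` ?b \<subseteq> V" using r(2) by blast
  ultimately show ?thesis by (intro exI[of _ "param c ` ?b"]) simp
qed

subsection \<open>Product charts\<close>

abbreviation prod_chart :: "('a, 'e) chart \<Rightarrow> ('b, 'f) chart \<Rightarrow> ('a \<times> 'b, 'e \<times> 'f) chart" where
  "prod_chart c d \<equiv> (dom_of c \<times> dom_of d, map_prod (coord c) (coord d))"

lemma prod_chart_image:
  "coord (prod_chart c d) ` (X \<times> Y) = (coord c ` X) \<times> (coord d ` Y)"
  by (simp add: map_prod_surj_on)

lemma param_prod_chart: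
  assumes "smooth_atlas A" "smooth_atlas B" "c \<in> A" "d \<in> B"
    and "x \<in> coord c ` dom_of c" "y \<in> coord d ` dom_of d"
  shows "param (prod_chart c d) (x, y) = (param c x, param d y)"
proof -
  note ac = smooth_atlasD[OF assms(1,3)] and ad = smooth_atlasD[OF assms(2,4)]
  have "inj_on (map_prod (coord c) (coord d)) (dom_of c \<times> dom_of d)"
    using ac(5) ad(5) by (intro map_prod_inj_on) (metis inj_onI)+
  then show ?thesis
    unfolding param_def[of "prod_chart c d"] using ac(6,7) ad(6,7) assms(5,6)
    by (intro inv_into_f_eq) auto
qed

subsection \<open>Translations of a compact Lie group\<close>

locale compact_lie_group =
  fixes A :: "('a::{t2_space,second_countable_topology}, 'e::finite_dim_inner) atlas"
    and mul :: "'a \<Rightarrow> 'a \<Rightarrow> 'a" (infixl "\<star>" 70)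
    and one :: 'a and inve :: "'a \<Rightarrow> 'a"
  assumes lie: "lie_group A mul one inve"
    and compact: "compact (UNIV :: 'a set)"
begin

lemma atlas: "smooth_atlas A"
  using lie by (simp add: lie_group_def)

sublocale compact_group mul one inve
proof -
  interpret group mul one inve using lie by (simp add: lie_group_def)
  show "compact_group mul one inve"
    using lie compact by unfold_locales (auto simp: lie_group_def smooth_map_def)
qed

lemma chart_at_param:
  assumes "c \<in> A" "x \<in> coord c ` dom_of c"
  shows "c \<in> charts_at A (param c x)" "coord c (param c x) = x"
  using smooth_atlasD(6,7)[OF atlas assms] assms(1) by (auto simp: charts_at_def)

definition mul_dom :: "('a, 'e) chart \<Rightarrow> ('a, 'e) chart \<Rightarrow> ('a, 'e) chart \<Rightarrow> ('e \<times> 'e) set" where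
  "mul_dom b c d = {(y, x). y \<in> coord b ` dom_of b \<and> x \<in> coord c ` dom_of c \<and> param b y \<star> param c x \<in> dom_of d}"

definition mul_coord :: "('a, 'e) chart \<Rightarrow> ('a, 'e) chart \<Rightarrow> ('a, 'e) chart \<Rightarrow> 'e \<times> 'e \<Rightarrow> 'e" where
  "mul_coord b c d = (\<lambda>(y, x). coord d (param b y \<star> param c x))"

text \<open>The partial derivative in the second factor, taken as the total derivative along
  \<open>(0, e)\<close>: its regularity in both variables then comes from joint smoothness of the
  multiplication.\<close>

abbreviation mul_deriv :: "('a, 'e) chart \<Rightarrow> ('a, 'e) chart \<Rightarrow> ('a, 'e) chart \<Rightarrow> 'e \<times> 'e \<Rightarrow> 'e \<Rightarrow> 'e" where
  "mul_deriv b c d z e \<equiv> frechet_derivative (mul_coord b c d) (at z) (0, e)"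

lemma mul_coord:
  assumes "b \<in> A" "c \<in> A" "d \<in> A"
  shows "open (mul_dom b c d)" "smooth_on (mul_dom b c d) (mul_coord b c d)"
proof -
  note ab = smooth_atlasD[OF atlas assms(1)] and ac = smooth_atlasD[OF atlas assms(2)]
    and ad = smooth_atlasD[OF atlas assms(3)]
  let ?R = "coord b ` dom_of b \<times> coord c ` dom_of c"
  have "continuous_on ?R (\<lambda>z. param b (fst z) \<star> param c (snd z))"
    by (intro continuous_intros continuous_on_compose2[OF ab(4)] continuous_on_compose2[OF ac(4)]) auto
  from continuous_open_preimage[OF this open_Times[OF ab(2) ac(2)] ad(1)]
  have "open (?R \<inter> (\<lambda>z. param b (fst z) \<star> param c (snd z)) -` dom_of d)" .
  moreover have "mul_dom b c d = ?R \<inter> (\<lambda>z. param b (fst z) \<star> param c (snd z)) -` dom_of d"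
    by (auto simp: mul_dom_def)
  ultimately show op: "open (mul_dom b c d)" by simp
  let ?p = "prod_chart b c"
  have "?p \<in> prod_atlas A A" unfolding prod_atlas_def using assms by blast
  then have sm: "smooth_on (coord ?p ` (dom_of ?p \<inter> (\<lambda>(x, y). x \<star> y) -` dom_of d)) (coord d \<circ> (\<lambda>(x, y). x \<star> y) \<circ> param ?p)"
    using lie assms(3) by (auto simp: lie_group_def smooth_map_def)
  have eq: "coord ?p ` (dom_of ?p \<inter> (\<lambda>(x, y). x \<star> y) -` dom_of d) = mul_dom b c d"
  proof (intro equalityI subsetI)
    fix z assume "z \<in> mul_dom b c d"
    then show "z \<in> coord ?p ` (dom_of ?p \<inter> (\<lambda>(x, y). x \<star> y) -` dom_of d)"
      using ab(6,7) ac(6,7)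
      by (intro image_eqI[of _ _ "(param b (fst z), param c (snd z))"]) (auto simp: mul_dom_def)
  qed (use ab(5) ac(5) in \<open>auto simp: mul_dom_def\<close>)
  have val: "(coord d \<circ> (\<lambda>(x, y). x \<star> y) \<circ> param ?p) z = mul_coord b c d z" if "z \<in> mul_dom b c d" for z
    using that param_prod_chart[OF atlas atlas assms(1,2), of "fst z" "snd z"]
    by (auto simp: mul_dom_def mul_coord_def)
  show "smooth_on (mul_dom b c d) (mul_coord b c d)"
    by (rule smooth_on_cong[OF op _ sm[unfolded eq]]) (rule val)
qed

lemma left_mul_has_derivative:
  assumes "b \<in> charts_at A h" "c \<in> charts_at A p" "d \<in> charts_at A (h \<star> p)"
  shows "((coord d \<circ> (\<star>) h \<circ> param c) has_derivative mul_deriv b c d (coord b h, coord c p)) (at (coord c p))"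
    and "(coord b h, coord c p) \<in> mul_dom b c d"
proof -
  have m: "b \<in> A" "h \<in> dom_of b" "c \<in> A" "p \<in> dom_of c" "d \<in> A" "h \<star> p \<in> dom_of d"
    using assms by (auto simp: charts_at_def)
  have ph: "param b (coord b h) = h" "param c (coord c p) = p"
    using smooth_atlasD(5)[OF atlas] m by auto
  show mem: "(coord b h, coord c p) \<in> mul_dom b c d"
    using m ph by (auto simp: mul_dom_def)
  have 1: "(mul_coord b c d has_derivative frechet_derivative (mul_coord b c d) (at (coord b h, coord c p)))
      (at (coord b h, coord c p))"
    using smooth_on_differentiable[OF mul_coord(2)[OF m(1,3,5)] mem] frechet_derivative_works by blast
  have 2: "((\<lambda>x. (coord b h, x)) has_derivative (\<lambda>e. (0, e))) (at (coord c p))"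
    by (auto intro!: derivative_eq_intros)
  from has_derivative_compose[OF 2 1]
  show "((coord d \<circ> (\<star>) h \<circ> param c) has_derivative mul_deriv b c d (coord b h, coord c p)) (at (coord c p))"
    by (simp add: mul_coord_def o_def ph)
qed

lemma mdiff_left_mul: "mdiff A A ((\<star>) h) p"
  unfolding mdiff_def
proof (intro conjI ballI)
  show "continuous_on UNIV ((\<star>) h)" by (intro continuous_intros)
  fix c d assume "c \<in> charts_at A p" "d \<in> charts_at A (h \<star> p)"
  from left_mul_has_derivative(1)[OF chart_at_in[OF atlas] this]
  show "(coord d \<circ> (\<star>) h \<circ> param c) differentiable (at (coord c p))"
    unfolding differentiable_def by blast
qed

lemma differential_left_mul:
  assumes "b \<in> charts_at A h" "c \<in> charts_at A p" "d \<in> charts_at A (h \<star> p)"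
  shows "differential A A ((\<star>) h) p (coord_vector A c p e) =
    coord_vector A d (h \<star> p) (mul_deriv b c d (coord b h, coord c p) e)"
  using differential_coord_vector[OF atlas atlas mdiff_left_mul assms(2,3)]
    frechet_derivative_at[OF left_mul_has_derivative(1)[OF assms]] by metis

lemma differential_left_mul_comp:
  assumes "v \<in> tangent_space A p"
  shows "differential A A ((\<star>) h) (k \<star> p) (differential A A ((\<star>) k) p v) = differential A A ((\<star>) (h \<star> k)) p v"
proof -
  have "(\<star>) h \<circ> (\<star>) k = (\<star>) (h \<star> k)" by (simp add: fun_eq_iff assoc)
  then show ?thesis
    using differential_comp[OF atlas atlas atlas mdiff_left_mul mdiff_left_mul assms] by metis
qed

end

subsection \<open>The primitive of the averaged form\<close>

locale closed_form_on_group = compact_lie_group A mul one inve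
  for A :: "('a::{t2_space,second_countable_topology}, 'e::finite_dim_inner) atlas"
    and mul :: "'a \<Rightarrow> 'a \<Rightarrow> 'a" (infixl "\<star>" 70)
    and one :: 'a and inve :: "'a \<Rightarrow> 'a" +
  fixes \<omega> :: "('a, 'e) form"
  assumes connected: "connected (UNIV :: 'a set)"
    and smooth: "smooth_form A \<omega>" and closed: "closed_form A \<omega>" and real: "real_form A \<omega>"
begin

section \<open>The forms \<open>L_h^*\<omega> - \<omega>\<close> and their primitives\<close>

definition displacement :: "'a \<Rightarrow> 'a \<Rightarrow> ('a, 'e) tangent \<Rightarrow> real" where
  "displacement h p v = Re (\<omega> (h \<star> p) (differential A A ((\<star>) h) p v)) - Re (\<omega> p v)"

lemma one_form: "one_form A \<omega>"
  using smooth by (simp add: smooth_form_def)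

text \<open>The difference is split at the intermediate point \<open>k \<star> p\<close>, with the
  chain rule for translations.\<close>

lemma displacement_mul:
  assumes "v \<in> tangent_space A p"
  shows "displacement (h \<star> k) p v = displacement h (k \<star> p) (differential A A ((\<star>) k) p v) + displacement k p v"
  by (simp add: displacement_def differential_left_mul_comp[OF assms] assoc)

text \<open>One \<open>U\<close> has to serve all points, since the primitives built from it are
  global functions for each fixed \<open>h\<close>. Continuity of the product gives a neighbourhood
  of the identity for each point, and compactness reduces these to finitely many.\<close>

lemma small_neighbourhood:
  "\<exists>U. open U \<and> connected U \<and> one \<in> U \<and>
    (\<forall>p. \<exists>W B \<phi>. open W \<and> p \<in> W \<and> open B \<and> (\<forall>h\<in>U. \<forall>q\<in>W. h \<star> q \<in> B) \<and>
      (\<forall>q\<in>B. mderiv A \<phi> q (\<lambda>v. Re (\<omega> q v))))"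
proof -
  have "\<exists>V W B \<phi>. open V \<and> one \<in> V \<and> open W \<and> p \<in> W \<and> open B \<and> (\<forall>h\<in>V. \<forall>q\<in>W. h \<star> q \<in> B) \<and>
      (\<forall>q\<in>B. mderiv A \<phi> q (\<lambda>v. Re (\<omega> q v)))" for p
  proof -
    obtain B \<phi> where B: "open B" "p \<in> B" "\<forall>q\<in>B. mderiv A \<phi> q (\<lambda>v. Re (\<omega> q v))"
      using local_primitive[OF atlas smooth closed] by blast
    have "open ((\<lambda>(h, q). h \<star> q) -` B)" by (rule open_vimage[OF B(1) continuous_mul])
    moreover have "(one, p) \<in> (\<lambda>(h, q). h \<star> q) -` B" using B(2) by simp
    ultimately obtain V W where "open V" "open W" "one \<in> V" "p \<in> W" "V \<times> W \<subseteq> (\<lambda>(h, q). h \<star> q) -` B"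
      by (rule open_prod_elim) auto
    then show ?thesis using B
      by (intro exI[of _ V] exI[of _ W] exI[of _ B] exI[of _ \<phi>]) auto
  qed
  then obtain V W B \<phi> where V: "\<And>p. open (V p)" "\<And>p. one \<in> V p" "\<And>p. open (W p)" "\<And>p. p \<in> W p" "\<And>p. open (B p)"
      "\<And>p h q. h \<in> V p \<Longrightarrow> q \<in> W p \<Longrightarrow> h \<star> q \<in> B p"
      "\<And>p q. q \<in> B p \<Longrightarrow> mderiv A (\<phi> p) q (\<lambda>v. Re (\<omega> q v))"
    by metis
  have "UNIV \<subseteq> (\<Union>p. W p)" using V(4) by auto
  from compactE_image[OF compact V(3) this] obtain P where P: "finite P" "UNIV \<subseteq> (\<Union>p\<in>P. W p)"
    by metis
  have "open (\<Inter>p\<in>P. V p)" using P(1) V(1) by (intro open_INT) auto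
  moreover have "one \<in> (\<Inter>p\<in>P. V p)" using V(2) by auto
  ultimately have "\<exists>U. open U \<and> connected U \<and> one \<in> U \<and> U \<subseteq> (\<Inter>p\<in>P. V p)"
    by (rule connected_neighbourhood[OF atlas])
  then obtain U where U: "open U" "connected U" "one \<in> U" "U \<subseteq> (\<Inter>p\<in>P. V p)"
    by blast
  show ?thesis
  proof (rule exI[of _ U], intro conjI U(1-3) allI)
    fix p
    obtain q where q: "q \<in> P" "p \<in> W q" using P(2) by blast
    then have "\<forall>h\<in>U. \<forall>x\<in>W q. h \<star> x \<in> B q" using V(6) U(4) by blast
    then show "\<exists>W B \<phi>. open W \<and> p \<in> W \<and> open B \<and> (\<forall>h\<in>U. \<forall>q\<in>W. h \<star> q \<in> B) \<and>
      (\<forall>q\<in>B. mderiv A \<phi> q (\<lambda>v. Re (\<omega> q v)))"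
      using V(3,5,7) q(2) by (intro exI[of _ "W q"] exI[of _ "B q"] exI[of _ "\<phi> q"]) simp
  qed
qed

text \<open>A primitive \<open>\<phi>\<close> of \<open>\<omega>\<close> near \<open>p\<close> gives the primitive \<open>\<phi> (h \<star> p) - \<phi> p\<close> of the displacement. It does
  not depend on \<open>\<phi>\<close>: two primitives differ by a constant on the connected set \<open>U \<star> p\<close>.\<close>

lemma local_displacement_primitive:
  "\<exists>U G. open U \<and> one \<in> U \<and> (\<forall>h\<in>U. \<forall>p. mderiv A (G h) p (displacement h p)) \<and>
    (\<forall>p. continuous_on U (\<lambda>h. G h p))"
proof -
  obtain U where U: "open U" "connected U" "one \<in> U"
    "\<forall>p. \<exists>W B \<phi>. open W \<and> p \<in> W \<and> open B \<and> (\<forall>h\<in>U. \<forall>q\<in>W. h \<star> q \<in> B) \<and>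
      (\<forall>q\<in>B. mderiv A \<phi> q (\<lambda>v. Re (\<omega> q v)))"
    using small_neighbourhood by (elim exE conjE)
  then obtain W B \<phi> where V: "\<And>p. open (W p)" "\<And>p. p \<in> W p" "\<And>p. open (B p)"
      "\<And>p h q. h \<in> U \<Longrightarrow> q \<in> W p \<Longrightarrow> h \<star> q \<in> B p"
      "\<And>p q. q \<in> B p \<Longrightarrow> mderiv A (\<phi> p) q (\<lambda>v. Re (\<omega> q v))"
    by metis
  define G where "G h p = \<phi> p (h \<star> p) - \<phi> p p" for h p
  have G: "G h q = \<phi> p (h \<star> q) - \<phi> p q" if h: "h \<in> U" and q: "q \<in> W p" for h p q
  proof -
    have "\<phi> q (h \<star> q) - \<phi> p (h \<star> q) = \<phi> q (one \<star> q) - \<phi> p (one \<star> q)"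
    proof (rule mderiv_zero_imp_constant[OF atlas, of "B p \<inter> B q" "(\<lambda>h. h \<star> q) ` U" "\<lambda>x. \<phi> q x - \<phi> p x"])
      show "connected ((\<lambda>h. h \<star> q) ` U)"
        by (intro connected_continuous_image U(2) continuous_intros)
      show "mderiv A (\<lambda>x. \<phi> q x - \<phi> p x) x (\<lambda>v. 0)" if "x \<in> B p \<inter> B q" for x
        using mderiv_diff[OF V(5)[of x q] V(5)[of x p]] that by simp
      show "h \<star> q \<in> (\<lambda>h. h \<star> q) ` U" "one \<star> q \<in> (\<lambda>h. h \<star> q) ` U"
        using h U(3) by (blast intro: imageI)+
    qed (use V q in auto)
    then show ?thesis by (simp add: G_def algebra_simps)
  qed
  show ?thesis
  proof (rule exI[of _ U], rule exI[of _ G], intro conjI U(1,3) ballI allI)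
    fix h p assume h: "h \<in> U"
    have "mderiv A (\<phi> p \<circ> (\<star>) h) p (\<lambda>v. Re (\<omega> (h \<star> p) (differential A A ((\<star>) h) p v)))"
      using V(2,4,5) h by (intro mderiv_comp[OF atlas atlas mdiff_left_mul]) blast
    moreover have "mderiv A (\<phi> p) p (\<lambda>v. Re (\<omega> p v))"
      using V(5)[of p p] V(4)[OF U(3) V(2)[of p]] by simp
    ultimately have "mderiv A (\<lambda>q. (\<phi> p \<circ> (\<star>) h) q - \<phi> p q) p (displacement h p)"
      unfolding displacement_def[abs_def] by (rule mderiv_diff)
    \<comment> \<open>On \<open>W p\<close> the single primitive \<open>\<phi> p\<close> computes
      \<open>G h\<close>, so \<open>G h\<close> inherits this derivative.\<close>
    then show "mderiv A (G h) p (displacement h p)"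
      by (rule mderiv_transform[OF atlas _ V(1)[of p] V(2)]) (simp add: G[OF h])
  next
    fix p
    have "continuous_on (B p) (\<phi> p)" using mderiv_continuous_on[OF atlas V(3) V(5)] .
    then have "continuous_on U (\<lambda>h. \<phi> p (h \<star> p))"
      by (rule continuous_on_compose2) (use V(2,4) in \<open>auto intro!: continuous_intros\<close>)
    then show "continuous_on U (\<lambda>h. G h p)" unfolding G_def by (intro continuous_intros)
  qed
qed

lemma displacement_exact: "\<exists>g. \<forall>p. mderiv A g p (displacement h p)"
proof -
  obtain U G where "open U" "one \<in> U" "\<forall>h\<in>U. \<forall>p. mderiv A (G h) p (displacement h p)"
    "\<forall>p. continuous_on U (\<lambda>h. G h p)"
    using local_displacement_primitive by (elim exE conjE)
  then have U: "open U" "one \<in> U" "\<And>h p. h \<in> U \<Longrightarrow> mderiv A (G h) p (displacement h p)"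
    "\<And>p. continuous_on U (\<lambda>h. G h p)"
    by simp_all
  define H where "H = {h. \<exists>g. \<forall>p. mderiv A g p (displacement h p)}"
  have UH: "h \<star> k \<in> H" if h: "h \<in> U" and k: "k \<in> H" for h k
  proof -
    obtain g where g: "\<And>p. mderiv A g p (displacement k p)" using k H_def by blast
    have "mderiv A (\<lambda>q. (G h \<circ> (\<star>) k) q + g q) p (displacement (h \<star> k) p)" for p
      by (rule mderiv_cong[OF atlas mderiv_add[OF mderiv_comp[OF atlas atlas mdiff_left_mul U(3)[OF h]] g]])
        (simp add: displacement_mul)
    then show ?thesis unfolding H_def by blast
  qed
  have "open H"
  proof (rule topological_space_class.openI)
    fix k assume k: "k \<in> H"
    have "open ((\<lambda>x. x \<star> inve k) -` U)" by (intro open_vimage U(1) continuous_intros)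
    moreover have "k \<in> (\<lambda>x. x \<star> inve k) -` U" using U(2) by simp
    moreover have "x \<in> H" if "x \<in> (\<lambda>x. x \<star> inve k) -` U" for x
      using UH[OF _ k, of "x \<star> inve k"] that by (simp add: assoc)
    ultimately show "\<exists>T. open T \<and> k \<in> T \<and> T \<subseteq> H" by blast
  qed
  moreover have "open (- H)"
  proof (rule topological_space_class.openI)
    fix k assume k: "k \<in> - H"
    \<comment> \<open>If such an \<open>x\<close> were in \<open>H\<close>, then
      \<open>k = (k \<star> inve x) \<star> x\<close> would be in \<open>H\<close> too.\<close>
    have "open ((\<lambda>x. k \<star> inve x) -` U)" by (intro open_vimage U(1) continuous_intros)
    moreover have "k \<in> (\<lambda>x. k \<star> inve x) -` U" using U(2) by simp
    moreover have "x \<in> - H" if "x \<in> (\<lambda>x. k \<star> inve x) -` U" for x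
      using UH[of "k \<star> inve x" x] that k by (auto simp: assoc)
    ultimately show "\<exists>T. open T \<and> k \<in> T \<and> T \<subseteq> - H" by blast
  qed
  moreover have "one \<in> H" using U(2,3) H_def by blast
  ultimately have "H = UNIV"
    using connected unfolding connected_clopen by (metis closed_closedin closed_def empty_iff open_openin subtopology_UNIV)
  then show ?thesis unfolding H_def by blast
qed

text \<open>Normalising at \<open>one\<close> makes the primitive unique on the connected group, so
  the choices for different \<open>h\<close> fit together: they depend continuously on
  \<open>h\<close> and satisfy an exact cocycle identity.\<close>

definition cocyc :: "'a \<Rightarrow> 'a \<Rightarrow> real" where
  "cocyc h = (SOME g. (\<forall>p. mderiv A g p (displacement h p)) \<and> g one = 0)"

lemma cocyc: "mderiv A (cocyc h) p (displacement h p)" "cocyc h one = 0"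
proof -
  obtain g where g: "\<And>p. mderiv A g p (displacement h p)" using displacement_exact by blast
  have "mderiv A (\<lambda>p. g p - g one) p (displacement h p)" for p
    using mderiv_diff[OF g mderiv_const[of A "g one"]] by simp
  then have "\<exists>g. (\<forall>p. mderiv A g p (displacement h p)) \<and> g one = 0"
    by (intro exI[of _ "\<lambda>p. g p - g one"]) simp
  from someI_ex[OF this] show "mderiv A (cocyc h) p (displacement h p)" "cocyc h one = 0"
    unfolding cocyc_def by blast+
qed

lemma cocyc_unique:
  assumes "\<And>p. mderiv A g p (displacement h p)"
  shows "cocyc h p = g p - g one"
proof -
  have "cocyc h p - g p = cocyc h one - g one"
  proof (rule mderiv_zero_imp_constant[OF atlas open_UNIV connected, of "\<lambda>p. cocyc h p - g p"])
    show "mderiv A (\<lambda>p. cocyc h p - g p) q (\<lambda>v. 0)" for q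
      using mderiv_diff[OF cocyc(1) assms, of h q] by simp
  qed auto
  then show ?thesis by (simp add: cocyc(2))
qed

text \<open>The sum of \<open>cocyc h \<circ> (\<star>) k\<close> and \<open>cocyc k\<close> is a
  primitive for \<open>h \<star> k\<close>; its value at \<open>one\<close> is
  \<open>cocyc h k\<close>, which the normalisation subtracts.\<close>

lemma cocyc_mul: "cocyc (h \<star> k) p = cocyc h (k \<star> p) - cocyc h k + cocyc k p"
proof -
  have "mderiv A (\<lambda>q. (cocyc h \<circ> (\<star>) k) q + cocyc k q) p (displacement (h \<star> k) p)" for p
    by (rule mderiv_cong[OF atlas mderiv_add[OF mderiv_comp[OF atlas atlas mdiff_left_mul cocyc(1)] cocyc(1)]])
      (simp add: displacement_mul)
  from cocyc_unique[OF this] show ?thesis by (simp add: cocyc(2))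
qed

text \<open>Near the identity the local construction is continuous in \<open>h\<close>. The cocycle
  identity with \<open>h = (h \<star> inve k) \<star> k\<close> transports this to every
  \<open>k\<close>.\<close>

lemma continuous_cocyc: "continuous_on UNIV (\<lambda>h. cocyc h p)"
proof (rule continuous_on_local)
  fix k :: 'a
  obtain U G where "open U" "one \<in> U" "\<forall>h\<in>U. \<forall>p. mderiv A (G h) p (displacement h p)"
    "\<forall>p. continuous_on U (\<lambda>h. G h p)"
    using local_displacement_primitive by (elim exE conjE)
  then have U: "open U" "one \<in> U" "\<And>h p. h \<in> U \<Longrightarrow> mderiv A (G h) p (displacement h p)"
    "\<And>p. continuous_on U (\<lambda>h. G h p)"
    by simp_all
  have cU: "continuous_on U (\<lambda>h. cocyc h q)" for q
  proof (rule continuous_on_eq)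
    show "continuous_on U (\<lambda>h. G h q - G h one)" by (intro continuous_intros U(4))
    show "G h q - G h one = cocyc h q" if "h \<in> U" for h
      using cocyc_unique[OF U(3)[OF that]] by simp
  qed
  let ?N = "(\<lambda>h. h \<star> inve k) -` U"
  have "open ?N" by (intro open_vimage U(1) continuous_intros)
  moreover have "k \<in> ?N" using U(2) by simp
  moreover have "continuous_on ?N (\<lambda>h. cocyc h p)"
  proof (rule continuous_on_eq)
    have "continuous_on ?N (\<lambda>h. cocyc (h \<star> inve k) q)" for q
      by (rule continuous_on_compose2[OF cU[of q]]) (auto intro!: continuous_intros)
    then show "continuous_on ?N (\<lambda>h. cocyc (h \<star> inve k) (k \<star> p) - cocyc (h \<star> inve k) k + cocyc k p)"
      by (intro continuous_intros)
    show "cocyc (h \<star> inve k) (k \<star> p) - cocyc (h \<star> inve k) k + cocyc k p = cocyc h p" for h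
      using cocyc_mul[of "h \<star> inve k" k p] by (simp add: assoc)
  qed
  ultimately show "\<exists>N. open N \<and> k \<in> N \<and> continuous_on N (\<lambda>h. cocyc h p)" by blast
qed

lemma continuous_coeff:
  assumes "c \<in> A"
  shows "continuous_on (coord c ` dom_of c) (\<lambda>x. Re (coeff_in A \<omega> c e x))"
  using smooth assms smooth_on_continuous unfolding smooth_form_def
  by (intro continuous_on_Re) blast

text \<open>Joint continuity is what differentiation under the mean requires. In charts the
  pulled-back form is a finite sum of components of \<open>mul_deriv\<close> times coefficients of
  \<omega>, each continuous in both variables.\<close>

lemma continuous_displacement:
  assumes c: "c \<in> A"
  shows "continuous_on (UNIV \<times> coord c ` dom_of c)
    (\<lambda>(h, x). displacement h (param c x) (coord_vector A c (param c x) e))"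
proof (rule continuous_on_local)
  fix z :: "'a \<times> 'e" assume "z \<in> UNIV \<times> coord c ` dom_of c"
  then obtain h0 x0 where z: "z = (h0, x0)" "x0 \<in> coord c ` dom_of c" by blast
  obtain b d where b: "b \<in> charts_at A h0" and d: "d \<in> charts_at A (h0 \<star> param c x0)"
    using atlas by blast
  have bA: "b \<in> A" "h0 \<in> dom_of b" and dA: "d \<in> A"
    using b d by (auto simp: charts_at_def)
  note ab = smooth_atlasD[OF atlas bA(1)] and ac = smooth_atlasD[OF atlas c] and ad = smooth_atlasD[OF atlas dA]
  let ?\<Omega> = "mul_dom b c d" and ?\<Phi> = "mul_coord b c d"
  note \<Omega> = mul_coord[OF bA(1) c dA]
  let ?K = "\<lambda>z. (\<Sum>b'\<in>fd_basis. (mul_deriv b c d z e \<bullet> b' / (b' \<bullet> b')) * Re (coeff_in A \<omega> d b' (?\<Phi> z)))"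
  have "?\<Phi> ` ?\<Omega> \<subseteq> coord d ` dom_of d" by (auto simp: mul_dom_def mul_coord_def)
  then have K: "continuous_on ?\<Omega> ?K"
    unfolding divide_inverse
    by (intro continuous_intros continuous_on_compose2[OF continuous_coeff[OF dA]]
      smooth_on_continuous[OF \<Omega>(2)] smooth_on_continuous[OF smooth_on_derivative[OF \<Omega>(2)]])
  let ?D = "dom_of b \<times> coord c ` dom_of c" and ?f = "\<lambda>p. (coord b (fst p), snd p)"
  let ?N = "?D \<inter> ?f -` ?\<Omega>"
  have fc: "continuous_on ?D ?f"
    by (intro continuous_intros continuous_on_compose2[OF ab(3)]) auto
  have "open ?N"
    by (rule continuous_open_preimage[OF fc open_Times[OF ab(1) ac(2)] \<Omega>(1)])
  moreover have "z \<in> ?N"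
    using left_mul_has_derivative(2)[OF b chart_at_param(1)[OF c z(2)] d] chart_at_param(2)[OF c z(2)] z bA by simp
  moreover have "continuous_on ?N (\<lambda>(h, x). displacement h (param c x) (coord_vector A c (param c x) e))"
  proof (rule continuous_on_eq)
    have "continuous_on ?N (\<lambda>p. ?K (?f p))"
      by (rule continuous_on_compose2[OF K continuous_on_subset[OF fc]]) auto
    moreover have "continuous_on ?N (\<lambda>p. Re (coeff_in A \<omega> c e (snd p)))"
      by (rule continuous_on_compose2[OF continuous_coeff[OF c]]) (auto intro!: continuous_intros)
    ultimately show "continuous_on ?N (\<lambda>p. ?K (?f p) - Re (coeff_in A \<omega> c e (snd p)))"
      by (rule continuous_on_diff)
    fix p assume p: "p \<in> ?N"
    obtain h x where hx: "p = (h, x)" by (cases p)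
    have x: "x \<in> coord c ` dom_of c" and h: "h \<in> dom_of b" and mem: "(coord b h, x) \<in> ?\<Omega>"
      using p hx by auto
    have bh: "b \<in> charts_at A h" using h bA by (simp add: charts_at_def)
    note cx = chart_at_param[OF c x]
    have "h \<star> param c x \<in> dom_of d" using mem h ab(5) by (simp add: mul_dom_def)
    then have dh: "d \<in> charts_at A (h \<star> param c x)" using dA by (simp add: charts_at_def)
    have \<Phi>: "?\<Phi> (coord b h, x) = coord d (h \<star> param c x)" using h ab(5) by (simp add: mul_coord_def)
    have "\<omega> (h \<star> param c x) (differential A A ((\<star>) h) (param c x) (coord_vector A c (param c x) e)) =
        \<omega> (h \<star> param c x) (coord_vector A d (h \<star> param c x) (mul_deriv b c d (coord b h, x) e))"
      using differential_left_mul[OF bh cx(1) dh] cx(2) by simp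
    then have "Re (\<omega> (h \<star> param c x) (differential A A ((\<star>) h) (param c x) (coord_vector A c (param c x) e))) = ?K (?f p)"
      using linear_fd_expand[OF linear_Re_comp[OF one_form_linear[OF atlas one_form dh]], of "mul_deriv b c d (coord b h, x) e"]
      by (simp add: \<Phi> coeff_in_coord[OF atlas dh] hx)
    then show "?K (?f p) - Re (coeff_in A \<omega> c e (snd p)) =
        (\<lambda>(h, x). displacement h (param c x) (coord_vector A c (param c x) e)) p"
      using hx by (simp add: displacement_def coeff_in_def)
  qed
  ultimately show "\<exists>N. open N \<and> z \<in> N \<and> continuous_on N (\<lambda>(h, x). displacement h (param c x) (coord_vector A c (param c x) e))"
    by blast
qed

section \<open>The averaged form and its potential\<close>

definition potential :: "'a \<Rightarrow> real" where
  "potential p = mean (\<lambda>h. cocyc h p)"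

text \<open>On tangent vectors this is the mean over \<open>h\<close> of the translates
  \<open>L_h^*\<omega>\<close>, written so that its difference from \<omega> is visibly the
  differential of \<open>potential\<close>.\<close>

definition invariant_form :: "('a, 'e) form" where
  "invariant_form p v = complex_of_real (Re (\<omega> p v) + mean (\<lambda>h. displacement h p v))"

lemma potential_mderiv: "mderiv A potential p (\<lambda>v. mean (\<lambda>h. displacement h p v))"
proof -
  obtain c where c: "c \<in> charts_at A p" using atlas by blast
  then have cA: "c \<in> A" "p \<in> dom_of c" by (auto simp: charts_at_def)
  note ac = smooth_atlasD[OF atlas cA(1)]
  have "((\<lambda>x. mean (\<lambda>h. (cocyc h \<circ> param c) x)) has_derivative
      (\<lambda>e. mean (\<lambda>h. displacement h (param c (coord c p)) (coord_vector A c (param c (coord c p)) e)))) (at (coord c p))"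
  proof (rule mean_has_derivative[OF ac(2)])
    show "coord c p \<in> coord c ` dom_of c" using cA by simp
    show "((cocyc h \<circ> param c) has_derivative (\<lambda>e. displacement h (param c x) (coord_vector A c (param c x) e))) (at x)"
      if "x \<in> coord c ` dom_of c" for h x
      using cocyc(1)[of h "param c x"] chart_at_param[OF cA(1) that] unfolding mderiv_def by metis
    show "continuous_on UNIV (\<lambda>h. (cocyc h \<circ> param c) x)" for x
      using continuous_cocyc by simp
    show "continuous_on (UNIV \<times> coord c ` dom_of c) (\<lambda>(h, x). displacement h (param c x) (coord_vector A c (param c x) v))" for v
      using continuous_displacement[OF cA(1)] .
  qed
  then show ?thesis
    using ac(5)[OF cA(2)] by (intro mderivI_chart[OF atlas c]) (simp add: potential_def o_def)
qed

text \<open>The invariance of the mean enters here. Solving \<open>cocyc_mul\<close> for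
  \<open>cocyc h (g \<star> p)\<close> leaves \<open>cocyc (h \<star> g) p\<close>, a right
  translate in \<open>h\<close> with the same mean as \<open>cocyc h p\<close>.\<close>

lemma potential_mul: "potential (g \<star> p) = potential p + potential g - cocyc g p"
proof -
  have "cocyc h (g \<star> p) = cocyc (h \<star> g) p + cocyc h g - cocyc g p" for h
    using cocyc_mul[of h g p] by simp
  then have "potential (g \<star> p) = mean (\<lambda>h. cocyc (h \<star> g) p + cocyc h g - cocyc g p)"
    by (simp add: potential_def)
  also have "\<dots> = mean (\<lambda>h. cocyc (h \<star> g) p) + potential g - cocyc g p"
  proof -
    have c: "continuous_on UNIV (\<lambda>h. cocyc (h \<star> g) p)"
      by (rule continuous_on_compose2[OF continuous_cocyc]) (auto intro!: continuous_intros)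
    show ?thesis
      using mean_diff[OF continuous_on_add[OF c continuous_cocyc[of g]] continuous_on_const[of UNIV "cocyc g p"]]
        mean_add[OF c continuous_cocyc[of g]] by (simp add: potential_def)
  qed
  also have "mean (\<lambda>h. cocyc (h \<star> g) p) = potential p"
    using mean_translate[OF continuous_cocyc[of p]] by (simp add: potential_def)
  finally show ?thesis .
qed

lemma left_invariant_form: "left_invariant A (\<star>) invariant_form"
  unfolding left_invariant_def
proof (intro allI ballI)
  fix g p v assume v: "v \<in> tangent_space A p"
  have "mderiv A (potential \<circ> (\<star>) g) p (\<lambda>v. mean (\<lambda>h. displacement h (g \<star> p) (differential A A ((\<star>) g) p v)))"
    by (rule mderiv_comp[OF atlas atlas mdiff_left_mul potential_mderiv])
  moreover have "mderiv A (\<lambda>p. potential p + potential g - cocyc g p) p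
      (\<lambda>v. mean (\<lambda>h. displacement h p v) + 0 - displacement g p v)"
    by (intro mderiv_add mderiv_diff potential_mderiv mderiv_const cocyc(1))
  then have "mderiv A (potential \<circ> (\<star>) g) p (\<lambda>v. mean (\<lambda>h. displacement h p v) + 0 - displacement g p v)"
    by (simp add: o_def potential_mul)
  ultimately have "mean (\<lambda>h. displacement h (g \<star> p) (differential A A ((\<star>) g) p v)) =
      mean (\<lambda>h. displacement h p v) + 0 - displacement g p v"
    by (rule mderiv_unique[OF atlas _ _ v])
  \<comment> \<open>\<open>displacement g p v\<close> is exactly the change of the real part of
    \<omega> under translation by \<open>g\<close>, so it cancels.\<close>
  then show "pullback A A ((\<star>) g) invariant_form p v = invariant_form p v"
    by (simp add: pullback_def invariant_form_def displacement_def)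
qed

text \<open>Linearity comes for free, since the map is a derivative of \<open>potential\<close> in a
  chart.\<close>

lemma linear_mean_displacement:
  assumes "c \<in> charts_at A p"
  shows "linear (\<lambda>e. mean (\<lambda>h. displacement h p (coord_vector A c p e)))"
  using potential_mderiv[of p] assms has_derivative_linear unfolding mderiv_def by blast

lemma invariant_form_linear:
  assumes "c \<in> charts_at A p"
  shows "linear (\<lambda>e. invariant_form p (coord_vector A c p e))"
  unfolding invariant_form_def
  using linear_compose[OF linear_compose_add[OF linear_Re_comp[OF one_form_linear[OF atlas one_form assms]]
    linear_mean_displacement[OF assms]] bounded_linear.linear[OF bounded_linear_of_real[where 'a=complex]]]
  by (simp add: o_def)

lemma one_form_invariant_form: "one_form A invariant_form"
  unfolding one_form_def
proof (intro allI conjI ballI)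
  fix p u v and r :: real assume u: "u \<in> tangent_space A p"
  obtain c where c: "c \<in> charts_at A p" using atlas by blast
  note lin = invariant_form_linear[OF c]
  have "(\<lambda>d. r *\<^sub>R u d) = coord_vector A c p (r *\<^sub>R u c)"
    using coord_vector_scale[OF atlas c, of r "u c"] tangent_eq_coord_vector[OF u c] by simp
  then show "invariant_form p (\<lambda>d. r *\<^sub>R u d) = complex_of_real r * invariant_form p u"
    using linear_scale[OF lin, of r "u c"] tangent_eq_coord_vector[OF u c] by (simp add: scaleR_conv_of_real)
  assume v: "v \<in> tangent_space A p"
  have "(\<lambda>d. u d + v d) = coord_vector A c p (u c + v c)"
    using coord_vector_add[OF atlas c, of "u c" "v c"] tangent_eq_coord_vector[OF u c] tangent_eq_coord_vector[OF v c] by simp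
  then show "invariant_form p (\<lambda>d. u d + v d) = invariant_form p u + invariant_form p v"
    using linear_add[OF lin, of "u c" "v c"] tangent_eq_coord_vector[OF u c] tangent_eq_coord_vector[OF v c] by simp
qed

lemma smooth_invariant_coeff:
  assumes c: "c \<in> A"
  shows "smooth_on (coord c ` dom_of c) (coeff_in A invariant_form c e)"
  unfolding smooth_on_def
proof (intro allI Ck_on_local)
  fix k x0 assume x0: "x0 \<in> coord c ` dom_of c"
  obtain d where d: "d \<in> charts_at A one" using atlas by blast
  obtain b where b: "b \<in> charts_at A (inve (param c x0))" using atlas by blast
  have bA: "b \<in> A" "inve (param c x0) \<in> dom_of b" and dA: "d \<in> A" "one \<in> dom_of d"
    using b d by (auto simp: charts_at_def)
  note ab = smooth_atlasD[OF atlas bA(1)] and ac = smooth_atlasD[OF atlas c]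
  let ?N = "coord c ` (dom_of c \<inter> inve -` dom_of b)"
  let ?i = "coord b \<circ> inve \<circ> param c"
  have N_eq: "?N = coord c ` dom_of c \<inter> (\<lambda>x. inve (param c x)) -` dom_of b"
  proof (intro equalityI subsetI)
    fix x assume "x \<in> coord c ` dom_of c \<inter> (\<lambda>x. inve (param c x)) -` dom_of b"
    then show "x \<in> ?N" using ac(6,7) by (intro image_eqI[of _ _ "param c x"]) auto
  qed (use ac(5) in auto)
  have N: "open ?N" unfolding N_eq
    by (rule continuous_open_preimage[OF continuous_on_inve[OF ac(4)] ac(2) ab(1)])
  have i: "smooth_on ?N ?i" using lie bA(1) c by (simp add: lie_group_def smooth_map_def)
  let ?\<Omega> = "mul_dom b c d"
  note \<Omega> = mul_coord[OF bA(1) c dA(1)]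
  have param_i: "param b (?i x) = inve (param c x)" if "x \<in> ?N" for x
    using ab(5) that N_eq by auto
  have "(\<lambda>x. (?i x, x)) ` ?N \<subseteq> ?\<Omega>"
    using param_i dA(2) unfolding N_eq by (auto simp: mul_dom_def)
  moreover have "smooth_on ?N (\<lambda>x. (?i x, x))"
    using i Ck_on_Pair[OF N _ Ck_on_id[OF N]] unfolding smooth_on_def by blast
  ultimately have sm: "smooth_on ?N (\<lambda>x. mul_deriv b c d (?i x, x) e)"
    using smooth_on_compose[OF N \<Omega>(1) _ _ smooth_on_derivative[OF \<Omega>(2)]] by blast
  \<comment> \<open>Invariance moves the evaluation to the fixed point \<open>one\<close>. The
    functional there does not depend on \<open>x\<close>; all dependence on \<open>x\<close> sits in
    \<open>mul_deriv\<close>, which expresses the differential of translation by the inverse of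
    \<open>param c x\<close>.\<close>
  let ?L = "\<lambda>w. invariant_form one (coord_vector A d one w)"
  have L: "bounded_linear ?L" using invariant_form_linear[OF d] by (rule linear_fd_bounded)
  have "Ck_on k ?N (\<lambda>x. mul_deriv b c d (?i x, x) e)" using sm unfolding smooth_on_def by blast
  from Ck_on_bounded_linear[OF L N this] have Ck: "Ck_on k ?N (\<lambda>x. ?L (mul_deriv b c d (?i x, x) e))" .
  have "?L (mul_deriv b c d (?i x, x) e) = coeff_in A invariant_form c e x" if x: "x \<in> ?N" for x
  proof -
    have xc: "x \<in> coord c ` dom_of c" and ib: "inve (param c x) \<in> dom_of b" using x N_eq by auto
    note cx = chart_at_param[OF c xc]
    let ?p = "param c x"
    have bi: "b \<in> charts_at A (inve ?p)" using ib bA by (simp add: charts_at_def)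
    have "pullback A A ((\<star>) (inve ?p)) invariant_form ?p (coord_vector A c ?p e) = invariant_form ?p (coord_vector A c ?p e)"
      using left_invariant_form coord_vector_in[OF atlas cx(1)] unfolding left_invariant_def by blast
    then show ?thesis
      using differential_left_mul[OF bi cx(1), of d e] d cx(2) by (simp add: pullback_def coeff_in_def)
  qed
  then have "Ck_on k ?N (coeff_in A invariant_form c e)"
    by (intro iffD1[OF Ck_on_cong[OF N] Ck])
  moreover have "x0 \<in> ?N" using x0 bA unfolding N_eq by simp
  ultimately show "\<exists>U. open U \<and> x0 \<in> U \<and> Ck_on k U (coeff_in A invariant_form c e)" using N by blast
qed

lemma smooth_invariant_form: "smooth_form A invariant_form"
  using one_form_invariant_form smooth_invariant_coeff by (simp add: smooth_form_def)

lemma real_invariant_form: "real_form A invariant_form"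
  by (simp add: real_form_def invariant_form_def)

lemma potential_has_derivative:
  assumes "c \<in> A" "x \<in> coord c ` dom_of c"
  shows "((potential \<circ> param c) has_derivative
    (\<lambda>e. Re (coeff_in A invariant_form c e x) - Re (coeff_in A \<omega> c e x))) (at x)"
  using potential_mderiv[of "param c x"] chart_at_param[OF assms]
  unfolding mderiv_def by (fastforce simp: coeff_in_def invariant_form_def)

text \<open>The first derivative of the potential is a difference of smooth coefficients, which
  yields all higher derivatives.\<close>

lemma smooth_potential:
  assumes "c \<in> A"
  shows "smooth_on (coord c ` dom_of c) (potential \<circ> param c)"
proof (rule smooth_onI_derivative[OF smooth_atlasD(2)[OF atlas assms] potential_has_derivative[OF assms]])
  note op = smooth_atlasD(2)[OF atlas assms]
  show "smooth_on (coord c ` dom_of c) (\<lambda>x. Re (coeff_in A invariant_form c e x) - Re (coeff_in A \<omega> c e x))" for e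
    using smooth assms unfolding smooth_form_def
    by (intro smooth_on_diff op smooth_on_Re smooth_invariant_coeff[OF assms]) blast
qed

text \<open>In a chart the coefficients are the real parts of those of \<omega> plus first
  derivatives of \<open>potential\<close>, whose contribution to the exterior derivative cancels by
  symmetry of second derivatives.\<close>

lemma closed_invariant_form: "closed_form A invariant_form"
  unfolding closed_form_def
proof (intro ballI allI)
  fix c x e e' assume c: "c \<in> A" and x: "x \<in> coord c ` dom_of c"
  note op = smooth_atlasD(2)[OF atlas c]
  let ?f = "potential \<circ> param c" and ?S = "coord c ` dom_of c"
  have coeff: "coeff_in A invariant_form c e y = complex_of_real (Re (coeff_in A \<omega> c e y) + frechet_derivative ?f (at y) e)"
    if "y \<in> ?S" for y e
  proof -
    have "frechet_derivative ?f (at y) e = Re (coeff_in A invariant_form c e y) - Re (coeff_in A \<omega> c e y)"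
      using fun_cong[OF frechet_derivative_at[OF potential_has_derivative[OF c that]], of e] by (rule sym)
    then show ?thesis by (simp add: coeff_in_def invariant_form_def)
  qed
  have s\<omega>: "(\<lambda>x. Re (coeff_in A \<omega> c e x)) differentiable (at x)" and s\<omega>': "coeff_in A \<omega> c e differentiable (at x)" for e
    using smooth c x smooth_on_differentiable smooth_on_Re[OF op] unfolding smooth_form_def by blast+
  have sf: "(\<lambda>y. frechet_derivative ?f (at y) e) differentiable (at x)" for e
    using smooth_on_differentiable[OF smooth_on_derivative[OF smooth_potential[OF c]] x] .
  have D: "frechet_derivative (coeff_in A invariant_form c e) (at x) e' = complex_of_real
      (Re (frechet_derivative (coeff_in A \<omega> c e) (at x) e') + frechet_derivative (\<lambda>y. frechet_derivative ?f (at y) e) (at x) e')" for e e'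
  proof -
    have "((\<lambda>y. complex_of_real (Re (coeff_in A \<omega> c e y) + frechet_derivative ?f (at y) e)) has_derivative
      (\<lambda>v. complex_of_real (frechet_derivative (\<lambda>y. Re (coeff_in A \<omega> c e y)) (at x) v + frechet_derivative (\<lambda>y. frechet_derivative ?f (at y) e) (at x) v))) (at x)"
      using s\<omega> sf frechet_derivative_works by (intro has_derivative_of_real has_derivative_add) blast+
    note D = fun_cong[OF frechet_derivative_at[OF this], of e', symmetric]
    have "frechet_derivative (coeff_in A invariant_form c e) (at x) =
        frechet_derivative (\<lambda>y. complex_of_real (Re (coeff_in A \<omega> c e y) + frechet_derivative ?f (at y) e)) (at x)"
      by (rule frechet_derivative_cong_open[OF op x]) (rule coeff)
    then show ?thesis unfolding D frechet_derivative_Re[OF s\<omega>'] by (simp only: D frechet_derivative_Re[OF s\<omega>'])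
  qed
  have "Ck_on 2 ?S ?f" using smooth_potential[OF c] by (simp add: smooth_on_def)
  from mixed_derivatives_symmetric[OF op x this, of e e']
  have s: "frechet_derivative (\<lambda>y. frechet_derivative ?f (at y) e) (at x) e' = frechet_derivative (\<lambda>y. frechet_derivative ?f (at y) e') (at x) e" .
  have "ext_deriv_in A \<omega> c x e e' = 0" using closed c x unfolding closed_form_def by blast
  then show "ext_deriv_in A invariant_form c x e e' = 0"
    unfolding ext_deriv_in_def D s by simp
qed

end

subsection \<open>Products of atlases\<close>

lemma open_transition_domain:
  assumes "smooth_atlas A" "c \<in> A" "open X"
  shows "open (coord c ` (dom_of c \<inter> X))"
proof -
  note at = smooth_atlasD[OF assms(1,2)]
  have "coord c ` (dom_of c \<inter> X) = coord c ` dom_of c \<inter> param c -` X"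
  proof (intro equalityI subsetI)
    fix x assume x: "x \<in> coord c ` dom_of c \<inter> param c -` X"
    then have "x = coord c (param c x)" "param c x \<in> dom_of c \<inter> X" using at(6,7) by auto
    then show "x \<in> coord c ` (dom_of c \<inter> X)" by (rule image_eqI)
  qed (use at(5) in auto)
  then show ?thesis using continuous_open_preimage[OF at(4,2) assms(3)] by simp
qed

lemma smooth_atlas_prod:
  fixes A :: "('a::topological_space, 'e::finite_dim_inner) atlas"
    and B :: "('b::topological_space, 'f::finite_dim_inner) atlas"
  assumes A: "smooth_atlas A" and B: "smooth_atlas B"
  shows "smooth_atlas (prod_atlas A B)"
proof -
  have union: "(\<Union>C\<in>prod_atlas A B. dom_of C) = UNIV"
  proof (intro equalityI subsetI UNIV_I)
    fix z :: "'a \<times> 'b"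
    obtain c d where "c \<in> charts_at A (fst z)" "d \<in> charts_at B (snd z)" using A B by blast
    then have "prod_chart c d \<in> prod_atlas A B" "z \<in> dom_of (prod_chart c d)"
      unfolding prod_atlas_def charts_at_def by (blast, auto simp: mem_Times_iff)
    then show "z \<in> (\<Union>C\<in>prod_atlas A B. dom_of C)" by blast
  qed
  have homeo: "open (dom_of C) \<and> open (coord C ` dom_of C) \<and>
      homeomorphism (dom_of C) (coord C ` dom_of C) (coord C) (param C)" if C: "C \<in> prod_atlas A B" for C
  proof -
    obtain c d where cd: "C = prod_chart c d" "c \<in> A" "d \<in> B" using C unfolding prod_atlas_def by blast
    note ac = smooth_atlasD[OF A cd(2)] and ad = smooth_atlasD[OF B cd(3)]
    have img: "coord C ` dom_of C = coord c ` dom_of c \<times> coord d ` dom_of d"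
      using prod_chart_image[of c d "dom_of c" "dom_of d"] cd(1) by simp
    have par: "param C z = (param c (fst z), param d (snd z))" if "z \<in> coord C ` dom_of C" for z
      using param_prod_chart[OF A B cd(2,3), of "fst z" "snd z"] that unfolding img cd(1) by auto
    have "continuous_on (coord C ` dom_of C) (\<lambda>z. (param c (fst z), param d (snd z)))"
      unfolding img by (intro continuous_intros continuous_on_compose2[OF ac(4)] continuous_on_compose2[OF ad(4)]) auto
    then have "continuous_on (coord C ` dom_of C) (param C)"
      by (rule continuous_on_eq) (simp add: par)
    moreover have "continuous_on (dom_of C) (coord C)"
      unfolding cd(1) map_prod_def case_prod_unfold
      by (auto intro!: continuous_intros continuous_on_compose2[OF ac(3)] continuous_on_compose2[OF ad(3)])
    moreover have "param C (coord C z) = z" if "z \<in> dom_of C" for z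
      using par[of "coord C z"] that ac(5) ad(5) unfolding cd(1) by auto
    ultimately have "homeomorphism (dom_of C) (coord C ` dom_of C) (coord C) (param C)"
      by (intro homeomorphismI) (auto simp: image_iff)
    then show ?thesis unfolding img using open_Times[OF ac(1) ad(1)] open_Times[OF ac(2) ad(2)] by (simp add: cd(1))
  qed
  have trans: "smooth_on (coord C ` (dom_of C \<inter> dom_of C')) (coord C' \<circ> param C)"
    if C: "C \<in> prod_atlas A B" and C': "C' \<in> prod_atlas A B" for C C'
  proof -
    obtain c d where cd: "C = prod_chart c d" "c \<in> A" "d \<in> B" using C unfolding prod_atlas_def by blast
    obtain c' d' where cd': "C' = prod_chart c' d'" "c' \<in> A" "d' \<in> B" using C' unfolding prod_atlas_def by blast
    let ?X = "coord c ` (dom_of c \<inter> dom_of c')" and ?Y = "coord d ` (dom_of d \<inter> dom_of d')"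
    have op: "open ?X" "open ?Y"
      using open_transition_domain[OF A cd(2)] open_transition_domain[OF B cd(3)]
        smooth_atlasD(1)[OF A cd'(2)] smooth_atlasD(1)[OF B cd'(3)] by blast+
    have XY: "coord C ` (dom_of C \<inter> dom_of C') = ?X \<times> ?Y"
      using prod_chart_image[of c d] unfolding cd cd' by (simp add: Times_Int_Times)
    have s: "smooth_on ?X (coord c' \<circ> param c)" "smooth_on ?Y (coord d' \<circ> param d)"
      using A B cd cd' unfolding smooth_atlas_def by blast+
    have "smooth_on (?X \<times> ?Y) (\<lambda>z. ((coord c' \<circ> param c) (fst z), (coord d' \<circ> param d) (snd z)))"
      unfolding smooth_on_def
    proof (intro allI Ck_on_Pair open_Times op)
      fix k
      show "Ck_on k (?X \<times> ?Y) (\<lambda>z. (coord c' \<circ> param c) (fst z))"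
      proof (rule Ck_on_compose[OF open_Times[OF op] op(1) _
          Ck_on_bounded_linear[OF bounded_linear_fst open_Times[OF op] Ck_on_id[OF open_Times[OF op]]]])
        show "Ck_on k ?X (coord c' \<circ> param c)" using s(1) unfolding smooth_on_def by blast
      qed auto
      show "Ck_on k (?X \<times> ?Y) (\<lambda>z. (coord d' \<circ> param d) (snd z))"
      proof (rule Ck_on_compose[OF open_Times[OF op] op(2) _
          Ck_on_bounded_linear[OF bounded_linear_snd open_Times[OF op] Ck_on_id[OF open_Times[OF op]]]])
        show "Ck_on k ?Y (coord d' \<circ> param d)" using s(2) unfolding smooth_on_def by blast
      qed auto
    qed
    then show ?thesis
      unfolding XY
    proof (rule smooth_on_cong[OF open_Times[OF op], rotated])
      show "((coord c' \<circ> param c) (fst z), (coord d' \<circ> param d) (snd z)) = (coord C' \<circ> param C) z" if "z \<in> ?X \<times> ?Y" for z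
      proof -
        have "param C (fst z, snd z) = (param c (fst z), param d (snd z))"
          unfolding cd(1) using that by (intro param_prod_chart[OF A B cd(2,3)]) auto
        then show ?thesis by (simp add: cd'(1))
      qed
    qed
  qed
  show ?thesis unfolding smooth_atlas_def using union homeo trans by blast
qed

lemma charts_at_prod:
  "C \<in> charts_at (prod_atlas A B) P \<longleftrightarrow>
    (\<exists>c d. C = prod_chart c d \<and> c \<in> charts_at A (fst P) \<and> d \<in> charts_at B (snd P))"
  unfolding charts_at_def prod_atlas_def by (auto simp: mem_Times_iff) blast+

lemma prod_chart_in:
  "c \<in> charts_at A (fst P) \<Longrightarrow> d \<in> charts_at B (snd P) \<Longrightarrow> prod_chart c d \<in> charts_at (prod_atlas A B) P"
  unfolding charts_at_prod by blast

lemma prod_projection_has_derivative: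
  fixes A :: "('a::topological_space, 'e::finite_dim_inner) atlas"
    and B :: "('b::topological_space, 'f::finite_dim_inner) atlas"
  assumes A: "smooth_atlas A" and B: "smooth_atlas B"
    and c: "c \<in> charts_at A p" and d: "d \<in> charts_at B q"
  shows "c' \<in> charts_at A p \<Longrightarrow> ((coord c' \<circ> fst \<circ> param (prod_chart c d)) has_derivative
      (\<lambda>z. frechet_derivative (coord c' \<circ> param c) (at (coord c p)) (fst z))) (at (coord (prod_chart c d) (p, q)))"
    and "d' \<in> charts_at B q \<Longrightarrow> ((coord d' \<circ> snd \<circ> param (prod_chart c d)) has_derivative
      (\<lambda>z. frechet_derivative (coord d' \<circ> param d) (at (coord d q)) (snd z))) (at (coord (prod_chart c d) (p, q)))"
proof -
  have cA: "c \<in> A" "p \<in> dom_of c" and dB: "d \<in> B" "q \<in> dom_of d" using c d by (auto simp: charts_at_def)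
  let ?S = "coord c ` dom_of c \<times> coord d ` dom_of d"
  have S: "open ?S" "(coord c p, coord d q) \<in> ?S"
    using smooth_atlasD(2)[OF A cA(1)] smooth_atlasD(2)[OF B dB(1)] cA dB by (auto intro: open_Times)
  have par: "param (prod_chart c d) z = (param c (fst z), param d (snd z))" if "z \<in> ?S" for z
    using param_prod_chart[OF A B cA(1) dB(1), of "fst z" "snd z"] that by auto
  show "((coord c' \<circ> fst \<circ> param (prod_chart c d)) has_derivative
      (\<lambda>z. frechet_derivative (coord c' \<circ> param c) (at (coord c p)) (fst z))) (at (coord (prod_chart c d) (p, q)))"
    if c': "c' \<in> charts_at A p"
  proof -
    have "((coord c' \<circ> param c) has_derivative frechet_derivative (coord c' \<circ> param c) (at (coord c p))) (at (fst (coord c p, coord d q)))"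
      using mdiff_has_derivative[OF mdiff_id[OF A] c c'] by (simp add: o_def)
    from has_derivative_compose[OF bounded_linear_imp_has_derivative[OF bounded_linear_fst] this]
    have "((\<lambda>z. (coord c' \<circ> param c) (fst z)) has_derivative
      (\<lambda>z. frechet_derivative (coord c' \<circ> param c) (at (coord c p)) (fst z))) (at (coord c p, coord d q))" .
    from has_derivative_transform_within_open[OF this S] show ?thesis using par by simp
  qed
  show "((coord d' \<circ> snd \<circ> param (prod_chart c d)) has_derivative
      (\<lambda>z. frechet_derivative (coord d' \<circ> param d) (at (coord d q)) (snd z))) (at (coord (prod_chart c d) (p, q)))"
    if d': "d' \<in> charts_at B q"
  proof -
    have "((coord d' \<circ> param d) has_derivative frechet_derivative (coord d' \<circ> param d) (at (coord d q))) (at (snd (coord c p, coord d q)))"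
      using mdiff_has_derivative[OF mdiff_id[OF B] d d'] by (simp add: o_def)
    from has_derivative_compose[OF bounded_linear_imp_has_derivative[OF bounded_linear_snd] this]
    have "((\<lambda>z. (coord d' \<circ> param d) (snd z)) has_derivative
      (\<lambda>z. frechet_derivative (coord d' \<circ> param d) (at (coord d q)) (snd z))) (at (coord c p, coord d q))" .
    from has_derivative_transform_within_open[OF this S] show ?thesis using par by simp
  qed
qed

text \<open>With the same factor charts on both sides the projections become the linear ones, so the
  components of the coordinate vector can be read off.\<close>

lemma differential_prod_projections:
  fixes A :: "('a::topological_space, 'e::finite_dim_inner) atlas"
    and B :: "('b::topological_space, 'f::finite_dim_inner) atlas"
  assumes A: "smooth_atlas A" and B: "smooth_atlas B"
    and c: "c \<in> charts_at A p" and d: "d \<in> charts_at B q"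
    and v: "v \<in> tangent_space (prod_atlas A B) (p, q)"
  shows "differential (prod_atlas A B) A fst (p, q) v = coord_vector A c p (fst (v (prod_chart c d)))"
    and "differential (prod_atlas A B) B snd (p, q) v = coord_vector B d q (snd (v (prod_chart c d)))"
proof -
  note P = smooth_atlas_prod[OF A B]
  have C: "prod_chart c d \<in> charts_at (prod_atlas A B) (p, q)" using c d by (intro prod_chart_in) auto
  have m1: "mdiff (prod_atlas A B) A fst (p, q)"
    unfolding mdiff_def
  proof (intro conjI ballI)
    fix C e assume "C \<in> charts_at (prod_atlas A B) (p, q)" and e: "e \<in> charts_at A (fst (p, q))"
    then obtain c d where C: "C = prod_chart c d" and cd: "c \<in> charts_at A p" "d \<in> charts_at B q"
      unfolding charts_at_prod fst_conv snd_conv by blast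
    show "(coord e \<circ> fst \<circ> param C) differentiable (at (coord C (p, q)))"
      using prod_projection_has_derivative(1)[OF A B cd, of e] e unfolding C differentiable_def by auto
  qed (intro continuous_intros)
  have m2: "mdiff (prod_atlas A B) B snd (p, q)"
    unfolding mdiff_def
  proof (intro conjI ballI)
    fix C e assume "C \<in> charts_at (prod_atlas A B) (p, q)" and e: "e \<in> charts_at B (snd (p, q))"
    then obtain c d where C: "C = prod_chart c d" and cd: "c \<in> charts_at A p" "d \<in> charts_at B q"
      unfolding charts_at_prod fst_conv snd_conv by blast
    show "(coord e \<circ> snd \<circ> param C) differentiable (at (coord C (p, q)))"
      using prod_projection_has_derivative(2)[OF A B cd, of e] e unfolding C differentiable_def by auto
  qed (intro continuous_intros)
  show "differential (prod_atlas A B) A fst (p, q) v = coord_vector A c p (fst (v (prod_chart c d)))"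
    using differential_eq_coord_vector[OF P A m1 v C, of c] c
      fun_cong[OF frechet_derivative_at[OF prod_projection_has_derivative(1)[OF A B c d c]], of "v (prod_chart c d)"]
    by (simp add: transition_self[OF A c])
  show "differential (prod_atlas A B) B snd (p, q) v = coord_vector B d q (snd (v (prod_chart c d)))"
    using differential_eq_coord_vector[OF P B m2 v C, of d] d
      fun_cong[OF frechet_derivative_at[OF prod_projection_has_derivative(2)[OF A B c d d]], of "v (prod_chart c d)"]
    by (simp add: transition_self[OF B d])
qed

subsection \<open>The torus\<close>

lemma abs_torus_eq_iff:
  "abs_torus x = abs_torus y \<longleftrightarrow> (\<forall>k. \<exists>n::int. x $ k - y $ k = 2 * pi * of_int n)"
  by (rule torus.abs_eq_iff)

lemma abs_rep_torus [simp]: "abs_torus (rep_torus q) = q"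
  using Quotient3_abs_rep[OF Quotient3_torus] .

lemma abs_torus_surj: "\<exists>x. q = abs_torus x"
  by (metis abs_rep_torus)

lemma abs_torus_add_left: "abs_torus x = abs_torus y \<Longrightarrow> abs_torus (x + z) = abs_torus (y + z)"
  by (simp add: abs_torus_eq_iff)

lemma abs_torus_diff: "abs_torus x = abs_torus y \<Longrightarrow> abs_torus (x - y) = abs_torus 0"
  by (simp add: abs_torus_eq_iff)

lemma abs_torus_period: "abs_torus z = abs_torus 0 \<Longrightarrow> abs_torus (x + z) = abs_torus x"
  using abs_torus_add_left[of z 0 x] by (simp add: add.commute)

lemma continuous_abs_torus: "continuous_on UNIV abs_torus"
  by (simp add: continuous_on_open_vimage open_torus_def)

text \<open>The saturation of \<open>W\<close> is the union of its translates by all periods, which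
  is open.\<close>

lemma open_abs_torus_image:
  assumes "open W"
  shows "open (abs_torus ` W)"
proof -
  have "abs_torus -` (abs_torus ` W) = (\<Union>z\<in>{z. abs_torus z = abs_torus 0}. (+) z ` W)"
  proof (intro equalityI subsetI)
    fix x assume "x \<in> abs_torus -` (abs_torus ` W)"
    then obtain w where w: "w \<in> W" "abs_torus x = abs_torus w" by auto
    then show "x \<in> (\<Union>z\<in>{z. abs_torus z = abs_torus 0}. (+) z ` W)"
      using abs_torus_diff by (intro UN_I[of "x - w"] image_eqI[of _ _ w]) auto
  next
    fix x assume "x \<in> (\<Union>z\<in>{z. abs_torus z = abs_torus 0}. (+) z ` W)"
    then obtain z w where z: "abs_torus z = abs_torus 0" and w: "w \<in> W" "x = z + w" by auto
    have "abs_torus x = abs_torus w"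
      using abs_torus_period[OF z, of w] w(2) by (simp add: add.commute)
    then show "x \<in> abs_torus -` (abs_torus ` W)" using w(1) by auto
  qed
  then show ?thesis using assms by (auto simp: open_torus_def intro!: open_translation)
qed

definition torus_patch :: "(real ^ 'm::finite) set \<Rightarrow> bool" where
  "torus_patch W \<longleftrightarrow> open W \<and> inj_on abs_torus W"

abbreviation torus_chart :: "(real ^ 'm::finite) set \<Rightarrow> ('m torus, real ^ 'm) chart" where
  "torus_chart W \<equiv> (abs_torus ` W, inv_into W abs_torus)"

text \<open>Points of a ball of radius \<open>pi\<close> are less than \<open>2 * pi\<close> apart,
  hence so are their coordinates, and the only integer multiple of \<open>2 * pi\<close> in that
  range is 0.\<close>

lemma torus_patch_ball: "torus_patch (ball (x::real^'m::finite) pi)"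
  unfolding torus_patch_def
proof (intro conjI open_ball inj_onI)
  fix y z assume y: "y \<in> ball x pi" and z: "z \<in> ball x pi" and eq: "abs_torus y = abs_torus z"
  have "dist y z < 2 * pi" using dist_triangle_less_add[of y x pi z pi] y z by (simp add: dist_commute)
  have "y $ k = z $ k" for k
  proof -
    obtain n :: int where n: "y $ k - z $ k = 2 * pi * of_int n" using eq abs_torus_eq_iff by blast
    have "\<bar>y $ k - z $ k\<bar> \<le> dist y z" using component_le_norm_cart[of "y - z" k] by (simp add: dist_norm)
    then have "2 * pi * \<bar>of_int n\<bar> \<le> dist y z" using n by (simp add: abs_mult)
    then have "2 * pi * \<bar>of_int n\<bar> < 2 * pi * 1" using \<open>dist y z < 2 * pi\<close> by linarith
    then have "\<bar>of_int n :: real\<bar> < 1" by (rule mult_left_less_imp_less) simp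
    then have "n = 0" by linarith
    then show ?thesis using n by simp
  qed
  then show "y = z" by (simp add: vec_eq_iff)
qed

lemma torus_chart_inverse:
  "torus_patch W \<Longrightarrow> x \<in> W \<Longrightarrow> inv_into W abs_torus (abs_torus x) = x"
  by (simp add: torus_patch_def)

lemma param_torus_chart:
  assumes "torus_patch W" "x \<in> W"
  shows "param (torus_chart W) x = abs_torus x"
  unfolding param_def using assms torus_chart_inverse[OF assms] inj_on_inv_into[of "abs_torus ` W" abs_torus W]
  by (intro inv_into_f_eq) auto

lemma torus_chart_image: "torus_patch W \<Longrightarrow> inv_into W abs_torus ` abs_torus ` W = W"
  using torus_chart_inverse[of W] by (force simp: image_image)

lemma torus_atlas_iff: "t \<in> torus_atlas \<longleftrightarrow> (\<exists>W. torus_patch W \<and> t = torus_chart W)"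
  unfolding torus_atlas_def torus_patch_def by blast

text \<open>The period \<open>z\<close> is found at the one point \<open>x\<close>; by injectivity
  on \<open>W\<close> it remains the right one as long as \<open>y + z\<close> stays in
  \<open>W\<close>. Torus charts composed with the projection are thus local translations.\<close>

lemma torus_chart_local:
  assumes "torus_patch W" "abs_torus x \<in> abs_torus ` W"
  obtains z where "x + z \<in> W" "\<And>y. y + z \<in> W \<Longrightarrow> inv_into W abs_torus (abs_torus y) = y + z"
proof -
  obtain w where w: "w \<in> W" "abs_torus x = abs_torus w" using assms(2) by auto
  have z: "abs_torus (w - x) = abs_torus 0" using w(2) abs_torus_diff by metis
  show ?thesis
  proof (rule that)
    show "x + (w - x) \<in> W" using w by simp
    show "inv_into W abs_torus (abs_torus y) = y + (w - x)" if "y + (w - x) \<in> W" for y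
      using torus_chart_inverse[OF assms(1) that] abs_torus_period[OF z, of y] by simp
  qed
qed

lemma smooth_atlas_torus: "smooth_atlas (torus_atlas :: ('m::finite torus, real ^ 'm) atlas)"
proof -
  let ?T = "torus_atlas :: ('m torus, real ^ 'm) atlas"
  have union: "(\<Union>c\<in>?T. dom_of c) = UNIV"
  proof (intro equalityI subsetI UNIV_I)
    fix q :: "'m torus"
    obtain x where x: "q = abs_torus x" using abs_torus_surj by blast
    have "torus_chart (ball x pi) \<in> ?T" using torus_patch_ball torus_atlas_iff by blast
    moreover have "q \<in> dom_of (torus_chart (ball x pi))" using x by auto
    ultimately show "q \<in> (\<Union>c\<in>?T. dom_of c)" by blast
  qed
  have homeo: "open (dom_of t) \<and> open (coord t ` dom_of t) \<and>
      homeomorphism (dom_of t) (coord t ` dom_of t) (coord t) (param t)" if "t \<in> ?T" for t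
  proof -
    obtain W where W: "torus_patch W" "t = torus_chart W" using \<open>t \<in> ?T\<close> torus_atlas_iff by blast
    have op: "open W" using W(1) by (simp add: torus_patch_def)
    have img: "coord t ` dom_of t = W" using torus_chart_image[OF W(1)] W(2) by simp
    have "continuous_on W (param t)"
      using continuous_on_eq[OF continuous_on_subset[OF continuous_abs_torus subset_UNIV]]
        param_torus_chart[OF W(1)] W(2) by metis
    moreover have "continuous_on (abs_torus ` W) (inv_into W abs_torus)"
      unfolding continuous_on_open_vimage[OF open_abs_torus_image[OF op]]
    proof (intro allI impI)
      fix V :: "(real ^ 'm) set" assume V: "open V"
      have "inv_into W abs_torus -` V \<inter> abs_torus ` W = abs_torus ` (W \<inter> V)"
        using torus_chart_inverse[OF W(1)] by auto
      then show "open (inv_into W abs_torus -` V \<inter> abs_torus ` W)"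
        using open_abs_torus_image[OF open_Int[OF op V]] by simp
    qed
    ultimately have "homeomorphism (dom_of t) W (coord t) (param t)"
      using W param_torus_chart[OF W(1)] torus_chart_inverse[OF W(1)] torus_chart_image[OF W(1)]
      by (intro homeomorphismI) auto
    then show ?thesis using open_abs_torus_image[OF op] op img W(2) by simp
  qed
  have trans: "smooth_on (coord t ` (dom_of t \<inter> dom_of t')) (coord t' \<circ> param t)" if t: "t \<in> ?T" and t': "t' \<in> ?T" for t t'
    unfolding smooth_on_def
  proof (intro allI Ck_on_local)
    fix k x assume x: "x \<in> coord t ` (dom_of t \<inter> dom_of t')"
    obtain W W' where W: "torus_patch W" "t = torus_chart W" and W': "torus_patch W'" "t' = torus_chart W'"
      using t t' torus_atlas_iff by metis
    obtain w where w: "w \<in> W" "abs_torus w \<in> abs_torus ` W'" "x = inv_into W abs_torus (abs_torus w)"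
      using x unfolding W(2) W'(2) by auto
    then have xW: "x \<in> W" "abs_torus x \<in> abs_torus ` W'"
      using torus_chart_inverse[OF W(1) w(1)] by simp_all
    obtain z where z: "x + z \<in> W'" "\<And>y. y + z \<in> W' \<Longrightarrow> inv_into W' abs_torus (abs_torus y) = y + z"
      using torus_chart_local[OF W'(1) xW(2)] by metis
    let ?N = "W \<inter> (\<lambda>y. y + z) -` W'"
    have N: "open ?N" using W(1) W'(1) unfolding torus_patch_def
      by (intro open_Int open_vimage continuous_intros) auto
    have "Ck_on k ?N (\<lambda>y. y + z)" by (intro Ck_on_add N Ck_on_id Ck_on_const)
    moreover have "y + z = (coord t' \<circ> param t) y" if "y \<in> ?N" for y
      using that z(2) param_torus_chart[OF W(1), of y] W(2) W'(2) by simp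
    ultimately have "Ck_on k ?N (coord t' \<circ> param t)"
      by (rule Ck_on_eq[OF N])
    then show "\<exists>U. open U \<and> x \<in> U \<and> Ck_on k U (coord t' \<circ> param t)"
      using N xW(1) z(1) by (intro exI[of _ ?N]) simp
  qed
  show ?thesis unfolding smooth_atlas_def using union homeo trans by blast
qed

lemma torus_transition:
  assumes "t \<in> charts_at torus_atlas q" "t' \<in> charts_at torus_atlas q"
  shows "frechet_derivative (coord t' \<circ> param t) (at (coord t q)) e = e"
proof -
  obtain W W' where W: "torus_patch W" "t = torus_chart W" "q \<in> dom_of t"
    and W': "torus_patch W'" "t' = torus_chart W'" "q \<in> dom_of t'"
    using charts_atD[OF assms(1)] charts_atD[OF assms(2)] unfolding torus_atlas_iff by (elim exE conjE)
  then have q: "q \<in> abs_torus ` W" "q \<in> abs_torus ` W'" by simp_all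
  obtain x where x: "x \<in> W" "q = abs_torus x" using q(1) by blast
  obtain z where z: "x + z \<in> W'" "\<And>y. y + z \<in> W' \<Longrightarrow> inv_into W' abs_torus (abs_torus y) = y + z"
    using torus_chart_local[OF W'(1)] q(2) x(2) by metis
  let ?N = "W \<inter> (\<lambda>y. y + z) -` W'"
  have N: "open ?N" using W(1) W'(1) unfolding torus_patch_def
    by (intro open_Int open_vimage continuous_intros) auto
  have cx: "coord t q = x" using W(2) x torus_chart_inverse[OF W(1)] by simp
  have "frechet_derivative (coord t' \<circ> param t) (at x) = frechet_derivative (\<lambda>y. y + z) (at x)"
    by (rule frechet_derivative_cong_open[OF N]) (use x z W W' param_torus_chart[OF W(1)] in auto)
  moreover have "((\<lambda>y. y + z) has_derivative (\<lambda>e. e)) (at x)" by (auto intro!: derivative_eq_intros)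
  ultimately show ?thesis using cx frechet_derivative_at by metis
qed

text \<open>\<open>dx\<close> is read in the selected chart, but torus transition maps have identity
  derivative, so any torus chart gives the same coordinate.\<close>

lemma tube_form_chart:
  fixes A :: "('a::topological_space, 'e::finite_dim_inner) atlas"
    and \<omega> :: "'m::finite \<Rightarrow> ('a, 'e) form"
  assumes A: "smooth_atlas A" and c: "c \<in> charts_at A p" and t: "t \<in> charts_at torus_atlas q"
    and v: "v \<in> tangent_space (total_atlas A) (p, q)"
  shows "tube_form A \<omega> k (p, q) v =
    complex_of_real (snd (v (prod_chart c t)) $ k) - \<omega> k p (coord_vector A c p (fst (v (prod_chart c t))))"
proof -
  have "coord_vector torus_atlas t q e (chart_at torus_atlas q) = e" for e
    using torus_transition[OF t chart_at_in[OF smooth_atlas_torus]] chart_at_in[OF smooth_atlas_torus, of q]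
    by (simp add: coord_vector_def)
  then show ?thesis
    using differential_prod_projections[OF A smooth_atlas_torus c t v]
    by (simp add: tube_form_def pullback_def dx_def)
qed

subsection \<open>Shearing the torus factor\<close>

text \<open>The representative selected by \<open>rep_torus\<close> does not matter, by
  \<open>shear_abs\<close>: two representatives differ by a period.\<close>

definition shear :: "('a \<Rightarrow> real ^ 'm::finite) \<Rightarrow> 'a \<times> 'm torus \<Rightarrow> 'a \<times> 'm torus" where
  "shear f P = (fst P, abs_torus (rep_torus (snd P) + f (fst P)))"

lemma shear_abs: "shear f (p, abs_torus y) = (p, abs_torus (y + f p))"
  using abs_torus_add_left[OF abs_rep_torus[of "abs_torus y"], of "f p"] by (simp add: shear_def)

lemma shear_shear: "shear f (shear g P) = shear (\<lambda>p. g p + f p) P"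
proof -
  obtain p y where "P = (p, abs_torus y)" using abs_torus_surj by (metis surj_pair)
  then show ?thesis by (simp add: shear_abs add.assoc)
qed

lemma shear_zero [simp]: "shear (\<lambda>p. 0) P = P"
  by (simp add: shear_def)

definition smooth_fun :: "('a::topological_space, 'e::real_normed_vector) atlas \<Rightarrow> ('a \<Rightarrow> 'b::real_normed_vector) \<Rightarrow> bool" where
  "smooth_fun A f \<longleftrightarrow> (\<forall>c\<in>A. smooth_on (coord c ` dom_of c) (f \<circ> param c))"

lemma smooth_fun_continuous:
  assumes A: "smooth_atlas A" and f: "smooth_fun A f"
  shows "continuous_on UNIV f"
proof (rule continuous_on_local)
  fix p
  obtain c where c: "c \<in> A" "p \<in> dom_of c" using chart_at_in[OF A] charts_atD by metis
  note at = smooth_atlasD[OF A c(1)]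
  have "continuous_on (coord c ` dom_of c) (f \<circ> param c)"
    using f c(1) smooth_on_continuous unfolding smooth_fun_def by blast
  from continuous_on_compose2[OF this at(3)] have "continuous_on (dom_of c) (\<lambda>p. (f \<circ> param c) (coord c p))" by blast
  then have "continuous_on (dom_of c) f" by (rule continuous_on_eq) (simp add: at(5))
  then show "\<exists>N. open N \<and> p \<in> N \<and> continuous_on N f" using at(1) c(2) by blast
qed

text \<open>\<open>rep_torus\<close> is an arbitrary selection and carries no continuity, so near a
  point it is replaced by the inverse of the projection on a ball.\<close>

lemma continuous_shear:
  fixes f :: "'a::topological_space \<Rightarrow> real ^ 'm::finite"
  assumes "continuous_on UNIV f"
  shows "continuous_on UNIV (shear f)"
proof (rule continuous_on_local)
  fix P :: "'a \<times> 'm torus"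
  obtain p y where P: "P = (p, abs_torus y)" using abs_torus_surj by (metis surj_pair)
  let ?W = "ball y pi"
  let ?N = "UNIV \<times> abs_torus ` ?W :: ('a \<times> 'm torus) set"
  have t: "torus_chart ?W \<in> torus_atlas" using torus_patch_ball torus_atlas_iff by blast
  have "continuous_on (abs_torus ` ?W) (inv_into ?W abs_torus)"
    using smooth_atlasD(3)[OF smooth_atlas_torus t] by simp
  then have "continuous_on ?N (\<lambda>P. (fst P, abs_torus (inv_into ?W abs_torus (snd P) + f (fst P))))"
    using assms
    by (intro continuous_on_Pair continuous_on_fst continuous_on_id continuous_on_compose2[OF continuous_abs_torus]
        continuous_on_add continuous_on_compose2[OF _ continuous_on_snd[OF continuous_on_id]]
        continuous_on_compose2[OF assms]) auto
  then have "continuous_on ?N (shear f)"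
  proof (rule continuous_on_eq)
    fix Q assume "Q \<in> ?N"
    then obtain w where "w \<in> ?W" "Q = (fst Q, abs_torus w)" by (cases Q) auto
    then show "(fst Q, abs_torus (inv_into ?W abs_torus (snd Q) + f (fst Q))) = shear f Q"
      using shear_abs[of f "fst Q" w] torus_chart_inverse[OF torus_patch_ball, of w y] by (metis snd_conv)
  qed
  moreover have "open ?N" by (intro open_Times open_UNIV open_abs_torus_image open_ball)
  moreover have "P \<in> ?N" using P by auto
  ultimately show "\<exists>N. open N \<and> P \<in> N \<and> continuous_on N (shear f)" by blast
qed

text \<open>The period \<open>z\<close> is constant on \<open>N\<close>, so in charts the shear is a
  transition map in the first factor and an addition in the second. Smoothness and the differential
  are both read off from this formula.\<close>

lemma shear_local:
  fixes A :: "('a::topological_space, 'e::finite_dim_inner) atlas"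
    and f :: "'a \<Rightarrow> real ^ 'm::finite"
  assumes A: "smooth_atlas A" and f: "continuous_on UNIV f" and W: "torus_patch W" "torus_patch W'"
    and c: "c \<in> A" "c' \<in> A" and p: "p \<in> dom_of c" "p \<in> dom_of c'"
    and y: "y \<in> W" "abs_torus (y + f p) \<in> abs_torus ` W'"
  obtains N z where "open N" "(coord c p, y) \<in> N" "N \<subseteq> coord c ` (dom_of c \<inter> dom_of c') \<times> W"
    "\<And>x y. (x, y) \<in> N \<Longrightarrow> (coord (prod_chart c' (torus_chart W')) \<circ> shear f \<circ> param (prod_chart c (torus_chart W))) (x, y) =
      ((coord c' \<circ> param c) x, y + (f \<circ> param c) x + z)"
proof -
  obtain z where z: "(y + f p) + z \<in> W'" "\<And>u. u + z \<in> W' \<Longrightarrow> inv_into W' abs_torus (abs_torus u) = u + z"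
    using torus_chart_local[OF W(2) y(2)] by metis
  note at = smooth_atlasD[OF A c(1)]
  let ?X = "coord c ` (dom_of c \<inter> dom_of c')"
  let ?N = "(?X \<times> W) \<inter> (\<lambda>u. snd u + f (param c (fst u)) + z) -` W'"
  have X: "open ?X" by (rule open_transition_domain[OF A c(1) smooth_atlasD(1)[OF A c(2)]])
  have tW: "torus_chart W \<in> torus_atlas" using W(1) torus_atlas_iff by blast
  have "?X \<subseteq> coord c ` dom_of c" by blast
  then have "continuous_on (?X \<times> W) (\<lambda>u. f (param c (fst u)))"
    by (intro continuous_on_compose2[OF f] continuous_on_compose2[OF at(4)] continuous_intros) auto
  then have "continuous_on (?X \<times> W) (\<lambda>u. snd u + f (param c (fst u)) + z)"
    by (intro continuous_intros)
  then have N: "open ?N"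
    using W X unfolding torus_patch_def by (intro continuous_open_preimage open_Times) auto
  show ?thesis
  proof (rule that[OF N])
    show "(coord c p, y) \<in> ?N" using p y(1) z(1) at(5) by auto
    show "?N \<subseteq> ?X \<times> W" by blast
    fix x u assume xu: "(x, u) \<in> ?N"
    then have x: "x \<in> coord c ` dom_of c" and u: "u \<in> W" "u + f (param c x) + z \<in> W'" by auto
    have "param (prod_chart c (torus_chart W)) (x, u) = (param c x, abs_torus u)"
      using param_prod_chart[OF A smooth_atlas_torus c(1) tW x, of u] torus_chart_image[OF W(1)] u(1)
        param_torus_chart[OF W(1) u(1)] by simp
    then show "(coord (prod_chart c' (torus_chart W')) \<circ> shear f \<circ> param (prod_chart c (torus_chart W))) (x, u) =
      ((coord c' \<circ> param c) x, u + (f \<circ> param c) x + z)"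
      using z(2)[OF u(2)] by (simp add: shear_abs)
  qed
qed

lemma smooth_shear:
  fixes A :: "('a::topological_space, 'e::finite_dim_inner) atlas"
    and f :: "'a \<Rightarrow> real ^ 'm::finite"
  assumes A: "smooth_atlas A" and f: "smooth_fun A f"
  shows "smooth_map (total_atlas A) (total_atlas A) (shear f)"
  unfolding smooth_map_def
proof (intro conjI ballI)
  note cf = smooth_fun_continuous[OF A f]
  show "continuous_on UNIV (shear f)" by (rule continuous_shear[OF cf])
  fix C D :: "('a \<times> 'm torus, 'e \<times> (real ^ 'm)) chart"
  assume "C \<in> total_atlas A" "D \<in> total_atlas A"
  obtain c W where C: "C = prod_chart c (torus_chart W)" "c \<in> A" "torus_patch W"
    using \<open>C \<in> total_atlas A\<close> unfolding prod_atlas_def mem_Collect_eq torus_atlas_iff by (elim exE conjE) simp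
  obtain c' W' where D: "D = prod_chart c' (torus_chart W')" "c' \<in> A" "torus_patch W'"
    using \<open>D \<in> total_atlas A\<close> unfolding prod_atlas_def mem_Collect_eq torus_atlas_iff by (elim exE conjE) simp
  show "smooth_on (coord C ` (dom_of C \<inter> shear f -` dom_of D)) (coord D \<circ> shear f \<circ> param C)"
    unfolding smooth_on_def
  proof (intro allI Ck_on_local)
    fix k u assume "u \<in> coord C ` (dom_of C \<inter> shear f -` dom_of D)"
    then obtain p y where py: "p \<in> dom_of c" "y \<in> W" "shear f (p, abs_torus y) \<in> dom_of D" "u = coord C (p, abs_torus y)"
      unfolding C(1) by auto
    have u: "u = (coord c p, y)" using py(2,4) torus_chart_inverse[OF C(3)] by (simp add: C(1))
    have p': "p \<in> dom_of c'" "abs_torus (y + f p) \<in> abs_torus ` W'" using py(3) by (auto simp: D(1) shear_abs)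
    obtain N z where N: "open N" "(coord c p, y) \<in> N" "N \<subseteq> coord c ` (dom_of c \<inter> dom_of c') \<times> W"
      "\<And>x y. (x, y) \<in> N \<Longrightarrow> (coord D \<circ> shear f \<circ> param C) (x, y) = ((coord c' \<circ> param c) x, y + (f \<circ> param c) x + z)"
      using shear_local[OF A cf C(3) D(3) C(2) D(2) py(1) p'(1) py(2) p'(2)] unfolding C(1) D(1) by metis
    let ?X = "coord c ` (dom_of c \<inter> dom_of c')"
    have X: "open ?X" by (rule open_transition_domain[OF A C(2) smooth_atlasD(1)[OF A D(2)]])
    have fstN: "fst ` N \<subseteq> ?X" using N(3) by auto
    note Ck_fst = Ck_on_bounded_linear[OF bounded_linear_fst N(1) Ck_on_id[OF N(1)]]
    note Ck_snd = Ck_on_bounded_linear[OF bounded_linear_snd N(1) Ck_on_id[OF N(1)]]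
    have "Ck_on k ?X (coord c' \<circ> param c)" using A C(2) D(2) unfolding smooth_atlas_def smooth_on_def by blast
    then have 1: "Ck_on k N (\<lambda>u. (coord c' \<circ> param c) (fst u))"
      by (rule Ck_on_compose[OF N(1) X fstN Ck_fst])
    have "Ck_on k ?X (f \<circ> param c)"
      by (rule Ck_on_subset[of _ "coord c ` dom_of c"]) (use f C(2) in \<open>auto simp: smooth_fun_def smooth_on_def\<close>)
    then have 2: "Ck_on k N (\<lambda>u. (f \<circ> param c) (fst u))"
      by (rule Ck_on_compose[OF N(1) X fstN Ck_fst])
    have "Ck_on k N (\<lambda>u. ((coord c' \<circ> param c) (fst u), snd u + (f \<circ> param c) (fst u) + z))"
      by (intro Ck_on_Pair Ck_on_add N(1) 1 2 Ck_snd Ck_on_const)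
    moreover have "((coord c' \<circ> param c) (fst u), snd u + (f \<circ> param c) (fst u) + z) = (coord D \<circ> shear f \<circ> param C) u" if "u \<in> N" for u
      using N(4)[of "fst u" "snd u"] that by simp
    ultimately have "Ck_on k N (coord D \<circ> shear f \<circ> param C)"
      by (rule Ck_on_eq[OF N(1)])
    then show "\<exists>U. open U \<and> u \<in> U \<and> Ck_on k U (coord D \<circ> shear f \<circ> param C)"
      using N(1,2) u by blast
  qed
qed

lemma smooth_fun_minus:
  "smooth_atlas A \<Longrightarrow> smooth_fun A f \<Longrightarrow> smooth_fun A (\<lambda>p. - f p)"
  unfolding smooth_fun_def smooth_on_def o_def
  using Ck_on_bounded_linear[OF bounded_linear_minus[OF bounded_linear_ident]] smooth_atlasD(2) by blast

lemma inv_shear: "inv (shear f) = shear (\<lambda>p. - f p)"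
  by (rule inv_unique_comp) (simp_all add: fun_eq_iff shear_shear)

lemma diffeomorphism_shear:
  fixes A :: "('a::topological_space, 'e::finite_dim_inner) atlas"
    and f :: "'a \<Rightarrow> real ^ 'm::finite"
  assumes "smooth_atlas A" "smooth_fun A f"
  shows "diffeomorphism (total_atlas A) (total_atlas A) (shear f)"
proof -
  have "bij (shear f)"
    by (rule o_bij[of "shear (\<lambda>p. - f p)"]) (simp_all add: fun_eq_iff shear_shear)
  then show ?thesis
    using smooth_shear assms smooth_fun_minus unfolding diffeomorphism_def inv_shear by blast
qed

text \<open>The shear preserves the first coordinate of a point, so the same chart \<open>c\<close>
  is used on both sides and the first component of the vector is unchanged.\<close>

lemma differential_shear_chart:
  fixes A :: "('a::topological_space, 'e::finite_dim_inner) atlas"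
    and f :: "'a \<Rightarrow> real ^ 'm::finite"
  assumes A: "smooth_atlas A" and f: "smooth_fun A f"
    and c: "c \<in> charts_at A p" and t: "t \<in> charts_at torus_atlas q" and t': "t' \<in> charts_at torus_atlas (snd (shear f (p, q)))"
    and v: "v \<in> tangent_space (total_atlas A) (p, q)"
  shows "differential (total_atlas A) (total_atlas A) (shear f) (p, q) v (prod_chart c t') =
    (fst (v (prod_chart c t)), snd (v (prod_chart c t)) +
      frechet_derivative (f \<circ> param c) (at (coord c p)) (fst (v (prod_chart c t))))"
proof -
  note T = smooth_atlas_prod[OF A smooth_atlas_torus]
  have cA: "c \<in> A" "p \<in> dom_of c" using c by (auto simp: charts_at_def)
  obtain W W' where W: "torus_patch W" "t = torus_chart W" "q \<in> dom_of t"
    and W': "torus_patch W'" "t' = torus_chart W'" "snd (shear f (p, q)) \<in> dom_of t'"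
    using charts_atD[OF t] charts_atD[OF t'] unfolding torus_atlas_iff by (elim exE conjE)
  then have q: "q \<in> abs_torus ` W" "snd (shear f (p, q)) \<in> abs_torus ` W'" by simp_all
  obtain y where y: "y \<in> W" "q = abs_torus y" using q(1) by blast
  let ?C = "prod_chart c t" and ?D = "prod_chart c t'"
  let ?F = "frechet_derivative (f \<circ> param c) (at (coord c p))"
  have CD: "?C \<in> charts_at (total_atlas A) (p, q)" "?D \<in> charts_at (total_atlas A) (shear f (p, q))"
    using c t t' by (intro prod_chart_in; simp add: shear_def)+
  have "abs_torus (y + f p) \<in> abs_torus ` W'" using q(2) y(2) by (simp add: shear_abs)
  then obtain N z where N: "open N" "(coord c p, y) \<in> N" "N \<subseteq> coord c ` (dom_of c \<inter> dom_of c) \<times> W"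
      "\<And>x y. (x, y) \<in> N \<Longrightarrow> (coord ?D \<circ> shear f \<circ> param ?C) (x, y) = ((coord c \<circ> param c) x, y + (f \<circ> param c) x + z)"
    using shear_local[OF A smooth_fun_continuous[OF A f] W(1) W'(1) cA(1) cA(1) cA(2) cA(2) y(1)] unfolding W(2) W'(2) by metis
  have "((f \<circ> param c) has_derivative ?F) (at (fst (coord c p, y)))"
    using smooth_on_differentiable[of "coord c ` dom_of c" "f \<circ> param c" "coord c p"] f cA frechet_derivative_works
    unfolding smooth_fun_def by auto
  from has_derivative_compose[OF bounded_linear_imp_has_derivative[OF bounded_linear_fst] this]
  have "((\<lambda>u. (f \<circ> param c) (fst u)) has_derivative (\<lambda>u. ?F (fst u))) (at (coord c p, y))" .
  then have "((\<lambda>u. (fst u, snd u + (f \<circ> param c) (fst u) + z)) has_derivative (\<lambda>u. (fst u, snd u + ?F (fst u)))) (at (coord c p, y))"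
    by (auto intro!: derivative_eq_intros)
  then have D: "((coord ?D \<circ> shear f \<circ> param ?C) has_derivative (\<lambda>u. (fst u, snd u + ?F (fst u)))) (at (coord c p, y))"
  proof (rule has_derivative_transform_within_open[OF _ N(1,2)])
    fix u assume u: "u \<in> N"
    then have "fst u \<in> coord c ` dom_of c" using N(3) by auto
    then show "(fst u, snd u + (f \<circ> param c) (fst u) + z) = (coord ?D \<circ> shear f \<circ> param ?C) u"
      using N(4)[of "fst u" "snd u"] u smooth_atlasD(6)[OF A cA(1)] by simp
  qed
  have CP: "coord ?C (p, q) = (coord c p, y)" using y torus_chart_inverse[OF W(1)] W(2) by simp
  show ?thesis
    using differential_chart[OF T T smooth_map_mdiff[OF smooth_shear[OF A f]] v CD]
    unfolding CP frechet_derivative_at[OF D, symmetric] .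
qed

text \<open>The pullback of \<open>dx_k - \<omega>'_k\<close> under the shear is
  \<open>dx_k + df_k - \<omega>'_k\<close>, and \<open>df_k = \<omega>'_k - \<omega>_k\<close>.
  Reality of the forms enters because the assumption \<open>df\<close> controls their real parts
  only.\<close>

lemma tube_form_shear:
  fixes A :: "('a::topological_space, 'e::finite_dim_inner) atlas"
    and f :: "'a \<Rightarrow> real ^ 'm::finite"
  assumes A: "smooth_atlas A" and f: "smooth_fun A f"
    and df: "\<And>k p. mderiv A (\<lambda>p. f p $ k) p (\<lambda>v. Re (\<omega>' k p v) - Re (\<omega> k p v))"
    and real: "\<And>k. real_form A (\<omega> k)" "\<And>k. real_form A (\<omega>' k)"
    and v: "v \<in> tangent_space (total_atlas A) P"
  shows "tube_form A \<omega>' k (shear f P) (differential (total_atlas A) (total_atlas A) (shear f) P v) = tube_form A \<omega> k P v"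
proof -
  note T = smooth_atlas_prod[OF A smooth_atlas_torus]
  obtain p q where P: "P = (p, q)" by (cases P)
  obtain q' where sP: "shear f P = (p, q')" by (simp add: shear_def P)
  obtain c where c: "c \<in> charts_at A p" using A by blast
  obtain t where t: "t \<in> charts_at torus_atlas q" using smooth_atlas_torus by blast
  obtain t' where t': "t' \<in> charts_at torus_atlas q'" using smooth_atlas_torus by blast
  have cA: "c \<in> A" "p \<in> dom_of c" using c by (auto simp: charts_at_def)
  let ?w = "differential (total_atlas A) (total_atlas A) (shear f) P v"
  let ?F = "frechet_derivative (f \<circ> param c) (at (coord c p))" and ?e = "fst (v (prod_chart c t))"
  have w: "?w \<in> tangent_space (total_atlas A) (p, q')"
    using differential_in[OF T T smooth_map_mdiff[OF smooth_shear[OF A f]] v] sP by simp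
  have wD: "?w (prod_chart c t') = (?e, snd (v (prod_chart c t)) + ?F ?e)"
    using differential_shear_chart[OF A f c t, of t' v] t' v sP unfolding P by simp
  have "((f \<circ> param c) has_derivative ?F) (at (coord c p))"
    using smooth_on_differentiable[of "coord c ` dom_of c" "f \<circ> param c" "coord c p"] f cA frechet_derivative_works
    unfolding smooth_fun_def by auto
  from bounded_linear.has_derivative[OF bounded_linear_vec_nth this, of k]
  have d1: "(((\<lambda>p. f p $ k) \<circ> param c) has_derivative (\<lambda>e. ?F e $ k)) (at (coord c p))" by (simp add: o_def)
  have d2: "(((\<lambda>p. f p $ k) \<circ> param c) has_derivative
      (\<lambda>e. Re (\<omega>' k p (coord_vector A c p e)) - Re (\<omega> k p (coord_vector A c p e)))) (at (coord c p))"
    using df[of k p] c unfolding mderiv_def by blast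
  have Fk: "?F e $ k = Re (\<omega>' k p (coord_vector A c p e)) - Re (\<omega> k p (coord_vector A c p e))" for e
    using fun_cong[OF has_derivative_unique[OF d1 d2], of e] .
  have r: "complex_of_real (Re (\<omega> k p (coord_vector A c p e))) = \<omega> k p (coord_vector A c p e)"
    "complex_of_real (Re (\<omega>' k p (coord_vector A c p e))) = \<omega>' k p (coord_vector A c p e)" for e
    using real coord_vector_in[OF A c] unfolding real_form_def by (simp_all add: of_real_Re)
  show ?thesis
    using tube_form_chart[OF A c t', of ?w \<omega>' k] tube_form_chart[OF A c t, of v \<omega> k] w v wD
    unfolding sP by (simp add: P Fk r)
qed

lemma tube_structure_shear:
  fixes A :: "('a::topological_space, 'e::finite_dim_inner) atlas"
    and f :: "'a \<Rightarrow> real ^ 'm::finite"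
  assumes A: "smooth_atlas A" and f: "smooth_fun A f"
    and df: "\<And>k p. mderiv A (\<lambda>p. f p $ k) p (\<lambda>v. Re (\<omega>' k p v) - Re (\<omega> k p v))"
    and real: "\<And>k. real_form A (\<omega> k)" "\<And>k. real_form A (\<omega>' k)"
  shows "cdifferential (total_atlas A) (total_atlas A) (shear f) P ` tube_structure A \<omega> P
    \<subseteq> tube_structure A \<omega>' (shear f P)"
proof
  note T = smooth_atlas_prod[OF A smooth_atlas_torus]
  note m = smooth_map_mdiff[OF smooth_shear[OF A f]]
  fix Z' assume "Z' \<in> cdifferential (total_atlas A) (total_atlas A) (shear f) P ` tube_structure A \<omega> P"
  then obtain u v where Z: "(u, v) \<in> tube_structure A \<omega> P" "Z' = cdifferential (total_atlas A) (total_atlas A) (shear f) P (u, v)"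
    by auto
  then have uv: "u \<in> tangent_space (total_atlas A) P" "v \<in> tangent_space (total_atlas A) P"
    by (auto simp: tube_structure_def ctangent_space_def)
  then show "Z' \<in> tube_structure A \<omega>' (shear f P)"
    using Z differential_in[OF T T m] tube_form_shear[OF A f df real uv(1)] tube_form_shear[OF A f df real uv(2)]
    by (simp add: tube_structure_def ctangent_space_def cdifferential_def capply_def)
qed

text \<open>The shear by \<open>- f\<close> exchanges the roles of the two families, so the
  inclusion for arbitrary shears also yields the reverse one, without a dimension count.\<close>

lemma equivalent_tube_structures_shear:
  fixes A :: "('a::topological_space, 'e::finite_dim_inner) atlas"
    and f :: "'a \<Rightarrow> real ^ 'm::finite"
  assumes A: "smooth_atlas A" and f: "smooth_fun A f"
    and df: "\<And>k p. mderiv A (\<lambda>p. f p $ k) p (\<lambda>v. Re (\<omega>' k p v) - Re (\<omega> k p v))"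
    and real: "\<And>k. real_form A (\<omega> k)" "\<And>k. real_form A (\<omega>' k)"
  shows "equivalent_structures (total_atlas A) (tube_structure A \<omega>) (tube_structure A \<omega>')"
proof -
  note T = smooth_atlas_prod[OF A smooth_atlas_torus]
  let ?d = "\<lambda>f. cdifferential (total_atlas A) (total_atlas A) (shear f)"
  let ?g = "\<lambda>p. - f p"
  have g: "smooth_fun A ?g" using smooth_fun_minus[OF A f] .
  have dg: "mderiv A (\<lambda>p. ?g p $ k) p (\<lambda>v. Re (\<omega> k p v) - Re (\<omega>' k p v))" for k p
    using mderiv_diff[OF mderiv_const[of A 0] df[of k p]] by simp
  have "?d f P ` tube_structure A \<omega> P = tube_structure A \<omega>' (shear f P)" for P
  proof (rule equalityI[OF tube_structure_shear[OF A f df real]], rule subsetI)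
    fix Z assume Z: "Z \<in> tube_structure A \<omega>' (shear f P)"
    have undo: "shear ?g (shear f P) = P" by (simp add: shear_shear)
    have comp: "shear f \<circ> shear ?g = (\<lambda>Q. Q)" by (simp add: fun_eq_iff shear_shear)
    have inv: "differential (total_atlas A) (total_atlas A) (shear f) P
        (differential (total_atlas A) (total_atlas A) (shear ?g) (shear f P) v) = v"
      if "v \<in> tangent_space (total_atlas A) (shear f P)" for v
      using differential_comp[OF T T T smooth_map_mdiff[OF smooth_shear[OF A g]] smooth_map_mdiff[OF smooth_shear[OF A f]] that]
        differential_id[OF T that] unfolding comp undo by simp
    have "?d ?g (shear f P) Z \<in> tube_structure A \<omega> P"
      using tube_structure_shear[OF A g dg real(2,1), of "shear f P"] Z unfolding undo by blast
    moreover have "Z = ?d f P (?d ?g (shear f P) Z)"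
      using Z inv by (cases Z) (simp add: tube_structure_def ctangent_space_def cdifferential_def)
    ultimately show "Z \<in> ?d f P ` tube_structure A \<omega> P" by blast
  qed
  then show ?thesis unfolding equivalent_structures_def using diffeomorphism_shear[OF A f] by blast
qed

theorem corollary7p3:
  fixes A :: "('a::{t2_space,second_countable_topology}, 'e::finite_dim_inner) atlas"
    and mul :: "'a \<Rightarrow> 'a \<Rightarrow> 'a" and one :: 'a and inve :: "'a \<Rightarrow> 'a"
    and \<omega> :: "'m::finite \<Rightarrow> ('a, 'e) form"
  assumes "lie_group A mul one inve"
    and "compact (UNIV :: 'a set)" and "connected (UNIV :: 'a set)"
    and "\<And>k. smooth_form A (\<omega> k)" and "\<And>k. closed_form A (\<omega> k)" and "\<And>k. real_form A (\<omega> k)"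
  shows "\<exists>\<omega>' :: 'm \<Rightarrow> ('a, 'e) form.
    (\<forall>k. smooth_form A (\<omega>' k) \<and> closed_form A (\<omega>' k) \<and> real_form A (\<omega>' k) \<and>
         left_invariant A mul (\<omega>' k)) \<and>
    equivalent_structures (total_atlas A) (tube_structure A \<omega>) (tube_structure A \<omega>')"
proof -
  have loc: "closed_form_on_group A mul one inve (\<omega> k)" for k
    using assms by unfold_locales auto
  have A: "smooth_atlas A" using assms(1) by (simp add: lie_group_def)
  define \<omega>' where "\<omega>' k = closed_form_on_group.invariant_form A mul (\<omega> k)" for k
  define F where "F k = closed_form_on_group.potential A mul one (\<omega> k)" for k
  \<comment> \<open>One potential per form, assembled as a sum over the axes so that closure of
    \<open>Ck_on\<close> under sums gives smoothness.\<close>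
  define f :: "'a \<Rightarrow> real ^ 'm" where "f p = (\<Sum>k\<in>UNIV. F k p *\<^sub>R axis k 1)" for p
  have fk: "f p $ k = F k p" for p k
    by (simp add: f_def axis_def if_distrib cong: if_cong)
  have "smooth_fun A f"
    unfolding smooth_fun_def smooth_on_def
  proof (intro ballI allI)
    fix c n assume c: "c \<in> A"
    note op = smooth_atlasD(2)[OF A c]
    have "Ck_on n (coord c ` dom_of c) (\<lambda>x. (F k \<circ> param c) x)" for k
      using closed_form_on_group.smooth_potential[OF loc c] unfolding smooth_on_def F_def o_def by blast
    then show "Ck_on n (coord c ` dom_of c) (f \<circ> param c)"
      unfolding f_def o_def by (intro Ck_on_sum Ck_on_scaleR op Ck_on_const) simp
  qed
  moreover have "mderiv A (\<lambda>p. f p $ k) p (\<lambda>v. Re (\<omega>' k p v) - Re (\<omega> k p v))" for k p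
    using closed_form_on_group.potential_mderiv[OF loc, of k p]
    by (simp add: fk \<omega>'_def F_def closed_form_on_group.invariant_form_def[OF loc])
  moreover have inv: "smooth_form A (\<omega>' k) \<and> closed_form A (\<omega>' k) \<and> real_form A (\<omega>' k) \<and> left_invariant A mul (\<omega>' k)" for k
    unfolding \<omega>'_def
    using closed_form_on_group.smooth_invariant_form[OF loc] closed_form_on_group.closed_invariant_form[OF loc]
      closed_form_on_group.real_invariant_form[OF loc] closed_form_on_group.left_invariant_form[OF loc] by blast
  ultimately have "equivalent_structures (total_atlas A) (tube_structure A \<omega>) (tube_structure A \<omega>')"
    using assms(6) by (intro equivalent_tube_structures_shear[OF A]) blast+
  then show ?thesis using inv by blast
qed

end
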